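(* Under the local alternatives $K_{(n)}: H\beta=h+n^{-1/2}\xi$ and the regularity assumptions (A1), (A2) (model, estimators, statistics and assumptions as in the context), the following hold as $n\to\infty$. (i) If $C$ is a nonsingular matrix and $\lambda_n/n\to\lambda_0\ge 0$, then $\hat\beta_n^{L}\to \operatorname{argmin}(Z)$ in probability, where $$Z(\phi)=(\phi-\beta)^TC(\phi-\beta)+\lambda_0\sum_{j=1}^p|\phi_j|,\qquad \phi\in\mathbb{R}^p.$$ With $Z$ and the condition on $\lambda_n$ as in (i): (ii) $\hat\beta_n^{RL}\to \operatorname{argmin}(Z)-C^{-1}H^T(HC^{-1}H^T)^{-1}(H\operatorname{argmin}(Z)-h)$ in probability. (iii) $\hat\beta_n^{L}-\hat\beta_n^{RL}\to C^{-1}H^T(HC^{-1}H^T)^{-1}(H\operatorname{argmin}(Z)-h)$ in probability. (iv) $\hat\beta_n^{PTL}\to \operatorname{argmin}(Z)-C^{-1}H^T(HC^{-1}H^T)^{-1}(H\operatorname{argmin}(Z)-h)\,I(\mathcal{L}<\mathcal{L}_\alpha)$ in probability, where $$\mathcal{L}=\sigma^{-2}(HW+\xi)^T(HC^{-1}H^T)^{-1}(HW+\xi),\qquad W\sim N_p(0,\sigma^2C),$$ and $\mathcal{L}_\alpha$ is the upper ($\alpha$-level) critical value of the chi-squared distribution with $q$ degrees of freedom. (v) $\hat\beta_n^{SSL}\to \operatorname{argmin}(Z)-k\,C^{-1}H^T(HC^{-1}H^T)^{-1}(H\operatorname{argmin}(Z)-h)\,\mathcal{L}^{-1}$ in distribution,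 with $k=q-2$. (vi) $\hat\beta_n^{PRSSL}\to \operatorname{argmin}(Z)-\left\{k\mathcal{L}^{-1}+(1-k\mathcal{L}^{-1})I(\mathcal{L}<k)\right\}C^{-1}H^T(HC^{-1}H^T)^{-1}(H\operatorname{argmin}(Z)-h)$ in distribution.
   Context: Model: $Y_n=X_n\beta+\epsilon_n$, where $\beta\in\mathbb{R}^p$ is an unknown vector, $X_n$ is a given $n\times p$ design matrix of full rank with rows $x_1^T,\dots,x_n^T$, and $E(\epsilon_n)=0$, $E(\epsilon_n\epsilon_n^T)=\sigma^2I_n$ with $\sigma^2<\infty$. Put $C_n=X_n^TX_n$. OLS: $\tilde\beta_n=C_n^{-1}X_n^TY_n$, $m=n-p$, $s_e^2=m^{-1}(Y_n-X_n\tilde\beta_n)^T(Y_n-X_n\tilde\beta_n)$. It is taken that $\tilde\beta_n\sim N_p(\beta,\sigma^2C_n^{-1})$, independent of $ms_e^2/\sigma^2$, which is central chi-squared with $m$ degrees of freedom. Regularity assumptions: (A1) $\max_{1\le i\le n}x_i^TC_n^{-1}x_i\to0$ as $n\to\infty$; (A2) $\lim_{n\to\infty}n^{-1}C_n=C$, where $C$ is finite and positive definite. Restriction: $H$ is a known $q\times p$ matrix of rank $q\le p$, $h$ is a known $q\times1$ vector, and the null hypothesis is $\mathcal{H}_o: H\beta=h$. The local alternatives are $K_{(n)}: H\beta=h+n^{-1/2}\xi$ with $\xi\in\mathbb{R}^q$. LASSO: $\hat\beta_n^L=\operatorname{argmin}_{b\in\mathbb{R}^p}\{\sum_{i=1}^n(Y_i-x_i^Tb)^2+\lambda_n\sum_{j=1}^p|b_j|\}$,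 $\lambda_n\ge0$. Restricted LASSO: $\hat\beta_n^{RL}=\hat\beta_n^L-C_n^{-1}H^T(HC_n^{-1}H^T)^{-1}(H\hat\beta_n^L-h)$. Test statistic: $\mathcal{L}_n=s_e^{-2}(H\tilde\beta_n-h)^T(HC_n^{-1}H^T)^{-1}(H\tilde\beta_n-h)$; $\mathcal{L}_{n,\alpha}$ is the upper $\alpha$-level critical value of the exact distribution of $\mathcal{L}_n$ under $\mathcal{H}_o$. Preliminary test LASSO: $\hat\beta_n^{PTL}=\hat\beta_n^L-(\hat\beta_n^L-\hat\beta_n^{RL})I(\mathcal{L}_n\le\mathcal{L}_{n,\alpha})$. Stein-type shrinkage LASSO: $\hat\beta_n^{SSL}=\hat\beta_n^L-k_n(\hat\beta_n^L-\hat\beta_n^{RL})\mathcal{L}_n^{-1}$, with $k_n=m(q-2)/(m+2)$. Positive-rule Stein-type shrinkage LASSO: $\hat\beta_n^{PRSSL}=\hat\beta_n^{RL}+(1-k_n\mathcal{L}_n^{-1})I(\mathcal{L}_n>k_n)(\hat\beta_n^L-\hat\beta_n^{RL})$. $I(\cdot)$ is the indicator function.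
   Formalization: W has covariance σ²C^{-1}, not σ²C; the true parameter is β_n → β with Hβ_n = h + n^{-1/2}ξ; (iv) is convergence in distribution, plus in probability with I(L_n ≤ L_{n,α}) in place of I(L < L_α), since the printed forms fail. *)

theory Defs
  imports "HOL-Probability.Probability"
begin

text \<open>
  Regression data of sample size \<open>n\<close> are functions on \<open>nat\<close> of which only the indices
  \<open>i < n\<close> are used: \<open>x i\<close> is the \<open>i\<close>-th row of the design matrix \<open>X\<^sub>n\<close> and \<open>y i\<close> the
  \<open>i\<close>-th response.  The inverse \<open>matrix_inv\<close> is meaningful only for invertible
  matrices, the residual variance only for \<open>n > p\<close>; statements about these
  quantities are therefore to be restricted to \<open>n > p\<close> or to be asymptotic in \<open>n\<close>.
\<close>

definition gram :: "nat \<Rightarrow> (nat \<Rightarrow> real^'p) \<Rightarrow> real^'p^'p" where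
  "gram n x = (\<chi> j k. \<Sum>i<n. x i $ j * x i $ k)"  \<comment> \<open>\<open>C\<^sub>n = X\<^sub>n\<^sup>T X\<^sub>n\<close>\<close>

definition ols :: "nat \<Rightarrow> (nat \<Rightarrow> real^'p) \<Rightarrow> (nat \<Rightarrow> real) \<Rightarrow> real^'p" where
  "ols n x y = matrix_inv (gram n x) *v (\<Sum>i<n. y i *\<^sub>R x i)"

definition resid_var :: "nat \<Rightarrow> (nat \<Rightarrow> real^'p) \<Rightarrow> (nat \<Rightarrow> real) \<Rightarrow> real" where
  "resid_var n x y = (\<Sum>i<n. (y i - x i \<bullet> ols n x y)\<^sup>2) / real (n - CARD('p))"

definition positive_definite :: "real^'p^'p \<Rightarrow> bool" where
  "positive_definite A \<longleftrightarrow> transpose A = A \<and> (\<forall>v. v \<noteq> 0 \<longrightarrow> v \<bullet> (A *v v) > 0)"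

definition lasso :: "nat \<Rightarrow> (nat \<Rightarrow> real^'p) \<Rightarrow> real \<Rightarrow> (nat \<Rightarrow> real) \<Rightarrow> real^'p" where
  "lasso n x lam y =
     (ARG_MIN (\<lambda>b. (\<Sum>i<n. (y i - x i \<bullet> b)\<^sup>2) + lam * (\<Sum>j\<in>UNIV. \<bar>b $ j\<bar>)) b. True)"

definition restr_gain :: "real^'p^'p \<Rightarrow> real^'p^'q \<Rightarrow> real^'q^'p" where
  "restr_gain A H =
     matrix_inv A ** transpose H ** matrix_inv (H ** matrix_inv A ** transpose H)"

definition restricted_lasso ::
  "nat \<Rightarrow> (nat \<Rightarrow> real^'p) \<Rightarrow> real^'p^'q \<Rightarrow> real^'q \<Rightarrow> real \<Rightarrow> (nat \<Rightarrow> real) \<Rightarrow> real^'p" where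
  "restricted_lasso n x H h lam y =
     lasso n x lam y - restr_gain (gram n x) H *v (H *v lasso n x lam y - h)"

definition test_stat ::
  "nat \<Rightarrow> (nat \<Rightarrow> real^'p) \<Rightarrow> real^'p^'q \<Rightarrow> real^'q \<Rightarrow> (nat \<Rightarrow> real) \<Rightarrow> real" where
  "test_stat n x H h y =
     ((H *v ols n x y - h) \<bullet>
       (matrix_inv (H ** matrix_inv (gram n x) ** transpose H) *v (H *v ols n x y - h)))
     / resid_var n x y"

definition pt_lasso ::
  "nat \<Rightarrow> (nat \<Rightarrow> real^'p) \<Rightarrow> real^'p^'q \<Rightarrow> real^'q \<Rightarrow> real \<Rightarrow> real \<Rightarrow> (nat \<Rightarrow> real) \<Rightarrow> real^'p"
where  \<comment> \<open>\<open>c\<close> is the critical value of the test\<close>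
  "pt_lasso n x H h lam c y =
     lasso n x lam y
     - of_bool (test_stat n x H h y \<le> c) *\<^sub>R (lasso n x lam y - restricted_lasso n x H h lam y)"

definition shrink_const :: "nat \<Rightarrow> nat \<Rightarrow> nat \<Rightarrow> real" where
  "shrink_const n p q = real (n - p) * (real q - 2) / (real (n - p) + 2)"

definition ss_lasso ::
  "nat \<Rightarrow> (nat \<Rightarrow> real^'p) \<Rightarrow> real^'p^'q \<Rightarrow> real^'q \<Rightarrow> real \<Rightarrow> (nat \<Rightarrow> real) \<Rightarrow> real^'p" where
  "ss_lasso n x H h lam y =
     lasso n x lam y
     - (shrink_const n CARD('p) CARD('q) * inverse (test_stat n x H h y))
         *\<^sub>R (lasso n x lam y - restricted_lasso n x H h lam y)"

definition prss_lasso ::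
  "nat \<Rightarrow> (nat \<Rightarrow> real^'p) \<Rightarrow> real^'p^'q \<Rightarrow> real^'q \<Rightarrow> real \<Rightarrow> (nat \<Rightarrow> real) \<Rightarrow> real^'p" where
  "prss_lasso n x H h lam y =
     restricted_lasso n x H h lam y
     + ((1 - shrink_const n CARD('p) CARD('q) * inverse (test_stat n x H h y))
         * of_bool (test_stat n x H h y > shrink_const n CARD('p) CARD('q)))
         *\<^sub>R (lasso n x lam y - restricted_lasso n x H h lam y)"

text \<open>Density of \<open>N\<^sub>p(\<mu>, S)\<close> for a positive definite covariance matrix \<open>S\<close>.\<close>

definition mvn_density :: "real^'p \<Rightarrow> real^'p^'p \<Rightarrow> real^'p \<Rightarrow> real" where
  "mvn_density \<mu> S v =
     exp (- ((v - \<mu>) \<bullet> (matrix_inv S *v (v - \<mu>))) / 2) / sqrt ((2 * pi) ^ CARD('p) * det S)"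

definition has_mvn :: "'w measure \<Rightarrow> ('w \<Rightarrow> real^'p) \<Rightarrow> real^'p \<Rightarrow> real^'p^'p \<Rightarrow> bool" where
  "has_mvn M X \<mu> S \<longleftrightarrow> distributed M lborel X (\<lambda>v. ennreal (mvn_density \<mu> S v))"

text \<open>Independence; \<open>indep_var\<close> requires both variables to have the same type.\<close>

definition indep_rvs ::
  "'w measure \<Rightarrow> ('w \<Rightarrow> 'a::topological_space) \<Rightarrow> ('w \<Rightarrow> 'b::topological_space) \<Rightarrow> bool" where
  "indep_rvs M X V \<longleftrightarrow>
     X \<in> borel_measurable M \<and> V \<in> borel_measurable M \<and>
     (\<forall>A\<in>sets borel. \<forall>B\<in>sets borel.
        measure M {\<omega> \<in> space M. X \<omega> \<in> A \<and> V \<omega> \<in> B} =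
        measure M {\<omega> \<in> space M. X \<omega> \<in> A} * measure M {\<omega> \<in> space M. V \<omega> \<in> B})"

text \<open>Law of the sum of squares of \<open>k\<close> independent standard normal variables.\<close>

definition chi_squared :: "nat \<Rightarrow> real measure" where
  "chi_squared k =
     distr (Pi\<^sub>M {..<k} (\<lambda>_. density lborel (\<lambda>t. ennreal (std_normal_density t)))) borel
       (\<lambda>z. \<Sum>i<k. (z i)\<^sup>2)"

text \<open>
  Upper \<open>\<alpha>\<close>-level critical value, i.e. the \<open>(1 - \<alpha>)\<close>-quantile.  If the law has no atoms
  and \<open>0 < \<alpha> < 1\<close>, it is a point \<open>c\<close> at which the mass of \<open>{c<..}\<close> is exactly \<open>\<alpha>\<close>.
\<close>

definition upper_crit :: "real measure \<Rightarrow> real \<Rightarrow> real" where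
  "upper_crit \<mu> \<alpha> = Inf {c. measure \<mu> {c<..} \<le> \<alpha>}"

text \<open>
  Both modes of convergence require measurability (for all large \<open>n\<close>), because
  \<open>measure\<close> and the Bochner integral default to \<open>0\<close> on non-measurable arguments.
\<close>

definition conv_in_prob ::
  "'w measure \<Rightarrow> (nat \<Rightarrow> 'w \<Rightarrow> 'a::euclidean_space) \<Rightarrow> ('w \<Rightarrow> 'a) \<Rightarrow> bool" where
  "conv_in_prob M X Y \<longleftrightarrow>
     (\<forall>\<^sub>F n in sequentially. X n \<in> borel_measurable M) \<and> Y \<in> borel_measurable M \<and>
     (\<forall>e>0. (\<lambda>n. measure M {\<omega> \<in> space M. dist (X n \<omega>) (Y \<omega>) > e}) \<longlonglongrightarrow> 0)"

definition conv_in_distr ::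
  "'w measure \<Rightarrow> (nat \<Rightarrow> 'w \<Rightarrow> 'a::euclidean_space) \<Rightarrow> 'v measure \<Rightarrow> ('v \<Rightarrow> 'a) \<Rightarrow> bool" where
  "conv_in_distr M X N Y \<longleftrightarrow>
     (\<forall>\<^sub>F n in sequentially. X n \<in> borel_measurable M) \<and> Y \<in> borel_measurable N \<and>
     (\<forall>f :: 'a \<Rightarrow> real. continuous_on UNIV f \<and> bounded (range f) \<longrightarrow>
        (\<lambda>n. \<integral>\<omega>. f (X n \<omega>) \<partial>M) \<longlonglongrightarrow> (\<integral>v. f (Y v) \<partial>N))"

end

theory Submission
  imports Defs "HOL-Real_Asymp.Real_Asymp"
begin

text \<open>
  Everything in sight is a function of two statistics.  Write \<open>S\<^sub>n = n\<^sup>-\<^sup>1 C\<^sub>n\<close>.  Completing the square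
  around the least squares estimator turns the LASSO criterion into
  \<open>n ((b - u) \<bullet> S\<^sub>n (b - u) + (\<lambda>\<^sub>n / n) \<Sum>\<bar>b\<^sub>j\<bar>)\<close> plus a constant, with \<open>u\<close> the least squares estimator
  (\<open>lasso_eq_penalized_min\<close>).  With \<open>V\<^sub>n = n\<^sup>1\<^sup>/\<^sup>2 (u - \<beta>\<^sub>n)\<close> and \<open>s\<^sub>n\<close> the residual variance, all the
  estimators and the test statistic are therefore of the form \<open>G\<^sub>n (V\<^sub>n, s\<^sub>n)\<close> with deterministic \<open>G\<^sub>n\<close>;
  under the local alternatives the test statistic is a quadratic form in \<open>H V\<^sub>n + \<xi>\<close> divided by \<open>s\<^sub>n\<close>
  (\<open>test_stat_eq_wald_stat\<close>).

  The two statistics behave as well as possible.  \<open>V\<^sub>n\<close> has the density of \<open>N(0, \<sigma>\<^sup>2 S\<^sub>n\<^sup>-\<^sup>1)\<close>, which converges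
  pointwise to that of \<open>W\<close>; by Scheffe's lemma the laws converge in total variation
  (\<open>conv_strong_densities\<close>).  \<open>s\<^sub>n\<close> is \<open>\<sigma>\<^sup>2\<close> times a chi-squared variable over its degrees of freedom and
  tends to \<open>\<sigma>\<^sup>2\<close> in probability by Chebyshev's inequality.  Because
  the second limit is constant, an extended continuous mapping theorem (\<open>extended_continuous_mapping\<close>) gives
  \<open>G\<^sub>n (V\<^sub>n, s\<^sub>n) \<Rightarrow> g (W)\<close> as soon as \<open>G\<^sub>n (v\<^sub>n, t\<^sub>n) \<longlongrightarrow> g (v)\<close> whenever \<open>v\<^sub>n \<longlongrightarrow> v\<close> and \<open>t\<^sub>n \<longlongrightarrow> \<sigma>\<^sup>2\<close>, for
  all \<open>v\<close> outside a closed null set.  Statements on convergence in probability are the case of constant \<open>g\<close>.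

  It remains to check this deterministic convergence.  The penalized minimizer depends continuously on
  \<open>(S, u, \<lambda>)\<close> because the criterion grows quadratically away from its minimum
  (\<open>tendsto_penalized_min\<close>); the point \<open>u = \<beta>\<^sub>n + n\<^sup>-\<^sup>1\<^sup>/\<^sup>2 v\<^sub>n\<close> tends to \<open>\<beta>\<close>.  The indicators and the inverse of
  the test statistic are discontinuous only on level sets of a quadratic form, which are null sets
  (\<open>negligible_wald_stat_level\<close>).

  The preliminary test estimator also needs the critical values to converge.  The same mapping theorem,
  applied under the null hypothesis, shows that the survival functions of the statistic converge to
  that of the form with \<open>\<xi> = 0\<close>, whose law is chi-squared with \<open>q\<close> degrees of freedom
  (\<open>wald_stat_law\<close>): in a basis that is orthonormal for \<open>C\<close> and adapted to the kernel of \<open>H\<close>, the form is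
  a sum of \<open>q\<close> squared standard normal coordinates.  Quantiles then converge because the
  chi-squared law charges every interval in the half line (\<open>upper_crit_tendsto\<close>).
\<close>

section \<open>Matrices: limits, inverses and coercivity\<close>

lemma norm_matrix_vector_mult_le:
  fixes A :: "real^'n^'m"
  shows "norm (A *v v) \<le> norm A * norm v"
proof -
  have "norm (A *v v) = L2_set (\<lambda>i. norm ((A *v v) $ i)) UNIV"
    by (simp add: norm_vec_def)
  also have "\<dots> \<le> L2_set (\<lambda>i. norm (A $ i) * norm v) UNIV"
    by (rule L2_set_mono)
      (auto simp: matrix_vector_mul_component intro: order_trans[OF Cauchy_Schwarz_ineq2])
  also have "\<dots> = norm A * norm v"
    by (simp add: L2_set_left_distrib norm_vec_def)
  finally show ?thesis .
qed

lemma bounded_bilinear_matrix_vector_mult: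
  "bounded_bilinear ((*v) :: real^'n^'m \<Rightarrow> _)"
proof
  show "\<exists>K. \<forall>(a::real^'n^'m) b. norm (a *v b) \<le> norm a * norm b * K"
    using norm_matrix_vector_mult_le by (intro exI[of _ 1]) auto
qed (auto simp: matrix_vector_mult_add_rdistrib matrix_vector_right_distrib
       scaleR_matrix_vector_assoc matrix_vector_mult_scaleR)

lemmas tendsto_matrix_vector_mult [tendsto_intros] =
  bounded_bilinear.tendsto[OF bounded_bilinear_matrix_vector_mult]

lemma tendsto_matrix_mult [tendsto_intros]:
  fixes A :: "'a \<Rightarrow> real^'n^'m" and B :: "'a \<Rightarrow> real^'k^'n"
  assumes "(A \<longlongrightarrow> A\<^sub>0) F" "(B \<longlongrightarrow> B\<^sub>0) F"
  shows "((\<lambda>t. A t ** B t) \<longlongrightarrow> A\<^sub>0 ** B\<^sub>0) F"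
  unfolding matrix_matrix_mult_def using assms by (intro vec_tendstoI) (auto intro!: tendsto_intros)

lemma tendsto_det [tendsto_intros]:
  fixes A :: "'a \<Rightarrow> real^'n^'n"
  assumes "(A \<longlongrightarrow> A\<^sub>0) F"
  shows "((\<lambda>t. det (A t)) \<longlongrightarrow> det A\<^sub>0) F"
  unfolding det_def by (intro tendsto_intros tendsto_vec_nth assms)

lemma matrix_inv_cancel:
  fixes A :: "real^'n^'n"
  assumes "invertible A"
  shows "A ** matrix_inv A = mat 1" "matrix_inv A ** A = mat 1"
  using assms someI_ex[of "\<lambda>B. A ** B = mat 1 \<and> B ** A = mat 1"]
  unfolding invertible_def matrix_inv_def by auto

lemma matrix_inv_unique:
  fixes A B :: "real^'n^'n"
  assumes "A ** B = mat 1"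
  shows "matrix_inv A = B"
proof -
  have "B ** A = mat 1" using assms by (simp add: matrix_left_right_inverse)
  then have "invertible A" using assms unfolding invertible_def by blast
  then have "matrix_inv A ** (A ** B) = B"
    by (simp add: matrix_mul_assoc matrix_inv_cancel)
  then show ?thesis by (simp add: assms)
qed

lemma matrix_inv_scaleR:
  fixes A :: "real^'n^'n"
  assumes "invertible A" "c \<noteq> 0"
  shows "matrix_inv (c *\<^sub>R A) = (1 / c) *\<^sub>R matrix_inv A"
  by (rule matrix_inv_unique)
    (use assms in \<open>simp add: matrix_inv_cancel scalar_matrix_assoc matrix_scalar_ac\<close>)

text \<open>
  Cramer's rule writes the entries of the inverse as quotients of determinants.
\<close>

lemma tendsto_matrix_inv:
  fixes A :: "'a \<Rightarrow> real^'n^'n"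
  assumes lim: "(A \<longlongrightarrow> A\<^sub>0) F" and inv: "invertible A\<^sub>0"
  shows "((\<lambda>t. matrix_inv (A t)) \<longlongrightarrow> matrix_inv A\<^sub>0) F"
proof -
  define R where "R B i j = det (\<chi> k l. if l = i then axis j 1 $ k else B $ k $ l) / det B"
    for B :: "real^'n^'n" and i j
  have cram: "matrix_inv B = (\<chi> i j. R B i j)" if "det B \<noteq> 0" for B :: "real^'n^'n"
  proof -
    have "invertible B" using that by (simp add: invertible_det_nz)
    then have eq: "B *v (matrix_inv B *v axis j 1) = axis j 1" for j
      by (simp add: matrix_vector_mul_assoc matrix_inv_cancel)
    have "matrix_inv B *v axis j 1 = (\<chi> i. R B i j)" for j
      using eq[of j] unfolding cramer[OF that] R_def by simp
    then have "column j (matrix_inv B) = (\<chi> i. R B i j)" for j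
      by (simp add: matrix_vector_mult_basis)
    then show ?thesis by (simp add: vec_eq_iff column_def)
  qed
  have d: "det A\<^sub>0 \<noteq> 0" using inv by (simp add: invertible_det_nz)
  have "((\<lambda>t. \<chi> i j. R (A t) i j) \<longlongrightarrow> (\<chi> i j. R A\<^sub>0 i j)) F"
  proof (intro vec_tendstoI, simp)
    fix i j :: 'n
    have "((\<lambda>t. \<chi> k l. if l = i then axis j 1 $ k else A t $ k $ l)
             \<longlongrightarrow> (\<chi> k l. if l = i then axis j 1 $ k else A\<^sub>0 $ k $ l)) F"
    proof (intro vec_tendstoI, unfold vec_lambda_beta)
      fix k l :: 'n
      show "((\<lambda>t. if l = i then axis j 1 $ k else A t $ k $ l)
               \<longlongrightarrow> (if l = i then axis j 1 $ k else A\<^sub>0 $ k $ l)) F"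
        by (cases "l = i") (simp_all add: tendsto_vec_nth[OF tendsto_vec_nth[OF lim]])
    qed
    then show "((\<lambda>t. R (A t) i j) \<longlongrightarrow> R A\<^sub>0 i j) F"
      unfolding R_def by (intro tendsto_divide tendsto_det lim d)
  qed
  moreover have "\<forall>\<^sub>F t in F. det (A t) \<noteq> 0"
    using tendsto_imp_eventually_ne[OF tendsto_det[OF lim] d] .
  then have "\<forall>\<^sub>F t in F. (\<chi> i j. R (A t) i j) = matrix_inv (A t)"
    by (rule eventually_mono) (simp add: cram)
  ultimately have "((\<lambda>t. matrix_inv (A t)) \<longlongrightarrow> (\<chi> i j. R A\<^sub>0 i j)) F"
    by (rule Lim_transform_eventually)
  then show ?thesis by (simp add: cram[OF d])
qed

text \<open>
  Positive definiteness with an explicit constant: unlike mere positivity it survives small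
  perturbations, with a uniform constant.
\<close>

definition coercive :: "real \<Rightarrow> real^'n^'n \<Rightarrow> bool" where
  "coercive c A \<longleftrightarrow> 0 < c \<and> (\<forall>v. c * (norm v)\<^sup>2 \<le> v \<bullet> (A *v v))"

lemma coerciveD: "coercive c A \<Longrightarrow> c * (norm v)\<^sup>2 \<le> v \<bullet> (A *v v)" "coercive c A \<Longrightarrow> 0 < c"
  by (auto simp: coercive_def)

lemma coercive_pos: "coercive c A \<Longrightarrow> v \<noteq> 0 \<Longrightarrow> 0 < v \<bullet> (A *v v)"
  by (rule less_le_trans[OF _ coerciveD(1)]) (simp_all add: coerciveD(2))

lemma coercive_invertible:
  fixes A :: "real^'n^'n"
  assumes "coercive c A"
  shows "invertible A"
proof -
  have "v = 0" if "A *v v = 0" for v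
    using coercive_pos[OF assms, of v] that by fastforce
  then show ?thesis
    by (simp add: invertible_left_inverse matrix_left_invertible_ker)
qed

text \<open>
  The constant is the minimum of the quadratic form on the compact unit sphere.
\<close>

lemma positive_definite_coercive:
  fixes A :: "real^'n^'n"
  assumes "positive_definite A"
  obtains c where "coercive c A"
proof -
  let ?S = "sphere 0 1 :: (real^'n) set"
  have cont: "continuous_on ?S (\<lambda>v. v \<bullet> (A *v v))"
    by (intro continuous_intros)
  obtain w where w: "w \<in> ?S" "\<And>v. v \<in> ?S \<Longrightarrow> w \<bullet> (A *v w) \<le> v \<bullet> (A *v v)"
    using continuous_attains_inf[OF compact_sphere _ cont] by (metis sphere_eq_empty not_one_less_zero)
  have "coercive (w \<bullet> (A *v w)) A" unfolding coercive_def
  proof (intro conjI allI)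
    have "w \<noteq> 0" using w(1) by auto
    then show "0 < w \<bullet> (A *v w)" using assms by (auto simp: positive_definite_def)
    fix v
    show "w \<bullet> (A *v w) * (norm v)\<^sup>2 \<le> v \<bullet> (A *v v)"
    proof (cases "v = 0")
      case False
      then have "w \<bullet> (A *v w) \<le> (v /\<^sub>R norm v) \<bullet> (A *v (v /\<^sub>R norm v))"
        by (intro w(2)) simp
      also have "\<dots> = (v \<bullet> (A *v v)) / (norm v)\<^sup>2"
        by (simp add: matrix_vector_mult_scaleR divide_inverse power2_eq_square)
      finally show ?thesis using False by (simp add: field_simps)
    qed simp
  qed
  then show thesis by (rule that)
qed

lemma coercive_perturb:
  fixes A :: "'a \<Rightarrow> real^'n^'n"
  assumes lim: "(A \<longlongrightarrow> A\<^sub>0) F" and c: "coercive c A\<^sub>0"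
  shows "\<forall>\<^sub>F t in F. coercive (c / 2) (A t)"
proof -
  have "0 < c" using c by (rule coerciveD)
  then have "\<forall>\<^sub>F t in F. dist (A t) A\<^sub>0 < c / 2" using lim by (intro tendstoD) auto
  then show ?thesis
  proof (rule eventually_mono)
    fix t assume t: "dist (A t) A\<^sub>0 < c / 2"
    show "coercive (c / 2) (A t)" unfolding coercive_def
    proof (intro conjI allI)
      fix v
      have "\<bar>v \<bullet> ((A t - A\<^sub>0) *v v)\<bar> \<le> norm v * (norm (A t - A\<^sub>0) * norm v)"
        using norm_matrix_vector_mult_le[of "A t - A\<^sub>0" v]
        by (intro order_trans[OF Cauchy_Schwarz_ineq2] mult_left_mono) auto
      also have "\<dots> = norm (A t - A\<^sub>0) * (norm v)\<^sup>2"
        by (simp add: power2_eq_square)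
      also have "\<dots> \<le> c / 2 * (norm v)\<^sup>2"
        using t by (intro mult_right_mono) (auto simp: dist_norm)
      finally have "- (c / 2 * (norm v)\<^sup>2) \<le> v \<bullet> ((A t - A\<^sub>0) *v v)"
        by linarith
      then show "c / 2 * (norm v)\<^sup>2 \<le> v \<bullet> (A t *v v)"
        using coerciveD(1)[OF c, of v]
        by (simp add: matrix_vector_mult_diff_rdistrib inner_diff_right)
    qed (use \<open>0 < c\<close> in simp)
  qed
qed

section \<open>Stability of the penalized least squares minimizer\<close>

text \<open>
  The LASSO criterion after division by the sample size and removal of the residual sum of squares;
  for \<open>S = C\<close>, \<open>u = \<beta>\<close>, \<open>l = \<lambda>\<^sub>0\<close> it is the limit criterion \<open>Z\<close>.
\<close>

definition penalized :: "real^'p^'p \<Rightarrow> real^'p \<Rightarrow> real \<Rightarrow> real^'p \<Rightarrow> real" where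
  "penalized S u l b = (b - u) \<bullet> (S *v (b - u)) + l * (\<Sum>j\<in>UNIV. \<bar>b $ j\<bar>)"

definition penalized_min :: "real^'p^'p \<Rightarrow> real^'p \<Rightarrow> real \<Rightarrow> real^'p" where
  "penalized_min S u l = (ARG_MIN (penalized S u l) b. True)"

lemma symmetric_form_commute:
  fixes A :: "real^'n^'n"
  assumes "transpose A = A"
  shows "a \<bullet> (A *v b) = b \<bullet> (A *v a)"
  by (metis assms dot_lmul_matrix inner_commute transpose_matrix_vector)

lemmas continuous_on_matrix_vector_mult [continuous_intros] =
  bounded_bilinear.continuous_on[OF bounded_bilinear_matrix_vector_mult]

lemma continuous_penalized: "continuous_on A (penalized S u l)"
  unfolding penalized_def by (intro continuous_intros)

text \<open>
  \<open>penalized_min\<close> is a choice, so existence of a minimizer has to be shown: outside a large ball the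
  criterion exceeds its value at \<open>u\<close>.
\<close>

lemma penalized_has_min:
  assumes S: "coercive c S" and l: "0 \<le> l"
  shows "penalized S u l (penalized_min S u l) \<le> penalized S u l b"
proof -
  have c: "0 < c" using S by (rule coerciveD)
  let ?r = "sqrt (penalized S u l u / c)"
  have nn: "0 \<le> (b - u) \<bullet> (S *v (b - u))" for b
    by (rule order_trans[OF _ coerciveD(1)[OF S]]) (use c in simp)
  have nonneg: "0 \<le> penalized S u l u"
    by (simp add: penalized_def l sum_nonneg)
  have lower: "c * (norm (b - u))\<^sup>2 \<le> penalized S u l b" for b
    using coerciveD(1)[OF S, of "b - u"] l by (simp add: penalized_def add_increasing2 sum_nonneg)
  \<comment> \<open>Outside the ball of radius \<open>?r\<close> the quadratic part alone exceeds the value of the criterion at \<open>u\<close>.\<close>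
  obtain b\<^sub>0 where b\<^sub>0: "b\<^sub>0 \<in> cball u ?r" "\<And>b. b \<in> cball u ?r \<Longrightarrow> penalized S u l b\<^sub>0 \<le> penalized S u l b"
    using continuous_attains_inf[OF compact_cball _ continuous_penalized, of u ?r S u l] nonneg c
    by (metis cball_eq_empty divide_nonneg_pos not_less real_sqrt_ge_zero)
  have "penalized S u l b\<^sub>0 \<le> penalized S u l b" for b
  proof (cases "b \<in> cball u ?r")
    case False
    then have "?r < norm (b - u)" by (simp add: dist_norm norm_minus_commute)
    then have "penalized S u l u / c < (norm (b - u))\<^sup>2"
      by (metis norm_ge_zero not_le real_le_rsqrt)
    then have "penalized S u l u < penalized S u l b"
      using lower[of b] c by (simp add: field_simps)
    moreover have "penalized S u l b\<^sub>0 \<le> penalized S u l u"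
      using nonneg c by (intro b\<^sub>0) simp
    ultimately show ?thesis by simp
  qed (rule b\<^sub>0)
  then have "is_arg_min (penalized S u l) (\<lambda>_. True) b\<^sub>0"
    by (auto simp: is_arg_min_def not_less)
  then have "is_arg_min (penalized S u l) (\<lambda>_. True) (penalized_min S u l)"
    unfolding penalized_min_def arg_min_def by (rule someI)
  then show ?thesis by (auto simp: is_arg_min_def not_less)
qed

text \<open>
  The parallelogram identity for the quadratic part and convexity of the penalty.
\<close>

lemma penalized_midpoint:
  assumes l: "0 \<le> l"
  shows "penalized S u l ((1/2) *\<^sub>R (a + b))
           \<le> penalized S u l a / 2 + penalized S u l b / 2 - (b - a) \<bullet> (S *v (b - a)) / 4"
proof -
  define v w where "v = a - u" and "w = b - u"
  have eqs: "(1/2) *\<^sub>R (a + b) - u = (1/2) *\<^sub>R (v + w)" "b - a = w - v"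
    by (simp_all add: v_def w_def algebra_simps vec_eq_iff)
  have quad: "((1/2) *\<^sub>R (v + w)) \<bullet> (S *v ((1/2) *\<^sub>R (v + w)))
      = v \<bullet> (S *v v) / 2 + w \<bullet> (S *v w) / 2 - (w - v) \<bullet> (S *v (w - v)) / 4"
    by (simp add: matrix_vector_mult_scaleR matrix_vector_right_distrib
          matrix_vector_mult_diff_distrib inner_add_left inner_add_right
          inner_diff_left inner_diff_right)
       (simp add: field_simps)
  have "(\<Sum>j\<in>UNIV. \<bar>((1/2) *\<^sub>R (a + b)) $ j\<bar>) \<le> (\<Sum>j\<in>UNIV. \<bar>a $ j\<bar> / 2 + \<bar>b $ j\<bar> / 2)"
    by (rule sum_mono) (use abs_triangle_ineq in \<open>simp add: field_simps\<close>)
  also have "\<dots> = (\<Sum>j\<in>UNIV. \<bar>a $ j\<bar>) / 2 + (\<Sum>j\<in>UNIV. \<bar>b $ j\<bar>) / 2"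
    by (simp add: sum.distrib sum_divide_distrib)
  finally have "l * (\<Sum>j\<in>UNIV. \<bar>((1/2) *\<^sub>R (a + b)) $ j\<bar>)
      \<le> l * ((\<Sum>j\<in>UNIV. \<bar>a $ j\<bar>) / 2 + (\<Sum>j\<in>UNIV. \<bar>b $ j\<bar>) / 2)"
    by (rule mult_left_mono) (rule l)
  also have "\<dots> = l * (\<Sum>j\<in>UNIV. \<bar>a $ j\<bar>) / 2 + l * (\<Sum>j\<in>UNIV. \<bar>b $ j\<bar>) / 2"
    by (simp only: distrib_left times_divide_eq_right)
  finally show ?thesis
    unfolding penalized_def eqs quad v_def[symmetric] w_def[symmetric] by argo
qed

text \<open>
  Apply the midpoint inequality to \<open>b\<close> and the minimizer: the midpoint cannot lie below the minimum.
\<close>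

lemma penalized_growth:
  assumes S: "coercive c S" and l: "0 \<le> l"
  shows "c / 2 * (norm (b - penalized_min S u l))\<^sup>2
           \<le> penalized S u l b - penalized S u l (penalized_min S u l)"
  using penalized_has_min[OF S l, of u "(1/2) *\<^sub>R (penalized_min S u l + b)"]
    penalized_midpoint[OF l, of S u "penalized_min S u l" b]
    coerciveD(1)[OF S, of "b - penalized_min S u l"]
  by simp

lemma abs_l1_norm_diff_le:
  fixes a b :: "real^'p"
  shows "\<bar>(\<Sum>j\<in>UNIV. \<bar>a $ j\<bar>) - (\<Sum>j\<in>UNIV. \<bar>b $ j\<bar>)\<bar> \<le> real CARD('p) * norm (a - b)"
proof -
  have "\<bar>(\<Sum>j\<in>UNIV. \<bar>a $ j\<bar>) - (\<Sum>j\<in>UNIV. \<bar>b $ j\<bar>)\<bar> \<le> (\<Sum>j\<in>UNIV. \<bar>\<bar>a $ j\<bar> - \<bar>b $ j\<bar>\<bar>)"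
    unfolding sum_subtractf[symmetric] by (rule sum_abs)
  also have "\<dots> \<le> (\<Sum>j\<in>(UNIV :: 'p set). norm (a - b))"
  proof (rule sum_mono)
    fix j :: 'p
    have "\<bar>\<bar>a $ j\<bar> - \<bar>b $ j\<bar>\<bar> \<le> \<bar>(a - b) $ j\<bar>" by simp
    also have "\<dots> \<le> norm (a - b)" by (rule component_le_norm_cart)
    finally show "\<bar>\<bar>a $ j\<bar> - \<bar>b $ j\<bar>\<bar> \<le> norm (a - b)" .
  qed
  finally show ?thesis by simp
qed

text \<open>
  Quadratic growth at the first minimizer and minimality of the second bound \<open>\<parallel>w\<parallel>\<^sup>2\<close>, for the
  difference \<open>w\<close> of the minimizers, by the increment along \<open>w\<close> of the difference of the two criteria.  Except
  for \<open>w \<bullet> (S\<^sub>0 - S) w\<close>, that increment grows at most linearly in \<open>\<parallel>w\<parallel>\<close>, so that one factor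
  cancels.  An explicit bound is used, rather than compactness, because it yields
  convergence along an arbitrary filter.
\<close>

lemma penalized_min_diff_le:
  fixes S\<^sub>0 S :: "real^'p^'p" and u\<^sub>0 u :: "real^'p" and l\<^sub>0 l c c' :: real
  assumes c: "coercive c S\<^sub>0" and c': "coercive c' S" and sym: "transpose S\<^sub>0 = S\<^sub>0" "transpose S = S"
    and l: "0 \<le> l\<^sub>0" "0 \<le> l"
  defines "b\<^sub>0 \<equiv> penalized_min S\<^sub>0 u\<^sub>0 l\<^sub>0" and "b \<equiv> penalized_min S u l"
  shows "(c / 2 - norm (S\<^sub>0 - S)) * norm (b - b\<^sub>0)
    \<le> 2 * norm (S\<^sub>0 *v (b\<^sub>0 - u\<^sub>0) - S *v (b\<^sub>0 - u)) + \<bar>l\<^sub>0 - l\<bar> * real CARD('p)"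
proof -
  define w where "w = b - b\<^sub>0"
  define \<delta> where "\<delta> = S\<^sub>0 *v (b\<^sub>0 - u\<^sub>0) - S *v (b\<^sub>0 - u)"
  define t where "t = (\<Sum>j\<in>UNIV. \<bar>b $ j\<bar>) - (\<Sum>j\<in>UNIV. \<bar>b\<^sub>0 $ j\<bar>)"
  have expand: "(b - v) \<bullet> (A *v (b - v)) = (b\<^sub>0 - v) \<bullet> (A *v (b\<^sub>0 - v)) + 2 * (w \<bullet> (A *v (b\<^sub>0 - v))) + w \<bullet> (A *v w)"
    if "transpose A = A" for A :: "real^'p^'p" and v
  proof -
    have "b - v = (b\<^sub>0 - v) + w" by (simp add: w_def)
    then show ?thesis
      using symmetric_form_commute[OF that, of "b\<^sub>0 - v" w]
      by (simp only: matrix_vector_right_distrib inner_add_left inner_add_right)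
  qed
  have "c / 2 * (norm w)\<^sup>2 \<le> penalized S\<^sub>0 u\<^sub>0 l\<^sub>0 b - penalized S\<^sub>0 u\<^sub>0 l\<^sub>0 b\<^sub>0"
    unfolding w_def b\<^sub>0_def by (rule penalized_growth[OF c l(1)])
  also have "\<dots> \<le> (penalized S\<^sub>0 u\<^sub>0 l\<^sub>0 b - penalized S u l b) - (penalized S\<^sub>0 u\<^sub>0 l\<^sub>0 b\<^sub>0 - penalized S u l b\<^sub>0)"
    using penalized_has_min[OF c' l(2), of u b\<^sub>0] by (simp add: b_def)
  also have "\<dots> = w \<bullet> ((S\<^sub>0 - S) *v w) + 2 * (w \<bullet> \<delta>) + (l\<^sub>0 - l) * t"
    unfolding penalized_def expand[OF sym(1)] expand[OF sym(2)]
    by (simp add: t_def \<delta>_def matrix_vector_mult_diff_rdistrib inner_diff_right algebra_simps)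
  also have "\<dots> \<le> norm w * (norm (S\<^sub>0 - S) * norm w) + 2 * (norm w * norm \<delta>)
      + \<bar>l\<^sub>0 - l\<bar> * (real CARD('p) * norm w)"
  proof (intro add_mono mult_left_mono)
    show "w \<bullet> ((S\<^sub>0 - S) *v w) \<le> norm w * (norm (S\<^sub>0 - S) * norm w)"
      by (intro order_trans[OF norm_cauchy_schwarz] mult_left_mono norm_matrix_vector_mult_le) simp
    show "w \<bullet> \<delta> \<le> norm w * norm \<delta>" by (rule norm_cauchy_schwarz)
    have "(l\<^sub>0 - l) * t \<le> \<bar>l\<^sub>0 - l\<bar> * \<bar>t\<bar>" by (metis abs_ge_self abs_mult)
    also have "\<dots> \<le> \<bar>l\<^sub>0 - l\<bar> * (real CARD('p) * norm w)"
      unfolding t_def w_def by (intro mult_left_mono abs_l1_norm_diff_le) simp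
    finally show "(l\<^sub>0 - l) * t \<le> \<bar>l\<^sub>0 - l\<bar> * (real CARD('p) * norm w)" .
  qed simp
  finally have "norm w * ((c / 2 - norm (S\<^sub>0 - S)) * norm w)
      \<le> norm w * (2 * norm \<delta> + \<bar>l\<^sub>0 - l\<bar> * real CARD('p))"
    by (simp add: power2_eq_square algebra_simps)
  then show ?thesis
    by (cases "w = 0") (auto simp: w_def \<delta>_def)
qed

lemma tendsto_penalized_min:
  fixes S :: "'a \<Rightarrow> real^'p^'p"
  assumes S: "(S \<longlongrightarrow> S\<^sub>0) F" and u: "(u \<longlongrightarrow> u\<^sub>0) F" and l: "(l \<longlongrightarrow> l\<^sub>0) F"
    and c: "coercive c S\<^sub>0" and sym: "transpose S\<^sub>0 = S\<^sub>0" "\<And>t. transpose (S t) = S t"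
    and nonneg: "0 \<le> l\<^sub>0" "\<And>t. 0 \<le> l t"
  shows "((\<lambda>t. penalized_min (S t) (u t) (l t)) \<longlongrightarrow> penalized_min S\<^sub>0 u\<^sub>0 l\<^sub>0) F"
proof -
  define b\<^sub>0 where "b\<^sub>0 = penalized_min S\<^sub>0 u\<^sub>0 l\<^sub>0"
  define \<delta> where "\<delta> t = 2 * norm (S\<^sub>0 *v (b\<^sub>0 - u\<^sub>0) - S t *v (b\<^sub>0 - u t)) + \<bar>l\<^sub>0 - l t\<bar> * real CARD('p)" for t
  have pos: "0 < c" using c by (rule coerciveD)
  have "(\<delta> \<longlongrightarrow> 2 * norm (S\<^sub>0 *v (b\<^sub>0 - u\<^sub>0) - S\<^sub>0 *v (b\<^sub>0 - u\<^sub>0)) + \<bar>l\<^sub>0 - l\<^sub>0\<bar> * real CARD('p)) F"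
    unfolding \<delta>_def
    by (intro tendsto_add tendsto_mult tendsto_const tendsto_norm tendsto_diff tendsto_rabs
          tendsto_matrix_vector_mult S u l)
  then have "(\<delta> \<longlongrightarrow> 0) F" by simp
  then have \<delta>: "((\<lambda>t. \<delta> t / (c / 4)) \<longlongrightarrow> 0) F"
    by (rule tendsto_divide_zero)
  have ev: "\<forall>\<^sub>F t in F. dist (S t) S\<^sub>0 < c / 4" using S pos by (intro tendstoD) auto
  have "\<forall>\<^sub>F t in F. norm (penalized_min (S t) (u t) (l t) - b\<^sub>0) \<le> \<delta> t / (c / 4)"
    using coercive_perturb[OF S c] ev
  proof eventually_elim
    case (elim t)
    have "c / 4 * norm (penalized_min (S t) (u t) (l t) - b\<^sub>0)
      \<le> (c / 2 - norm (S\<^sub>0 - S t)) * norm (penalized_min (S t) (u t) (l t) - b\<^sub>0)"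
      using elim(2) by (intro mult_right_mono) (auto simp: dist_norm norm_minus_commute)
    also have "\<dots> \<le> \<delta> t"
      unfolding \<delta>_def b\<^sub>0_def
      by (rule penalized_min_diff_le[OF c elim(1) sym(1) sym(2) nonneg(1) nonneg(2)])
    finally show ?case using pos by (simp add: field_simps)
  qed
  then show ?thesis unfolding b\<^sub>0_def[symmetric]
    unfolding Lim_null[of _ b\<^sub>0] by (rule Lim_null_comparison[OF _ \<delta>])
qed

section \<open>An extended continuous mapping theorem\<close>

text \<open>
  Setwise convergence of laws.  It is stronger than weak convergence: the test functions need only
  be bounded and measurable, so that the continuous mapping theorem below may compare with the
  possibly discontinuous limit function \<open>g\<close> along the whole sequence.
\<close>

definition conv_strong ::
  "'w measure \<Rightarrow> (nat \<Rightarrow> 'w \<Rightarrow> 'a::euclidean_space) \<Rightarrow> 'v measure \<Rightarrow> ('v \<Rightarrow> 'a) \<Rightarrow> bool" where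
  "conv_strong M V N W \<longleftrightarrow>
     (\<forall>\<^sub>F n in sequentially. V n \<in> borel_measurable M) \<and> W \<in> borel_measurable N \<and>
     (\<forall>g :: 'a \<Rightarrow> real. g \<in> borel_measurable borel \<and> bounded (range g) \<longrightarrow>
        (\<lambda>n. \<integral>\<omega>. g (V n \<omega>) \<partial>M) \<longlonglongrightarrow> (\<integral>v. g (W v) \<partial>N))"

lemma conv_strongD:
  fixes g :: "'a::euclidean_space \<Rightarrow> real"
  assumes "conv_strong M V N W" "g \<in> borel_measurable borel" "\<And>v. \<bar>g v\<bar> \<le> B"
  shows "(\<lambda>n. \<integral>\<omega>. g (V n \<omega>) \<partial>M) \<longlonglongrightarrow> (\<integral>v. g (W v) \<partial>N)"
proof -
  have "bounded (range g)" using assms(3) by (auto simp: bounded_iff)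
  with assms(1,2) show ?thesis by (simp add: conv_strong_def)
qed

lemma eventually_prod3_filter:
  "(\<forall>\<^sub>F (n, v, u) in A \<times>\<^sub>F (B \<times>\<^sub>F C). P n v u) \<longleftrightarrow>
     (\<exists>P1 P2 P3. eventually P1 A \<and> eventually P2 B \<and> eventually P3 C \<and>
        (\<forall>n v u. P1 n \<longrightarrow> P2 v \<longrightarrow> P3 u \<longrightarrow> P n v u))" (is "?L \<longleftrightarrow> ?R")
proof
  assume ?L
  then obtain P1 Q where P1: "eventually P1 A" and Q: "eventually Q (B \<times>\<^sub>F C)"
    and PQ: "\<forall>n. P1 n \<longrightarrow> (\<forall>z. Q z \<longrightarrow> (case (n, z) of (n, v, u) \<Rightarrow> P n v u))"
    unfolding eventually_prod_filter by blast
  obtain P2 P3 where "eventually P2 B" "eventually P3 C" "\<forall>v. P2 v \<longrightarrow> (\<forall>u. P3 u \<longrightarrow> Q (v, u))"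
    using Q unfolding eventually_prod_filter by blast
  then show ?R using P1 PQ
    by (intro exI[of _ P1] exI[of _ P2] exI[of _ P3]) auto
next
  assume ?R
  then obtain P1 P2 P3 where P: "eventually P1 A" "eventually P2 B" "eventually P3 C"
    "\<forall>n v u. P1 n \<longrightarrow> P2 v \<longrightarrow> P3 u \<longrightarrow> P n v u" by blast
  have "eventually (\<lambda>z. P2 (fst z) \<and> P3 (snd z)) (B \<times>\<^sub>F C)"
    using P(2,3) by (rule eventually_prodI)
  from eventually_prodI[OF P(1) this] show ?L
    by (rule eventually_mono) (use P(4) in auto)
qed

text \<open>
  A finite subcover turns a condition that holds near each point of a compact set into one that
  holds uniformly on the set.
\<close>

lemma eventually_uniform_on_compact:
  fixes K :: "'a::t2_space set"
  assumes K: "compact K"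
    and ev: "\<And>v. v \<in> K \<Longrightarrow> \<forall>\<^sub>F (n, v', u') in A \<times>\<^sub>F (nhds v \<times>\<^sub>F B). P n v' u'"
  shows "\<forall>\<^sub>F (n, u') in A \<times>\<^sub>F B. \<forall>v\<in>K. P n v u'"
proof -
  have "\<exists>S Q. open S \<and> v \<in> S \<and> eventually Q (A \<times>\<^sub>F B) \<and>
          (\<forall>v'\<in>S. \<forall>n u'. Q (n, u') \<longrightarrow> P n v' u')" if "v \<in> K" for v
  proof -
    obtain P1 P2 P3 where P1: "eventually P1 A" and P2: "eventually P2 (nhds v)"
      and P3: "eventually P3 B" and PP: "\<forall>n v' u'. P1 n \<longrightarrow> P2 v' \<longrightarrow> P3 u' \<longrightarrow> P n v' u'"
      using ev[OF \<open>v \<in> K\<close>] unfolding eventually_prod3_filter by blast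
    obtain S where "open S" "v \<in> S" "\<forall>v'\<in>S. P2 v'"
      using P2 unfolding eventually_nhds by blast
    moreover have "eventually (\<lambda>(n, u'). P1 n \<and> P3 u') (A \<times>\<^sub>F B)"
      using eventually_prodI[OF P1 P3] by (simp add: case_prod_unfold)
    ultimately show ?thesis using PP
      by (intro exI[of _ S] exI[of _ "\<lambda>(n, u'). P1 n \<and> P3 u'"]) fastforce
  qed
  then obtain S Q where SQ: "\<And>v. v \<in> K \<Longrightarrow> open (S v)" "\<And>v. v \<in> K \<Longrightarrow> v \<in> S v"
    "\<And>v. v \<in> K \<Longrightarrow> eventually (Q v) (A \<times>\<^sub>F B)"
    "\<And>v v' n u'. v \<in> K \<Longrightarrow> v' \<in> S v \<Longrightarrow> Q v (n, u') \<Longrightarrow> P n v' u'"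
    by metis
  obtain F where F: "F \<subseteq> K" "finite F" "K \<subseteq> (\<Union>v\<in>F. S v)"
    using compactE_image[OF K, of K S] SQ(1,2) by blast
  have "eventually (\<lambda>z. \<forall>v\<in>F. Q v z) (A \<times>\<^sub>F B)"
    using F SQ(3) by (intro eventually_ball_finite) auto
  then show ?thesis
  proof (rule eventually_mono)
    fix z assume "\<forall>v\<in>F. Q v z"
    then show "case z of (n, u') \<Rightarrow> \<forall>v\<in>K. P n v u'"
      using F SQ(4) by (cases z) blast
  qed
qed

text \<open>
  Continuous convergence forces the limit function \<open>g\<close> to be continuous off \<open>D\<close>, so near \<open>v\<close> the value
  \<open>G n v' u'\<close> is close to \<open>g v'\<close> and not only to \<open>g v\<close>.
\<close>

lemma continuous_convergence_near_limit:
  fixes G :: "nat \<Rightarrow> 'a::t2_space \<Rightarrow> 'b::topological_space \<Rightarrow> real"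
  assumes D: "closed D" "v \<notin> D" and \<epsilon>: "\<epsilon> > 0"
    and lim: "\<And>v. v \<notin> D \<Longrightarrow>
           ((\<lambda>(n, v', u'). G n v' u') \<longlongrightarrow> g v) (sequentially \<times>\<^sub>F (nhds v \<times>\<^sub>F nhds u))"
  shows "\<forall>\<^sub>F (n, v', u') in sequentially \<times>\<^sub>F (nhds v \<times>\<^sub>F nhds u). \<bar>G n v' u' - g v'\<bar> < \<epsilon>"
proof -
  have "\<forall>\<^sub>F (n, v', u') in sequentially \<times>\<^sub>F (nhds v \<times>\<^sub>F nhds u). \<bar>G n v' u' - g v\<bar> < \<epsilon> / 2"
    using tendstoD[OF lim[OF D(2)], of "\<epsilon> / 2"] \<epsilon> by (simp add: case_prod_unfold dist_real_def)
  then obtain P1 P2 P3 where P1: "eventually P1 sequentially" and P2: "eventually P2 (nhds v)"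
    and P3: "eventually P3 (nhds u)"
    and PP: "\<forall>n v' u'. P1 n \<longrightarrow> P2 v' \<longrightarrow> P3 u' \<longrightarrow> \<bar>G n v' u' - g v\<bar> < \<epsilon> / 2"
    unfolding eventually_prod3_filter by blast
  have "eventually (\<lambda>v'. v' \<notin> D) (nhds v)"
    using D by (simp add: eventually_nhds) (metis ComplD ComplI open_Compl)
  then have near: "eventually (\<lambda>v'. \<bar>g v' - g v\<bar> \<le> \<epsilon> / 2) (nhds v)"
    using P2
  proof eventually_elim
    case (elim v')
    have "filterlim (\<lambda>n. (n, v', u)) (sequentially \<times>\<^sub>F (nhds v' \<times>\<^sub>F nhds u)) sequentially"
      by (intro filterlim_Pair filterlim_ident tendsto_const)
    from filterlim_compose[OF lim[OF elim(1)] this]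
    have "(\<lambda>n. G n v' u) \<longlonglongrightarrow> g v'" by simp
    then have "(\<lambda>n. \<bar>G n v' u - g v\<bar>) \<longlonglongrightarrow> \<bar>g v' - g v\<bar>" by (intro tendsto_intros)
    moreover have "\<forall>\<^sub>F n in sequentially. \<bar>G n v' u - g v\<bar> \<le> \<epsilon> / 2"
      using P1
      by (rule eventually_mono) (use PP elim(2) eventually_nhds_x_imp_x[OF P3] in \<open>auto intro: less_imp_le\<close>)
    ultimately show ?case by (rule tendsto_upperbound) simp
  qed
  have "\<bar>G n v' u' - g v'\<bar> < \<epsilon>" if "P1 n" "P2 v' \<and> \<bar>g v' - g v\<bar> \<le> \<epsilon> / 2" "P3 u'" for n v' u'
  proof -
    have "\<bar>G n v' u' - g v\<bar> < \<epsilon> / 2" using PP that by blast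
    then show ?thesis using that(2) by linarith
  qed
  then show ?thesis
    unfolding eventually_prod3_filter using P1 eventually_conj[OF P2 near] P3 by blast
qed

text \<open>
  The complement of \<open>D\<close> is open, hence exhausted by compact sets.
\<close>

lemma compact_approx_of_null_complement:
  fixes W :: "'v \<Rightarrow> 'a::euclidean_space"
  assumes N: "prob_space N" and W: "W \<in> borel_measurable N" and D: "closed D"
    and null: "measure N {\<omega> \<in> space N. W \<omega> \<in> D} = 0" and \<epsilon>: "0 < \<epsilon>"
  obtains K where "compact K" "K \<inter> D = {}" "measure N {\<omega> \<in> space N. W \<omega> \<notin> K} < \<epsilon>"
proof -
  interpret N: prob_space N by fact
  note [measurable] = W
  have [measurable]: "D \<in> sets borel" using D by (rule borel_closed)
  obtain C where C: "\<And>n. compact (C n)" "\<And>n. C n \<subseteq> - D" "\<And>n. C n \<subseteq> interior (C (Suc n))"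
    "\<Union>(range C) = - D"
    using open_Union_compact_subsets[of "- D"] D by (metis open_Compl)
  have [measurable]: "C n \<in> sets borel" for n
    using C(1) by (intro borel_closed compact_imp_closed)
  let ?A = "\<lambda>n. {\<omega> \<in> space N. W \<omega> \<in> C n}"
  have "incseq C" using C(3) interior_subset by (intro incseq_SucI) blast
  then have "incseq ?A" by (auto simp: incseq_def)
  moreover have "range ?A \<subseteq> sets N" by auto
  ultimately have "(\<lambda>n. measure N (?A n)) \<longlonglongrightarrow> measure N (\<Union>n. ?A n)"
    by (intro N.finite_Lim_measure_incseq) auto
  also have "(\<Union>n. ?A n) = {\<omega> \<in> space N. W \<omega> \<notin> D}"
    using C(4) by auto
  also have "measure N \<dots> = 1"
    using N.prob_neg[of "\<lambda>\<omega>. W \<omega> \<in> D"] null by simp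
  finally have "\<forall>\<^sub>F n in sequentially. 1 - \<epsilon> < measure N (?A n)"
    using \<epsilon> by (intro order_tendstoD) auto
  then obtain n where "1 - \<epsilon> < measure N (?A n)" by (auto simp: eventually_sequentially)
  moreover have "measure N {\<omega> \<in> space N. W \<omega> \<notin> C n} = 1 - measure N (?A n)"
    using N.prob_neg[of "\<lambda>\<omega>. W \<omega> \<in> C n"] by simp
  ultimately show thesis using C(1,2)[of n] by (intro that[of "C n"]) auto
qed

text \<open>
  On a compact set \<open>K\<close> that avoids \<open>D\<close> and carries almost all of the law of \<open>W\<close>, the functions \<open>G n\<close> are
  uniformly close to \<open>g\<close> once \<open>U n\<close> is close to \<open>u\<close>.  Strong convergence transfers the small mass outside
  \<open>K\<close> from \<open>W\<close> to \<open>V n\<close>, and gives the limit of the expectations of \<open>f (g (V n))\<close>.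
\<close>

lemma extended_continuous_mapping:
  fixes V :: "nat \<Rightarrow> 'w \<Rightarrow> 'a::euclidean_space" and U :: "nat \<Rightarrow> 'w \<Rightarrow> 'b::euclidean_space"
    and T :: "nat \<Rightarrow> 'w \<Rightarrow> 'c::euclidean_space"
  assumes M: "prob_space M" and N: "prob_space N"
    and V: "conv_strong M V N W" and U: "conv_in_prob M U (\<lambda>_. u)"
    and T: "\<forall>\<^sub>F n in sequentially. T n \<in> borel_measurable M"
    and T_eq: "\<forall>\<^sub>F n in sequentially. \<forall>\<omega>. T n \<omega> = G n (V n \<omega>) (U n \<omega>)"
    and D: "closed D" "measure N {\<omega> \<in> space N. W \<omega> \<in> D} = 0"
    and g: "g \<in> borel_measurable borel"
    and lim: "\<And>v. v \<notin> D \<Longrightarrow>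
           ((\<lambda>(n, v', u'). G n v' u') \<longlongrightarrow> g v) (sequentially \<times>\<^sub>F (nhds v \<times>\<^sub>F nhds u))"
  shows "conv_in_distr M T N (\<lambda>\<omega>. g (W \<omega>))"
  unfolding conv_in_distr_def
proof (intro conjI allI impI T)
  interpret M: prob_space M by fact
  interpret N: prob_space N by fact
  have W[measurable]: "W \<in> borel_measurable N" using V by (simp add: conv_strong_def)
  note [measurable] = g
  show "(\<lambda>\<omega>. g (W \<omega>)) \<in> borel_measurable N" by measurable
  fix f :: "'c \<Rightarrow> real" assume "continuous_on UNIV f \<and> bounded (range f)"
  then have f: "continuous_on UNIV f" and "bounded (range f)" by auto
  then obtain B where B: "0 < B" "\<And>z. \<bar>f z\<bar> \<le> B"
    by (auto simp: bounded_pos)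
  have [measurable]: "f \<in> borel_measurable borel" using f by (rule borel_measurable_continuous_onI)
  have f_lim: "((\<lambda>(n, v', u'). f (G n v' u')) \<longlongrightarrow> f (g v)) (sequentially \<times>\<^sub>F (nhds v \<times>\<^sub>F nhds u))"
    if "v \<notin> D" for v
    using continuous_on_tendsto_compose[OF f lim[OF that]] by (simp add: case_prod_unfold)
  have key: "\<forall>\<^sub>F n in sequentially. \<bar>(\<integral>\<omega>. f (T n \<omega>) \<partial>M) - (\<integral>v. f (g (W v)) \<partial>N)\<bar> < (2 + 4 * B) * \<epsilon>"
    if \<epsilon>: "0 < \<epsilon>" for \<epsilon>
  proof -
    obtain K where K: "compact K" "K \<inter> D = {}" "measure N {\<omega> \<in> space N. W \<omega> \<notin> K} < \<epsilon>"
      using compact_approx_of_null_complement[OF N W D \<epsilon>] .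
    have [measurable]: "K \<in> sets borel" using K(1) by (intro borel_closed compact_imp_closed)
    have "\<forall>\<^sub>F (n, u') in sequentially \<times>\<^sub>F nhds u. \<forall>v\<in>K. \<bar>f (G n v u') - f (g v)\<bar> < \<epsilon>"
      using K(1)
    proof (rule eventually_uniform_on_compact)
      fix v assume "v \<in> K"
      then have "v \<notin> D" using K(2) by auto
      from continuous_convergence_near_limit[OF D(1) this \<epsilon> f_lim]
      show "\<forall>\<^sub>F (n, v', u') in sequentially \<times>\<^sub>F (nhds v \<times>\<^sub>F nhds u). \<bar>f (G n v' u') - f (g v')\<bar> < \<epsilon>"
        by simp
    qed
    then obtain P Q where P: "eventually P sequentially" and Q: "eventually Q (nhds u)"
      and PQ: "\<And>n u' v. P n \<Longrightarrow> Q u' \<Longrightarrow> v \<in> K \<Longrightarrow> \<bar>f (G n v u') - f (g v)\<bar> < \<epsilon>"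
      unfolding eventually_prod_filter by (auto split: prod.splits)
    obtain d where d: "0 < d" "\<And>u'. dist u' u < d \<Longrightarrow> Q u'"
      using Q unfolding eventually_nhds_metric by auto
    let ?out = "\<lambda>n. measure M {\<omega> \<in> space M. V n \<omega> \<notin> K}"
    let ?far = "\<lambda>n. measure M {\<omega> \<in> space M. dist (U n \<omega>) u > d / 2}"
    have "(\<lambda>n. \<integral>\<omega>. indicator (- K) (V n \<omega>) \<partial>M) \<longlonglongrightarrow> (\<integral>v. indicator (- K) (W v) \<partial>N :: real)"
      by (rule conv_strongD[OF V, of _ 1]) (auto simp: indicator_def)
    moreover have "(\<integral>v. indicator (- K) (W v) \<partial>N :: real) < \<epsilon>"
    proof -
      have "(\<integral>v. indicator (- K) (W v) \<partial>N :: real) = (\<integral>v. indicator {\<omega> \<in> space N. W \<omega> \<notin> K} v \<partial>N)"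
        by (intro Bochner_Integration.integral_cong) (auto simp: indicator_def)
      then show ?thesis using K(3) by simp
    qed
    ultimately have ev1: "\<forall>\<^sub>F n in sequentially. (\<integral>\<omega>. indicator (- K) (V n \<omega>) \<partial>M :: real) < \<epsilon>"
      by (rule order_tendstoD)
    have "?far \<longlonglongrightarrow> 0"
      using U half_gt_zero[OF d(1)] unfolding conv_in_prob_def by blast
    then have ev2: "\<forall>\<^sub>F n in sequentially. ?far n < \<epsilon>"
      using \<epsilon> by (rule order_tendstoD)
    have "(\<lambda>n. \<integral>\<omega>. f (g (V n \<omega>)) \<partial>M) \<longlonglongrightarrow> (\<integral>v. f (g (W v)) \<partial>N)"
      by (rule conv_strongD[OF V, of _ B]) (auto intro: B(2))
    then have ev3: "\<forall>\<^sub>F n in sequentially. dist (\<integral>\<omega>. f (g (V n \<omega>)) \<partial>M) (\<integral>v. f (g (W v)) \<partial>N) < \<epsilon>"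
      using \<epsilon> by (rule tendstoD)
    have ev4: "\<forall>\<^sub>F n in sequentially. V n \<in> borel_measurable M"
      "\<forall>\<^sub>F n in sequentially. U n \<in> borel_measurable M"
      using V U by (auto simp: conv_strong_def conv_in_prob_def)
    show ?thesis using P ev1 ev2 ev3 ev4 T T_eq
    proof eventually_elim
      case (elim n)
      note [measurable] = elim(5,6,7)
      have int: "integrable M (\<lambda>\<omega>. f (T n \<omega>))" "integrable M (\<lambda>\<omega>. f (g (V n \<omega>)))"
        using B(2) by (auto intro!: M.integrable_const_bound[of _ B])
      have int': "integrable M (\<lambda>\<omega>. indicator (- K) (V n \<omega>) :: real)"
        by (rule M.integrable_const_bound[of _ 1]) auto
      let ?F = "{\<omega> \<in> space M. dist (U n \<omega>) u > d / 2}"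
      have int'': "integrable M (indicator ?F :: _ \<Rightarrow> real)"
        by (rule M.integrable_const_bound[of _ 1]) (auto simp: indicator_def)
      have "\<bar>(\<integral>\<omega>. f (T n \<omega>) \<partial>M) - (\<integral>\<omega>. f (g (V n \<omega>)) \<partial>M)\<bar>
          = \<bar>\<integral>\<omega>. f (T n \<omega>) - f (g (V n \<omega>)) \<partial>M\<bar>"
        using int by simp
      also have "\<dots> \<le> (\<integral>\<omega>. \<bar>f (T n \<omega>) - f (g (V n \<omega>))\<bar> \<partial>M)"
        by (rule integral_abs_bound)
      also have "\<dots> \<le> (\<integral>\<omega>. \<epsilon> + 2 * B * (indicator (- K) (V n \<omega>) + indicator ?F \<omega>) \<partial>M)"
      proof (rule integral_mono)
        fix \<omega> assume \<omega>: "\<omega> \<in> space M"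
        show "\<bar>f (T n \<omega>) - f (g (V n \<omega>))\<bar> \<le> \<epsilon> + 2 * B * (indicator (- K) (V n \<omega>) + indicator ?F \<omega>)"
        proof (cases "V n \<omega> \<in> K \<and> \<omega> \<notin> ?F")
          case True
          then have "Q (U n \<omega>)" using d \<omega> by (intro d(2)) auto
          then have "\<bar>f (T n \<omega>) - f (g (V n \<omega>))\<bar> < \<epsilon>"
            using PQ[OF elim(1)] True elim(8) by simp
          then show ?thesis using True B(1) by (auto simp: indicator_def)
        next
          case False
          then have "1 \<le> (indicator (- K) (V n \<omega>) + indicator ?F \<omega> :: real)"
            by (auto simp: indicator_def)
          then have "2 * B * 1 \<le> 2 * B * (indicator (- K) (V n \<omega>) + indicator ?F \<omega>)"
            using B(1) by (intro mult_left_mono) auto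
          then show ?thesis using B(2)[of "T n \<omega>"] B(2)[of "g (V n \<omega>)"] \<epsilon> by linarith
        qed
      qed (intro integrable_abs Bochner_Integration.integrable_diff Bochner_Integration.integrable_add
            integrable_mult_right M.integrable_const int int' int'')+
      also have "\<dots> = \<epsilon> + 2 * B * ((\<integral>\<omega>. indicator (- K) (V n \<omega>) \<partial>M) + ?far n)"
        using int' int'' by (simp add: M.prob_space)
      also have "\<dots> < \<epsilon> + 2 * B * (\<epsilon> + \<epsilon>)"
        using elim(2,3) B(1) by (intro add_strict_left_mono mult_strict_left_mono add_strict_mono) auto
      finally show ?case using elim(4) by (simp add: dist_real_def algebra_simps)
    qed
  qed
  show "(\<lambda>n. \<integral>\<omega>. f (T n \<omega>) \<partial>M) \<longlonglongrightarrow> (\<integral>v. f (g (W v)) \<partial>N)"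
  proof (rule tendstoI)
    fix e :: real assume "0 < e"
    then show "\<forall>\<^sub>F n in sequentially. dist (\<integral>\<omega>. f (T n \<omega>) \<partial>M) (\<integral>v. f (g (W v)) \<partial>N) < e"
      using key[of "e / (2 + 4 * B)"] B(1) by (simp add: dist_real_def)
  qed
qed

text \<open>
  Markov's inequality for the bounded continuous function \<open>min (dist z c) e\<close>.
\<close>

lemma conv_in_distr_const_imp_conv_in_prob:
  fixes T :: "nat \<Rightarrow> 'w \<Rightarrow> 'a::euclidean_space"
  assumes M: "prob_space M" and N: "prob_space N" and T: "conv_in_distr M T N (\<lambda>_. c)"
  shows "conv_in_prob M T (\<lambda>_. c)"
  unfolding conv_in_prob_def
proof (intro conjI allI impI)
  interpret M: prob_space M by fact
  interpret N: prob_space N by fact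
  show meas: "\<forall>\<^sub>F n in sequentially. T n \<in> borel_measurable M"
    using T by (simp add: conv_in_distr_def)
  fix e :: real assume e: "0 < e"
  define f where "f z = min (dist z c) e" for z :: 'a
  have f: "continuous_on UNIV f" unfolding f_def by (intro continuous_intros)
  have f_nn: "0 \<le> f z" "f z \<le> e" for z using e by (auto simp: f_def)
  have "bounded (range f)" using f_nn by (auto simp: bounded_iff intro!: exI[of _ e])
  with T f have "(\<lambda>n. \<integral>\<omega>. f (T n \<omega>) \<partial>M) \<longlonglongrightarrow> (\<integral>v. f c \<partial>N)"
    by (simp add: conv_in_distr_def)
  then have "(\<lambda>n. (\<integral>\<omega>. f (T n \<omega>) \<partial>M) / e) \<longlonglongrightarrow> 0 / e"
    using e by (intro tendsto_intros) (auto simp: f_def)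
  then have lim: "(\<lambda>n. (\<integral>\<omega>. f (T n \<omega>) \<partial>M) / e) \<longlonglongrightarrow> 0" by simp
  have [measurable]: "f \<in> borel_measurable borel" using f by (rule borel_measurable_continuous_onI)
  show "(\<lambda>n. measure M {\<omega> \<in> space M. e < dist (T n \<omega>) c}) \<longlonglongrightarrow> 0"
  proof (rule tendsto_sandwich[OF _ _ tendsto_const lim])
    show "\<forall>\<^sub>F n in sequentially. measure M {\<omega> \<in> space M. e < dist (T n \<omega>) c} \<le> (\<integral>\<omega>. f (T n \<omega>) \<partial>M) / e"
      using meas
    proof eventually_elim
      case (elim n)
      note [measurable] = elim
      have "e * measure M {\<omega> \<in> space M. e < dist (T n \<omega>) c}
          = (\<integral>\<omega>. e * indicator {\<omega> \<in> space M. e < dist (T n \<omega>) c} \<omega> \<partial>M)" by simp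
      also have "\<dots> \<le> (\<integral>\<omega>. f (T n \<omega>) \<partial>M)"
      proof (rule integral_mono)
        show "integrable M (\<lambda>\<omega>. e * indicator {\<omega> \<in> space M. e < dist (T n \<omega>) c} \<omega>)"
          by (rule M.integrable_const_bound[of _ e]) (use e in \<open>auto simp: indicator_def\<close>)
        show "integrable M (\<lambda>\<omega>. f (T n \<omega>))"
          using f_nn by (intro M.integrable_const_bound[of _ e]) auto
      qed (use f_nn in \<open>auto simp: indicator_def f_def\<close>)
      finally show ?case using e by (simp add: field_simps)
    qed
  qed simp
qed simp

section \<open>Convergence in total variation of the standardized least squares estimator\<close>

lemma nn_integral_lborel_affine:
  fixes t :: "'a::euclidean_space"
  assumes [measurable]: "f \<in> borel_measurable borel" and c: "c \<noteq> 0"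
  shows "(\<integral>\<^sup>+x. f x \<partial>lborel) = ennreal (\<bar>c\<bar> ^ DIM('a)) * (\<integral>\<^sup>+x. f (t + c *\<^sub>R x) \<partial>lborel)"
  by (subst lborel_affine[OF c, of t])
    (simp add: nn_integral_density nn_integral_distr nn_integral_cmult ennreal_power)

lemma distributed_standardize:
  fixes X :: "'w \<Rightarrow> 'a::euclidean_space"
  assumes X: "distributed M lborel X f" and c: "c \<noteq> 0"
  shows "distributed M lborel (\<lambda>\<omega>. (1 / c) *\<^sub>R (X \<omega> - t)) (\<lambda>v. ennreal (\<bar>c\<bar> ^ DIM('a)) * f (t + c *\<^sub>R v))"
proof -
  have [measurable]: "f \<in> borel_measurable borel" "X \<in> borel_measurable M"
    using X by (auto simp: distributed_def)
  show ?thesis unfolding distributed_def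
  proof (intro conjI measure_eqI)
    fix A assume "A \<in> sets (distr M lborel (\<lambda>\<omega>. (1 / c) *\<^sub>R (X \<omega> - t)))"
    then have [measurable]: "A \<in> sets borel" by simp
    have "emeasure (distr M lborel (\<lambda>\<omega>. (1 / c) *\<^sub>R (X \<omega> - t))) A
        = (\<integral>\<^sup>+\<omega>. indicator A ((1 / c) *\<^sub>R (X \<omega> - t)) \<partial>M)"
      by (simp add: nn_integral_distr flip: nn_integral_indicator)
    also have "\<dots> = (\<integral>\<^sup>+x. f x * indicator A ((1 / c) *\<^sub>R (x - t)) \<partial>lborel)"
      by (rule distributed_nn_integral[OF X, symmetric]) measurable
    also have "\<dots> = ennreal (\<bar>c\<bar> ^ DIM('a)) * (\<integral>\<^sup>+v. f (t + c *\<^sub>R v) * indicator A v \<partial>lborel)"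
      by (subst nn_integral_lborel_affine[OF _ c, of _ t]) (simp_all add: c)
    also have "\<dots> = emeasure (density lborel (\<lambda>v. ennreal (\<bar>c\<bar> ^ DIM('a)) * f (t + c *\<^sub>R v))) A"
      by (simp add: emeasure_density nn_integral_cmult mult.assoc)
    finally show "emeasure (distr M lborel (\<lambda>\<omega>. (1 / c) *\<^sub>R (X \<omega> - t))) A = \<dots>" .
  qed auto
qed

text \<open>
  Scheffe's lemma: pointwise convergence of probability densities implies convergence in \<open>L\<^sup>1\<close>.
\<close>

lemma conv_strong_densities:
  fixes V :: "nat \<Rightarrow> 'w \<Rightarrow> 'a::euclidean_space" and \<phi> :: "nat \<Rightarrow> 'a \<Rightarrow> real"
  assumes M: "prob_space M" and N: "prob_space N"
    and V: "\<forall>\<^sub>F n in sequentially. distributed M lborel (V n) (\<lambda>v. ennreal (\<phi> n v))"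
    and W: "distributed N lborel W (\<lambda>v. ennreal (\<psi> v))"
    and nn: "\<And>n v. 0 \<le> \<phi> n v" "\<And>v. 0 \<le> \<psi> v"
    and lim: "\<And>v. (\<lambda>n. \<phi> n v) \<longlonglongrightarrow> \<psi> v"
  shows "conv_strong M V N W"
proof -
  \<comment> \<open>Scheffe's lemma wants a density for every index; the finitely many exceptions get the limit density.\<close>
  define F where "F n = (if distributed M lborel (V n) (\<lambda>v. ennreal (\<phi> n v)) then \<phi> n else \<psi>)" for n
  have F_nn: "0 \<le> F n v" for n v using nn by (simp add: F_def)
  have density: "f \<in> borel_measurable borel \<and> (\<integral>\<^sup>+v. ennreal (f v) \<partial>lborel) = 1"
    if P: "prob_space P" and X: "distributed P lborel X (\<lambda>v. ennreal (f v))" and f: "\<And>v. 0 \<le> f v"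
    for P :: "'x measure" and X f
  proof -
    have "(\<integral>\<^sup>+v. ennreal (f v) * 1 \<partial>lborel) = (\<integral>\<^sup>+\<omega>. 1 \<partial>P)"
      by (rule distributed_nn_integral[OF X]) simp
    then show ?thesis
      using prob_space.emeasure_space_1[OF P] distributed_real_measurable[OF f X] by simp
  qed
  have F: "F n \<in> borel_measurable borel" "(\<integral>\<^sup>+v. ennreal (F n v) \<partial>lborel) = 1" for n
    using density[OF M, of "V n" "\<phi> n"] density[OF N W nn(2)] nn(1) by (auto simp: F_def)
  have \<psi>: "\<psi> \<in> borel_measurable borel" "(\<integral>\<^sup>+v. ennreal (\<psi> v) \<partial>lborel) = 1"
    using density[OF N W nn(2)] by auto
  note [measurable] = F(1) \<psi>(1)
  have ev: "\<forall>\<^sub>F n in sequentially. F n = \<phi> n"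
    using V by (rule eventually_mono) (simp add: F_def)
  have "(\<lambda>n. F n v) \<longlonglongrightarrow> \<psi> v" for v
    by (rule Lim_transform_eventually[OF lim]) (use ev in \<open>auto elim: eventually_mono\<close>)
  moreover have int: "integrable lborel (F n)" "integrable lborel \<psi>" for n
    using F \<psi> F_nn nn by (auto intro!: integrableI_nonneg)
  ultimately have "(\<lambda>n. \<integral>\<^sup>+v. norm (F n v - \<psi> v) \<partial>lborel) \<longlonglongrightarrow> 0"
    using F \<psi> F_nn nn by (intro Scheffe_lemma2) auto
  then have "(\<lambda>n. enn2real (\<integral>\<^sup>+v. norm (F n v - \<psi> v) \<partial>lborel)) \<longlonglongrightarrow> 0"
    using tendsto_enn2real[where l = 0] by simp
  then have L1: "(\<lambda>n. \<integral>v. norm (F n v - \<psi> v) \<partial>lborel) \<longlonglongrightarrow> 0"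
    by (simp add: integral_eq_nn_integral)
  show ?thesis unfolding conv_strong_def
  proof (intro conjI allI impI)
    show "\<forall>\<^sub>F n in sequentially. V n \<in> borel_measurable M"
      using V by (rule eventually_mono) (simp add: distributed_def)
    show "W \<in> borel_measurable N" using W by (simp add: distributed_def)
    fix g :: "'a \<Rightarrow> real" assume "g \<in> borel_measurable borel \<and> bounded (range g)"
    then have g[measurable]: "g \<in> borel_measurable borel" and "bounded (range g)" by auto
    then obtain B where B: "0 < B" "\<And>v. \<bar>g v\<bar> \<le> B" by (auto simp: bounded_pos)
    have le: "\<bar>a * g v\<bar> \<le> B * \<bar>a\<bar>" for a v
      using mult_left_mono[OF B(2)[of v], of "\<bar>a\<bar>"] by (simp add: abs_mult mult.commute)
    have int_g: "integrable lborel (\<lambda>v. f v * g v)" if "integrable lborel f" for f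
    proof (rule Bochner_Integration.integrable_bound)
      show "integrable lborel (\<lambda>v. B * f v)" using that by simp
      show "AE v in lborel. norm (f v * g v) \<le> norm (B * f v)"
        using le[of "f v" v for v] B(1) by (intro AE_I2) (simp add: abs_mult)
      show "(\<lambda>v. f v * g v) \<in> borel_measurable lborel"
        using borel_measurable_integrable[OF that] by simp
    qed
    have bound: "norm ((\<integral>v. F n v * g v \<partial>lborel) - (\<integral>v. \<psi> v * g v \<partial>lborel)) \<le> B * (\<integral>v. norm (F n v - \<psi> v) \<partial>lborel)" for n
    proof -
      have "\<bar>(\<integral>v. F n v * g v \<partial>lborel) - (\<integral>v. \<psi> v * g v \<partial>lborel)\<bar>
          = \<bar>\<integral>v. (F n v - \<psi> v) * g v \<partial>lborel\<bar>"
        using int_g int by (simp add: left_diff_distrib)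
      also have "\<dots> \<le> (\<integral>v. \<bar>(F n v - \<psi> v) * g v\<bar> \<partial>lborel)" by (rule integral_abs_bound)
      also have "\<dots> \<le> (\<integral>v. B * norm (F n v - \<psi> v) \<partial>lborel)"
        using int le
        by (intro integral_mono integrable_abs int_g Bochner_Integration.integrable_diff
              integrable_mult_right integrable_norm) auto
      finally show ?thesis by simp
    qed
    have bound_lim: "(\<lambda>n. B * (\<integral>v. norm (F n v - \<psi> v) \<partial>lborel)) \<longlonglongrightarrow> 0"
      using tendsto_mult_right_zero[OF L1] .
    have "(\<lambda>n. (\<integral>v. F n v * g v \<partial>lborel) - (\<integral>v. \<psi> v * g v \<partial>lborel)) \<longlonglongrightarrow> 0"
      using always_eventually[OF allI[OF bound]] bound_lim by (rule Lim_null_comparison)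
    then have "(\<lambda>n. \<integral>v. F n v * g v \<partial>lborel) \<longlonglongrightarrow> (\<integral>v. \<psi> v * g v \<partial>lborel)"
      by (rule LIM_zero_cancel)
    moreover have "\<forall>\<^sub>F n in sequentially. (\<integral>v. F n v * g v \<partial>lborel) = (\<integral>\<omega>. g (V n \<omega>) \<partial>M)"
      using V ev
    proof eventually_elim
      case (elim n)
      show ?case unfolding elim(2) by (rule distributed_integral[OF elim(1)]) (simp_all add: nn)
    qed
    ultimately have "(\<lambda>n. \<integral>\<omega>. g (V n \<omega>) \<partial>M) \<longlonglongrightarrow> (\<integral>v. \<psi> v * g v \<partial>lborel)"
      by (rule Lim_transform_eventually)
    also have "(\<integral>v. \<psi> v * g v \<partial>lborel) = (\<integral>v. g (W v) \<partial>N)"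
      by (rule distributed_integral[OF W]) (simp_all add: nn)
    finally show "(\<lambda>n. \<integral>\<omega>. g (V n \<omega>) \<partial>M) \<longlonglongrightarrow> (\<integral>v. g (W v) \<partial>N)" .
  qed
qed

text \<open>
  The density of \<open>N(0, \<sigma>\<^sup>2 A\<^sup>-\<^sup>1)\<close>, written without the inverse of \<open>A\<close> so that it is visibly continuous in
  \<open>A\<close>.
\<close>

definition precision_density :: "real \<Rightarrow> real^'p^'p \<Rightarrow> real^'p \<Rightarrow> real" where
  "precision_density \<sigma> A v =
     sqrt (det A) / sqrt ((2 * pi * \<sigma>\<^sup>2) ^ CARD('p)) * exp (- (v \<bullet> (A *v v)) / (2 * \<sigma>\<^sup>2))"

lemma det_scaleR_matrix:
  fixes A :: "real^'n^'n"
  shows "det (c *\<^sub>R A) = c ^ CARD('n) * det A"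
proof -
  have "c *\<^sub>R A = (c *\<^sub>R mat 1) ** A" by (simp add: scalar_matrix_assoc[symmetric])
  moreover have "c *\<^sub>R mat 1 = (matrix ((*\<^sub>R) c) :: real^'n^'n)"
    by (simp add: matrix_def mat_def vec_eq_iff axis_def)
  ultimately show ?thesis by (simp only: det_mul det_matrix_scaleR)
qed

text \<open>
  With \<open>c = n\<^sup>-\<^sup>1\<^sup>/\<^sup>2\<close> the left side is the density of the standardized estimator: the matrix
  \<open>(1 / c\<^sup>2) A\<close> is then \<open>n S\<^sub>n = C\<^sub>n\<close>, and \<open>c\<^sup>p\<close> is the Jacobian.
\<close>

lemma mvn_density_eq_precision_density:
  fixes A :: "real^'p^'p"
  assumes A: "invertible A" and \<sigma>: "\<sigma> > 0" and c: "c > 0"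
  shows "c ^ CARD('p) * mvn_density t (\<sigma>\<^sup>2 *\<^sub>R matrix_inv ((1 / c\<^sup>2) *\<^sub>R A)) (t + c *\<^sub>R v) = precision_density \<sigma> A v"
proof -
  have inv: "matrix_inv ((1 / c\<^sup>2) *\<^sub>R A) = c\<^sup>2 *\<^sub>R matrix_inv A"
    using matrix_inv_scaleR[OF A, of "1 / c\<^sup>2"] c by simp
  have A': "invertible (matrix_inv A)"
    using matrix_inv_cancel[OF A] unfolding invertible_def by blast
  have "matrix_inv (matrix_inv A) = A"
    by (rule matrix_inv_unique) (rule matrix_inv_cancel(2)[OF A])
  then have inv2: "matrix_inv (\<sigma>\<^sup>2 *\<^sub>R c\<^sup>2 *\<^sub>R matrix_inv A) = (1 / (\<sigma>\<^sup>2 * c\<^sup>2)) *\<^sub>R A"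
    using matrix_inv_scaleR[OF A', of "\<sigma>\<^sup>2 * c\<^sup>2"] c \<sigma> by simp
  have "det (matrix_inv A) * det A = 1"
    using matrix_inv_cancel(2)[OF A] by (metis det_I det_mul)
  then have detinv: "det (matrix_inv A) = 1 / det A"
    by (metis mult_zero_right nonzero_eq_divide_eq zero_neq_one)
  have det: "sqrt ((2 * pi) ^ CARD('p) * det (\<sigma>\<^sup>2 *\<^sub>R c\<^sup>2 *\<^sub>R matrix_inv A))
      = c ^ CARD('p) * (sqrt ((2 * pi * \<sigma>\<^sup>2) ^ CARD('p)) / sqrt (det A))"
  proof -
    have "(2 * pi) ^ CARD('p) * det (\<sigma>\<^sup>2 *\<^sub>R c\<^sup>2 *\<^sub>R matrix_inv A)
        = (c ^ CARD('p))\<^sup>2 * ((2 * pi * \<sigma>\<^sup>2) ^ CARD('p) / det A)"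
      by (simp add: det_scaleR_matrix detinv power_mult_distrib power2_eq_square mult_ac)
    then show ?thesis using c by (simp only: real_sqrt_mult real_sqrt_divide real_sqrt_abs) simp
  qed
  have ex: "(c *\<^sub>R v) \<bullet> (((1 / (\<sigma>\<^sup>2 * c\<^sup>2)) *\<^sub>R A) *v (c *\<^sub>R v)) = (v \<bullet> (A *v v)) / \<sigma>\<^sup>2"
    using c \<sigma> by (simp add: scaleR_matrix_vector_assoc[symmetric] matrix_vector_mult_scaleR power2_eq_square)
  show ?thesis
    unfolding mvn_density_def precision_density_def inv inv2 det add_diff_cancel_left' ex
    using c by (simp add: field_simps)
qed

lemma mvn_density_precision:
  fixes A :: "real^'p^'p"
  assumes "invertible A" "\<sigma> > 0"
  shows "mvn_density 0 (\<sigma>\<^sup>2 *\<^sub>R matrix_inv A) v = precision_density \<sigma> A v"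
  using mvn_density_eq_precision_density[OF assms, of 1 0 v] by simp

text \<open>
  The densities of the standardized variables are those of \<open>N(0, \<sigma>\<^sup>2 S\<^sub>n\<^sup>-\<^sup>1)\<close> exactly, for each \<open>n\<close>.  They are
  cut off at \<open>0\<close> only so that nonnegativity is evident; the extended real density is the same.
\<close>

lemma standardized_normal_conv_strong:
  fixes S :: "nat \<Rightarrow> real^'p^'p" and U :: "nat \<Rightarrow> 'w \<Rightarrow> real^'p"
  assumes M: "prob_space M" and N: "prob_space N" and \<sigma>: "\<sigma> > 0"
    and S: "S \<longlonglongrightarrow> S\<^sub>0" and c: "coercive c S\<^sub>0"
    and U: "\<forall>\<^sub>F n in sequentially. has_mvn M (U n) (b n) (\<sigma>\<^sup>2 *\<^sub>R matrix_inv (real n *\<^sub>R S n))"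
    and W: "has_mvn N W 0 (\<sigma>\<^sup>2 *\<^sub>R matrix_inv S\<^sub>0)"
  shows "conv_strong M (\<lambda>n \<omega>. sqrt (real n) *\<^sub>R (U n \<omega> - b n)) N W"
proof -
  have inv: "invertible S\<^sub>0" using c by (rule coercive_invertible)
  have "\<forall>\<^sub>F n in sequentially. invertible (S n)"
    using coercive_perturb[OF S c] by (rule eventually_mono) (rule coercive_invertible)
  then have V: "\<forall>\<^sub>F n in sequentially. distributed M lborel (\<lambda>\<omega>. sqrt (real n) *\<^sub>R (U n \<omega> - b n))
                  (\<lambda>v. ennreal (max 0 (precision_density \<sigma> (S n) v)))"
    using U eventually_gt_at_top[of "0::nat"]
  proof eventually_elim
    case (elim n)
    let ?c = "1 / sqrt (real n)"
    have c: "?c > 0" using elim(3) by simp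
    have "distributed M lborel (\<lambda>\<omega>. (1 / ?c) *\<^sub>R (U n \<omega> - b n))
        (\<lambda>v. ennreal (\<bar>?c\<bar> ^ DIM(real^'p)) * ennreal (mvn_density (b n) (\<sigma>\<^sup>2 *\<^sub>R matrix_inv (real n *\<^sub>R S n)) (b n + ?c *\<^sub>R v)))"
      using elim(2) c unfolding has_mvn_def by (intro distributed_standardize) auto
    moreover have "ennreal (\<bar>?c\<bar> ^ DIM(real^'p)) * ennreal (mvn_density (b n) (\<sigma>\<^sup>2 *\<^sub>R matrix_inv (real n *\<^sub>R S n)) (b n + ?c *\<^sub>R v))
        = ennreal (precision_density \<sigma> (S n) v)" for v
      using mvn_density_eq_precision_density[OF elim(1) \<sigma> c, of "b n" v] c elim(3)
      by (subst ennreal_mult'[symmetric]) (auto simp: power_divide)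
    ultimately show ?case by simp
  qed
  show ?thesis
  proof (rule conv_strong_densities[OF M N V])
    show "distributed N lborel W (\<lambda>v. ennreal (max 0 (precision_density \<sigma> S\<^sub>0 v)))"
      using W unfolding has_mvn_def mvn_density_precision[OF inv \<sigma>] by simp
    show "(\<lambda>n. max 0 (precision_density \<sigma> (S n) v)) \<longlonglongrightarrow> max 0 (precision_density \<sigma> S\<^sub>0 v)" for v
      unfolding precision_density_def using \<sigma>
      by (intro tendsto_max tendsto_const tendsto_mult tendsto_divide tendsto_real_sqrt tendsto_det
            tendsto_exp tendsto_minus tendsto_inner tendsto_matrix_vector_mult S) auto
  qed auto
qed

section \<open>Concentration of chi-squared variables\<close>

abbreviation std_normal_measure :: "real measure" where
  "std_normal_measure \<equiv> density lborel (\<lambda>t. ennreal (std_normal_density t))"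

lemma prob_space_std_normal: "prob_space std_normal_measure"
  by (rule prob_space_normal_density) simp

lemma std_normal_integrals:
  shows "integrable std_normal_measure (\<lambda>t. t\<^sup>2 - 1)" "(\<integral>t. t\<^sup>2 - 1 \<partial>std_normal_measure) = 0"
    and "integrable std_normal_measure (\<lambda>t. (t\<^sup>2 - 1)\<^sup>2)" "(\<integral>t. (t\<^sup>2 - 1)\<^sup>2 \<partial>std_normal_measure) = 2"
proof -
  interpret prob_space std_normal_measure by (rule prob_space_std_normal)
  have m: "integrable std_normal_measure (\<lambda>t. t ^ k)" for k
    by (subst integrable_density) (auto simp: integrable_std_normal_moment)
  have m2: "(\<integral>t. t\<^sup>2 \<partial>std_normal_measure) = 1"
    using integral_std_normal_moment_even[of 1] by (subst integral_density) (auto simp: fact_numeral)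
  have m4: "(\<integral>t. t ^ 4 \<partial>std_normal_measure) = 3"
    using integral_std_normal_moment_even[of 2] by (subst integral_density) (auto simp: fact_numeral)
  have e: "(t\<^sup>2 - 1)\<^sup>2 = t ^ 4 - 2 * t\<^sup>2 + 1" for t :: real
    by (simp add: power2_eq_square power4_eq_xxxx algebra_simps)
  show "integrable std_normal_measure (\<lambda>t. t\<^sup>2 - 1)" "integrable std_normal_measure (\<lambda>t. (t\<^sup>2 - 1)\<^sup>2)"
    unfolding e using m by auto
  show "(\<integral>t. t\<^sup>2 - 1 \<partial>std_normal_measure) = 0"
    using m[of 2] m2 prob_space by simp
  show "(\<integral>t. (t\<^sup>2 - 1)\<^sup>2 \<partial>std_normal_measure) = 2"
    unfolding e using m[of 2] m[of 4] m2 m4 prob_space by simp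
qed

text \<open>
  Chebyshev's inequality; the variance \<open>2 k\<close> comes from the fourth moment \<open>3\<close> of the normal law.
\<close>

lemma chi_squared_deviation:
  assumes k: "0 < k" and \<epsilon>: "0 < \<epsilon>"
  shows "measure (chi_squared k) {t. \<bar>t - real k\<bar> \<ge> \<epsilon> * real k} \<le> 2 / (\<epsilon>\<^sup>2 * real k)"
proof -
  let ?P = "Pi\<^sub>M {..<k} (\<lambda>_. std_normal_measure)"
  interpret S: prob_space std_normal_measure by (rule prob_space_std_normal)
  interpret F: product_prob_space "\<lambda>_. std_normal_measure" "{..<k}" by standard
  interpret P: prob_space ?P by (rule prob_space_PiM) (rule prob_space_std_normal)
  define Y where "Y z = (\<Sum>i<k. (z i)\<^sup>2 - 1)" for z :: "nat \<Rightarrow> real"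
  have "integrable ?P (\<lambda>z. ((z i)\<^sup>2 - 1) * ((z j)\<^sup>2 - 1)) \<and>
      (\<integral>z. ((z i)\<^sup>2 - 1) * ((z j)\<^sup>2 - 1) \<partial>?P) = (if i = j then 2 else 0)"
    if ij: "i < k" "j < k" for i j
  proof -
    \<comment> \<open>The product of the two centred squares, as a product of functions of single coordinates.\<close>
    define f where "f l = (if l = i \<and> l = j then (\<lambda>t :: real. (t\<^sup>2 - 1)\<^sup>2)
      else if l = i \<or> l = j then (\<lambda>t. t\<^sup>2 - 1) else (\<lambda>_. 1))" for l
    have f_int: "integrable std_normal_measure (f l)" for l
      using std_normal_integrals by (simp add: f_def)
    have prod: "(\<Prod>l<k. f l (z l)) = ((z i)\<^sup>2 - 1) * ((z j)\<^sup>2 - 1)" for z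
    proof -
      have "(\<Prod>l<k. f l (z l)) = (\<Prod>l\<in>{i, j}. f l (z l))"
        using ij by (intro prod.mono_neutral_right) (auto simp: f_def)
      then show ?thesis by (cases "i = j") (auto simp: f_def power2_eq_square)
    qed
    have "(\<Prod>l<k. \<integral>t. f l t \<partial>std_normal_measure) = (if i = j then 2 else 0)"
    proof (cases "i = j")
      case True
      have "(\<Prod>l<k. \<integral>t. f l t \<partial>std_normal_measure) = (\<Prod>l\<in>{i}. \<integral>t. f l t \<partial>std_normal_measure)"
        using ij S.prob_space True by (intro prod.mono_neutral_right) (auto simp: f_def)
      then show ?thesis using True std_normal_integrals by (simp add: f_def)
    next
      case False
      then have "(\<integral>t. f i t \<partial>std_normal_measure) = 0" using std_normal_integrals by (simp add: f_def)
      then have "(\<Prod>l<k. \<integral>t. f l t \<partial>std_normal_measure) = 0"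
        using ij by (intro prod_zero) auto
      then show ?thesis using False by simp
    qed
    then show ?thesis
      using F.product_integrable_prod[of "{..<k}" f] F.product_integral_prod[of "{..<k}" f] f_int
      by (simp add: prod)
  qed
  then have cov: "\<And>i j. i < k \<Longrightarrow> j < k \<Longrightarrow> integrable ?P (\<lambda>z. ((z i)\<^sup>2 - 1) * ((z j)\<^sup>2 - 1))"
    "\<And>i j. i < k \<Longrightarrow> j < k \<Longrightarrow> (\<integral>z. ((z i)\<^sup>2 - 1) * ((z j)\<^sup>2 - 1) \<partial>?P) = (if i = j then 2 else 0)"
    by auto
  have Y2: "(Y z)\<^sup>2 = (\<Sum>i<k. \<Sum>j<k. ((z i)\<^sup>2 - 1) * ((z j)\<^sup>2 - 1))" for z
    by (simp add: Y_def power2_eq_square sum_product)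
  have Y_int: "integrable ?P (\<lambda>z. (Y z)\<^sup>2)"
    unfolding Y2 using cov(1) by (intro Bochner_Integration.integrable_sum ballI) auto
  have "(\<integral>z. (Y z)\<^sup>2 \<partial>?P) = (\<Sum>i<k. \<integral>z. (\<Sum>j<k. ((z i)\<^sup>2 - 1) * ((z j)\<^sup>2 - 1)) \<partial>?P)"
    unfolding Y2 using cov(1)
    by (intro Bochner_Integration.integral_sum Bochner_Integration.integrable_sum) auto
  also have "\<dots> = (\<Sum>i<k. \<Sum>j<k. \<integral>z. ((z i)\<^sup>2 - 1) * ((z j)\<^sup>2 - 1) \<partial>?P)"
    using cov(1) by (intro sum.cong refl Bochner_Integration.integral_sum) auto
  also have "\<dots> = (\<Sum>i<k. \<Sum>j<k. if i = j then 2 else 0)"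
    using cov(2) by (intro sum.cong refl) auto
  finally have Y_var: "(\<integral>z. (Y z)\<^sup>2 \<partial>?P) = 2 * real k"
    by (simp add: sum.delta)
  have [measurable]: "Y \<in> borel_measurable ?P" unfolding Y_def by measurable
  have [measurable]: "(\<lambda>z. \<Sum>i<k. (z i)\<^sup>2) \<in> borel_measurable ?P" by measurable
  have "measure (chi_squared k) {t. \<bar>t - real k\<bar> \<ge> \<epsilon> * real k}
      = measure ?P {z \<in> space ?P. \<bar>Y z\<bar> \<ge> \<epsilon> * real k}"
    unfolding chi_squared_def
    by (subst measure_distr) (auto simp: Y_def sum_subtractf vimage_def Int_def conj_commute intro!: arg_cong[where f = "measure ?P"])
  also have "\<dots> \<le> (\<integral>z. (Y z)\<^sup>2 \<partial>?P) / (\<epsilon> * real k)\<^sup>2"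
    using k \<epsilon> by (intro F.second_moment_method Y_int) auto
  also have "\<dots> = 2 / (\<epsilon>\<^sup>2 * real k)"
    unfolding Y_var using k by (simp add: power2_eq_square)
  finally show ?thesis .
qed

lemma sets_chi_squared [measurable_cong, simp]: "sets (chi_squared k) = sets borel"
  by (simp add: chi_squared_def)

lemma prob_space_chi_squared: "prob_space (chi_squared k)"
proof -
  interpret P: prob_space "Pi\<^sub>M {..<k} (\<lambda>_. std_normal_measure)"
    by (rule prob_space_PiM) (rule prob_space_std_normal)
  show ?thesis unfolding chi_squared_def by (rule P.prob_space_distr) measurable
qed

lemma scaled_chi_squared_conv_in_prob:
  fixes s :: "nat \<Rightarrow> 'w \<Rightarrow> real"
  assumes \<sigma>: "0 < \<sigma>"
    and s: "\<forall>\<^sub>F n in sequentially. (\<lambda>\<omega>. real (n - p) * s n \<omega> / \<sigma>\<^sup>2) \<in> borel_measurable M \<and>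
      distr M borel (\<lambda>\<omega>. real (n - p) * s n \<omega> / \<sigma>\<^sup>2) = chi_squared (n - p)"
  shows "conv_in_prob M s (\<lambda>_. \<sigma>\<^sup>2)"
  unfolding conv_in_prob_def
proof (intro conjI allI impI)
  have ev: "\<forall>\<^sub>F n in sequentially. n > p" by (rule eventually_gt_at_top)
  have resc: "(\<lambda>\<omega>. \<sigma>\<^sup>2 / real (n - p) * (real (n - p) * s n \<omega> / \<sigma>\<^sup>2)) = s n" if "n > p" for n
    using that \<sigma> by (simp add: fun_eq_iff)
  show "\<forall>\<^sub>F n in sequentially. s n \<in> borel_measurable M"
    using s ev
  proof eventually_elim
    case (elim n)
    then have "(\<lambda>\<omega>. \<sigma>\<^sup>2 / real (n - p) * (real (n - p) * s n \<omega> / \<sigma>\<^sup>2)) \<in> borel_measurable M"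
      by (intro borel_measurable_times) auto
    then show ?case using resc elim by simp
  qed
  show "(\<lambda>_. \<sigma>\<^sup>2) \<in> borel_measurable M" by (rule borel_measurable_const)
  fix e :: real assume e: "0 < e"
  define \<epsilon> where "\<epsilon> = e / \<sigma>\<^sup>2"
  have \<epsilon>: "0 < \<epsilon>" using e \<sigma> by (simp add: \<epsilon>_def)
  show "(\<lambda>n. measure M {\<omega> \<in> space M. e < dist (s n \<omega>) (\<sigma>\<^sup>2)}) \<longlonglongrightarrow> 0"
  proof (rule tendsto_sandwich[OF _ _ tendsto_const])
    show "(\<lambda>n. 2 / (\<epsilon>\<^sup>2 * real (n - p))) \<longlonglongrightarrow> 0"
      using \<epsilon> by real_asymp
    show "\<forall>\<^sub>F n in sequentially. measure M {\<omega> \<in> space M. e < dist (s n \<omega>) (\<sigma>\<^sup>2)} \<le> 2 / (\<epsilon>\<^sup>2 * real (n - p))"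
      using s ev
    proof eventually_elim
      case (elim n)
      let ?m = "real (n - p)" and ?X = "\<lambda>\<omega>. real (n - p) * s n \<omega> / \<sigma>\<^sup>2"
      let ?A = "{t. \<bar>t - ?m\<bar> \<ge> \<epsilon> * ?m}"
      have m: "0 < ?m" using elim by simp
      have [measurable]: "?X \<in> borel_measurable M" using elim by blast
      interpret D: prob_space "distr M borel ?X" using elim prob_space_chi_squared by simp
      have fin: "emeasure M (space M) = 1"
        using D.emeasure_space_1 by (simp add: emeasure_distr)
      interpret M: finite_measure M by standard (simp add: fin)
      have "{\<omega> \<in> space M. e < dist (s n \<omega>) (\<sigma>\<^sup>2)} \<subseteq> ?X -` ?A \<inter> space M"
      proof (rule subsetI)
        fix \<omega> assume \<omega>: "\<omega> \<in> {\<omega> \<in> space M. e < dist (s n \<omega>) (\<sigma>\<^sup>2)}"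
        then have "?m / \<sigma>\<^sup>2 * e \<le> ?m / \<sigma>\<^sup>2 * \<bar>s n \<omega> - \<sigma>\<^sup>2\<bar>"
          using m by (intro mult_left_mono) (auto simp: dist_real_def)
        also have "\<dots> = \<bar>?m / \<sigma>\<^sup>2 * (s n \<omega> - \<sigma>\<^sup>2)\<bar>"
          using m by (simp add: abs_mult)
        also have "?m / \<sigma>\<^sup>2 * (s n \<omega> - \<sigma>\<^sup>2) = ?X \<omega> - ?m"
          using \<sigma> by (simp add: field_simps)
        finally have "\<epsilon> * ?m \<le> \<bar>?X \<omega> - ?m\<bar>" by (simp add: \<epsilon>_def mult.commute)
        then show "\<omega> \<in> ?X -` ?A \<inter> space M" using \<omega> by simp
      qed
      then have "measure M {\<omega> \<in> space M. e < dist (s n \<omega>) (\<sigma>\<^sup>2)} \<le> measure M (?X -` ?A \<inter> space M)"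
        by (intro M.finite_measure_mono) measurable
      also have "\<dots> = measure (chi_squared (n - p)) ?A"
        using elim by (subst measure_distr[symmetric]) auto
      also have "\<dots> \<le> 2 / (\<epsilon>\<^sup>2 * ?m)"
        using elim \<epsilon> by (intro chi_squared_deviation) auto
      finally show ?case .
    qed
  qed simp
qed

section \<open>Linear changes of variables and standard Gaussian measures\<close>

text \<open>
  Uniqueness of Haar measure, proved directly: for the indicator \<open>B\<close> of the unit ball, integrate
  \<open>f y * B (y - T g)\<close> over \<open>y\<close> and \<open>g\<close> in both orders.  One order gives the volume of the ball times the
  left side, the other a multiple of the integral of \<open>f\<close>.  In the application to
  probability laws the factor \<open>k\<close> is determined by normalization.
\<close>

lemma nn_integral_lborel_linear:
  fixes T :: "'a::euclidean_space \<Rightarrow> 'a"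
  assumes T: "linear T" "surj T"
  shows "\<exists>k. \<forall>f\<in>borel_measurable borel. (\<integral>\<^sup>+g. f (T g) \<partial>lborel) = k * (\<integral>\<^sup>+y. f y \<partial>lborel)"
proof -
  define B :: "'a \<Rightarrow> ennreal" where "B = indicator (cball 0 1)"
  have [measurable]: "B \<in> borel_measurable borel" unfolding B_def
    by (intro borel_measurable_indicator borel_closed closed_cball)
  have ball[measurable]: "cball (0::'a) 1 \<in> sets borel" by (rule borel_closed) simp
  define I where "I f = (\<integral>\<^sup>+g. f (T g) \<partial>lborel)" for f :: "'a \<Rightarrow> ennreal"
  define vB where "vB = emeasure lborel (cball 0 1 :: 'a set)"
  have [measurable]: "T \<in> borel_measurable borel"
    using T(1) by (intro borel_measurable_continuous_onI linear_continuous_on)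
      (simp add: linear_conv_bounded_linear)
  have shift: "(\<integral>\<^sup>+x. f (t + x) \<partial>lborel) = (\<integral>\<^sup>+x. f x \<partial>lborel)"
    and flip: "(\<integral>\<^sup>+x. f (t - x) \<partial>lborel) = (\<integral>\<^sup>+x. f x \<partial>lborel)"
    if "f \<in> borel_measurable borel" for f :: "'a \<Rightarrow> ennreal" and t
    using nn_integral_lborel_affine[OF that, of 1 t] nn_integral_lborel_affine[OF that, of "-1" t]
    by simp_all
  have key: "vB * I f = I B * (\<integral>\<^sup>+y. f y \<partial>lborel)"
    if [measurable]: "f \<in> borel_measurable borel" for f
  proof -
    have inner: "(\<integral>\<^sup>+g. f (y + T g) \<partial>lborel) = I f" for y
    proof -
      obtain g\<^sub>0 where y: "y = T g\<^sub>0" using T(2) by blast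
      have "(\<integral>\<^sup>+g. f (T (g\<^sub>0 + g)) \<partial>lborel) = I f"
        unfolding I_def by (rule shift) measurable
      then show ?thesis by (simp add: y linear_add[OF T(1)])
    qed
    have inner': "(\<integral>\<^sup>+g. B (y - T g) \<partial>lborel) = I B" for y
    proof -
      obtain g\<^sub>0 where y: "y = T g\<^sub>0" using T(2) by blast
      have "(\<integral>\<^sup>+g. B (T (g\<^sub>0 - g)) \<partial>lborel) = I B"
        unfolding I_def by (rule flip) measurable
      then show ?thesis by (simp add: y linear_diff[OF T(1)])
    qed
    have "vB * I f = (\<integral>\<^sup>+y. B y * (\<integral>\<^sup>+g. f (y + T g) \<partial>lborel) \<partial>lborel)"
      unfolding inner vB_def B_def by (subst nn_integral_multc) simp_all
    also have "\<dots> = (\<integral>\<^sup>+y. (\<integral>\<^sup>+g. B y * f (y + T g) \<partial>lborel) \<partial>lborel)"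
      by (intro nn_integral_cong nn_integral_cmult[symmetric]) measurable
    also have "\<dots> = (\<integral>\<^sup>+g. (\<integral>\<^sup>+y. B y * f (y + T g) \<partial>lborel) \<partial>lborel)"
      by (rule lborel_pair.Fubini') measurable
    also have "\<dots> = (\<integral>\<^sup>+g. (\<integral>\<^sup>+y. B (y - T g) * f y \<partial>lborel) \<partial>lborel)"
    proof (rule nn_integral_cong)
      fix g
      have "(\<integral>\<^sup>+y. B (- T g + y) * f (T g + (- T g + y)) \<partial>lborel) = (\<integral>\<^sup>+y. B y * f (T g + y) \<partial>lborel)"
        by (rule shift[of "\<lambda>y. B y * f (T g + y)"]) measurable
      then show "(\<integral>\<^sup>+y. B y * f (y + T g) \<partial>lborel) = (\<integral>\<^sup>+y. B (y - T g) * f y \<partial>lborel)"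
        by (simp add: add.commute)
    qed
    also have "\<dots> = (\<integral>\<^sup>+y. (\<integral>\<^sup>+g. B (y - T g) * f y \<partial>lborel) \<partial>lborel)"
      by (rule lborel_pair.Fubini'[symmetric]) measurable
    also have "\<dots> = (\<integral>\<^sup>+y. (\<integral>\<^sup>+g. B (y - T g) \<partial>lborel) * f y \<partial>lborel)"
      by (intro nn_integral_cong nn_integral_multc) measurable
    also have "\<dots> = I B * (\<integral>\<^sup>+y. f y \<partial>lborel)"
      by (simp add: inner' nn_integral_cmult)
    finally show ?thesis .
  qed
  have fin: "vB \<noteq> \<infinity>" unfolding vB_def using emeasure_lborel_cball_finite by (metis infinity_ennreal_def less_irrefl)
  have nz: "vB \<noteq> 0"
    using content_cball_pos[of 1 "0 :: 'a"] by (auto simp: vB_def measure_def)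
  show ?thesis
  proof (intro exI[of _ "I B / vB"] ballI)
    fix f :: "'a \<Rightarrow> ennreal" assume "f \<in> borel_measurable borel"
    from key[OF this] have "I f = I B * (\<integral>\<^sup>+y. f y \<partial>lborel) / vB"
      using fin nz by (metis ennreal_mult_divide_eq mult.commute infinity_ennreal_def)
    then show "(\<integral>\<^sup>+g. f (T g) \<partial>lborel) = I B / vB * (\<integral>\<^sup>+y. f y \<partial>lborel)"
      unfolding I_def by (simp add: ennreal_times_divide mult.commute divide_ennreal_def mult.left_commute)
  qed
qed

definition std_gaussian :: "'a::euclidean_space measure" where
  "std_gaussian = density lborel (\<lambda>g. \<Prod>b\<in>Basis. ennreal (std_normal_density (g \<bullet> b)))"

lemma sets_std_gaussian [measurable_cong, simp]: "sets std_gaussian = sets borel"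
  by (simp add: std_gaussian_def)

lemma space_std_gaussian [simp]: "space std_gaussian = UNIV"
  by (simp add: std_gaussian_def)

text \<open>
  The density is a product over the basis; the coordinates outside \<open>J\<close> integrate to \<open>1\<close>.
\<close>

lemma emeasure_std_gaussian_coordinates:
  fixes t :: "nat \<Rightarrow> 'a::euclidean_space"
  assumes t: "bij_betw t {..<k} J" and J: "J \<subseteq> Basis" and A: "\<And>i. i < k \<Longrightarrow> A i \<in> sets borel"
  shows "emeasure std_gaussian {g. \<forall>i<k. g \<bullet> t i \<in> A i} = (\<Prod>i<k. emeasure std_normal_measure (A i))"
proof -
  interpret S: prob_space std_normal_measure by (rule prob_space_std_normal)
  let ?s = "the_inv_into {..<k} t"
  define f where "f = (\<lambda>(b :: 'a) (x :: real).
    ennreal (std_normal_density x) * (if b \<in> J then indicator (A (?s b)) x else 1))"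
  have inj: "inj_on t {..<k}" and im: "t ` {..<k} = J" using t by (auto simp: bij_betw_def)
  have s_t: "?s (t i) = i" if "i < k" for i using the_inv_into_f_f[OF inj] that by auto
  have s_J: "?s b < k" "t (?s b) = b" if "b \<in> J" for b
    using that im s_t by auto
  have A': "A (?s b) \<in> sets borel" if "b \<in> J" for b using A s_J(1)[OF that] by blast
  have restr: "(\<Prod>b\<in>Basis. if b \<in> J then h b else 1) = (\<Prod>b\<in>J. h b)" for h :: "'a \<Rightarrow> ennreal"
    using prod.inter_restrict[OF finite_Basis, of h J] Int_absorb1[OF J] by simp
  have reindex: "(\<Prod>b\<in>J. h (?s b) b) = (\<Prod>i<k. h i (t i))" for h :: "nat \<Rightarrow> 'a \<Rightarrow> ennreal"
    unfolding im[symmetric] prod.reindex[OF inj] comp_def by (intro prod.cong refl) (simp add: s_t)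
  have f[measurable]: "f b \<in> borel_measurable borel" for b
  proof (cases "b \<in> J")
    case True
    note [measurable] = A'[OF True]
    show ?thesis unfolding f_def by measurable
  next
    case False
    then show ?thesis unfolding f_def by simp
  qed
  have sets: "{g. \<forall>i<k. g \<bullet> t i \<in> A i} \<in> sets borel"
  proof -
    have "{g \<in> space borel. g \<bullet> t i \<in> A i} \<in> sets borel" if "i \<in> {..<k}" for i
    proof -
      have "(\<lambda>g. g \<bullet> t i) \<in> borel_measurable borel" by simp
      from measurable_sets[OF this A] show ?thesis using that by (simp add: vimage_def)
    qed
    then have "{g \<in> space borel. \<forall>i\<in>{..<k}. g \<bullet> t i \<in> A i} \<in> sets borel"
      by (intro sets.sets_Collect_finite_All) auto
    moreover have "{g \<in> space borel. \<forall>i\<in>{..<k}. g \<bullet> t i \<in> A i} = {g. \<forall>i<k. g \<bullet> t i \<in> A i}"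
      by auto
    ultimately show ?thesis by (simp only:)
  qed
  have eq: "(\<Prod>b\<in>Basis. ennreal (std_normal_density (g \<bullet> b))) * indicator {g. \<forall>i<k. g \<bullet> t i \<in> A i} g
      = (\<Prod>b\<in>Basis. f b (g \<bullet> b))" for g
  proof -
    have "(\<Prod>b\<in>Basis. if b \<in> J then indicator (A (?s b)) (g \<bullet> b) else 1) = (\<Prod>i<k. indicator (A i) (g \<bullet> t i) :: ennreal)"
      unfolding restr by (rule reindex[of "\<lambda>i b. indicator (A i) (g \<bullet> b)"])
    also have "\<dots> = indicator {g. \<forall>i<k. g \<bullet> t i \<in> A i} g"
    proof (cases "\<forall>i<k. g \<bullet> t i \<in> A i")
      case False
      then have "(\<Prod>i<k. indicator (A i) (g \<bullet> t i) :: ennreal) = 0"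
        by (intro prod_zero) (auto intro!: bexI simp: indicator_def)
      then show ?thesis using False by simp
    qed simp
    finally show ?thesis unfolding f_def prod.distrib by (simp only:)
  qed
  have "emeasure std_gaussian {g. \<forall>i<k. g \<bullet> t i \<in> A i} = (\<integral>\<^sup>+g. (\<Prod>b\<in>Basis. f b (g \<bullet> b)) \<partial>lborel)"
  proof -
    have dens: "(\<lambda>g :: 'a. \<Prod>b\<in>Basis. ennreal (std_normal_density (g \<bullet> b))) \<in> borel_measurable lborel"
      by measurable
    show ?thesis
      using emeasure_density[OF dens, of "{g. \<forall>i<k. g \<bullet> t i \<in> A i}"] sets
      by (simp only: std_gaussian_def eq sets_lborel)
  qed
  also have "\<dots> = (\<Prod>b\<in>Basis. \<integral>\<^sup>+x. f b x \<partial>lborel)"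
    by (rule nn_integral_lborel_prod) (simp_all only: f zero_le)
  also have "\<dots> = (\<Prod>b\<in>Basis. if b \<in> J then emeasure std_normal_measure (A (?s b)) else 1)"
  proof (rule prod.cong[OF refl])
    fix b :: 'a
    show "(\<integral>\<^sup>+x. f b x \<partial>lborel) = (if b \<in> J then emeasure std_normal_measure (A (?s b)) else 1)"
    proof (cases "b \<in> J")
      case True
      then show ?thesis using A'[OF True] by (simp add: f_def emeasure_density)
    next
      case False
      then show ?thesis using S.emeasure_space_1 by (simp add: f_def emeasure_density)
    qed
  qed
  also have "\<dots> = (\<Prod>i<k. emeasure std_normal_measure (A i))"
    unfolding restr by (rule reindex[of "\<lambda>i _. emeasure std_normal_measure (A i)"])
  finally show ?thesis .
qed

lemma distr_std_gaussian_sum_squares: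
  fixes J :: "'a::euclidean_space set"
  assumes J: "J \<subseteq> Basis"
  shows "distr std_gaussian borel (\<lambda>g. \<Sum>b\<in>J. (g \<bullet> b)\<^sup>2) = chi_squared (card J)"
proof -
  have "finite J" using finite_subset[OF J finite_Basis] .
  then obtain t where t: "bij_betw t {..<card J} J"
    using ex_bij_betw_nat_finite atLeast0LessThan by metis
  interpret S: prob_space std_normal_measure by (rule prob_space_std_normal)
  interpret S: product_sigma_finite "\<lambda>_::nat. std_normal_measure" by standard
  let ?P = "Pi\<^sub>M {..<card J} (\<lambda>_::nat. std_normal_measure)"
  let ?X = "\<lambda>g. restrict (\<lambda>i. g \<bullet> t i) {..<card J}"
  have X[measurable]: "?X \<in> measurable std_gaussian ?P"
    by (intro measurable_restrict) simp
  have law: "distr std_gaussian ?P ?X = ?P"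
  proof (rule S.PiM_eqI)
    fix A :: "nat \<Rightarrow> real set" assume A: "\<And>i. i \<in> {..<card J} \<Longrightarrow> A i \<in> sets std_normal_measure"
    then have PA: "Pi\<^sub>E {..<card J} A \<in> sets ?P" by (intro sets_PiM_I_finite) auto
    have "?X g \<in> Pi\<^sub>E {..<card J} A \<longleftrightarrow> (\<forall>i<card J. g \<bullet> t i \<in> A i)" for g
      unfolding restrict_PiE_iff by (simp only: Ball_def lessThan_iff)
    then have "?X -` Pi\<^sub>E {..<card J} A \<inter> space std_gaussian = {g. \<forall>i<card J. g \<bullet> t i \<in> A i}"
      by (simp only: vimage_def space_std_gaussian Int_UNIV_right)
    then have "emeasure (distr std_gaussian ?P ?X) (Pi\<^sub>E {..<card J} A)
        = emeasure std_gaussian {g. \<forall>i<card J. g \<bullet> t i \<in> A i}"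
      using emeasure_distr[OF X PA] by simp
    also have "\<dots> = (\<Prod>i<card J. emeasure std_normal_measure (A i))"
      using A by (intro emeasure_std_gaussian_coordinates[OF t J]) auto
    finally show "emeasure (distr std_gaussian ?P ?X) (Pi\<^sub>E {..<card J} A)
        = (\<Prod>i<card J. emeasure std_normal_measure (A i))" .
  qed simp_all
  have sum: "(\<Sum>i<card J. (?X g i)\<^sup>2) = (\<Sum>b\<in>J. (g \<bullet> b)\<^sup>2)" for g
    using sum.reindex_bij_betw[OF t, of "\<lambda>b. (g \<bullet> b)\<^sup>2"] by simp
  have [measurable]: "(\<lambda>z. \<Sum>i<card J. (z i)\<^sup>2) \<in> borel_measurable ?P" by measurable
  have "chi_squared (card J) = distr (distr std_gaussian ?P ?X) borel (\<lambda>z. \<Sum>i<card J. (z i)\<^sup>2)"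
    by (simp only: law chi_squared_def)
  also have "\<dots> = distr std_gaussian borel (\<lambda>g. \<Sum>i<card J. (?X g i)\<^sup>2)"
    by (subst distr_distr) (auto simp: comp_def)
  finally show ?thesis unfolding sum by simp
qed

section \<open>Bases adapted to the restriction\<close>

definition orthonormal_wrt :: "real^'n^'n \<Rightarrow> (real^'n) set \<Rightarrow> bool" where
  "orthonormal_wrt A E \<longleftrightarrow> (\<forall>u\<in>E. \<forall>v\<in>E. u \<bullet> (A *v v) = (if u = v then 1 else 0))"

lemma linear_form: "linear (\<lambda>v. u \<bullet> (A *v v))" for A :: "real^'n^'m"
  by (intro linearI) (simp_all add: matrix_vector_right_distrib inner_add_right matrix_vector_mult_scaleR)

lemma orthonormal_wrt_independent:
  assumes "orthonormal_wrt A E"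
  shows "independent E"
proof
  assume "dependent E"
  then obtain e where e: "e \<in> E" "e \<in> span (E - {e})" by (auto simp: dependent_def)
  have "e \<bullet> (A *v e) = 0"
  proof (rule linear_eq_0_on_span[OF linear_form _ e(2)])
    show "e \<bullet> (A *v x) = 0" if "x \<in> E - {e}" for x
      using assms e(1) that by (auto simp: orthonormal_wrt_def)
  qed
  then show False using assms e(1) by (auto simp: orthonormal_wrt_def)
qed

text \<open>
  Gram--Schmidt for the form \<open>A\<close>: in an orthonormal superset of maximal cardinality, a vector outside the
  span could be projected, normalized and added.
\<close>

lemma orthonormal_wrt_extend:
  fixes A :: "real^'n^'n"
  assumes A: "coercive c A" "transpose A = A" and S: "subspace S"
    and E: "orthonormal_wrt A E" "E \<subseteq> S"
  obtains E' where "E \<subseteq> E'" "E' \<subseteq> S" "orthonormal_wrt A E'" "span E' = S"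
proof -
  let ?P = "\<lambda>E'. E \<subseteq> E' \<and> E' \<subseteq> S \<and> orthonormal_wrt A E'"
  have "\<exists>E'. ?P E' \<and> (\<forall>F. ?P F \<longrightarrow> card F \<le> card E')"
  proof (rule ex_has_greatest_nat[where b = "Suc DIM(real^'n)" and k = E])
    show "\<forall>F. ?P F \<longrightarrow> card F < Suc DIM(real^'n)"
      using independent_bound orthonormal_wrt_independent by (metis less_Suc_eq_le)
  qed (use E in auto)
  then obtain E' where E': "?P E'" and max: "\<And>F. ?P F \<Longrightarrow> card F \<le> card E'" by blast
  have fin: "finite E'" using E' orthonormal_wrt_independent independent_imp_finite by blast
  have on: "u \<bullet> (A *v v) = (if u = v then 1 else 0)" if "u \<in> E'" "v \<in> E'" for u v
    using E' that by (auto simp: orthonormal_wrt_def)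
  have "x \<in> span E'" if x: "x \<in> S" for x
  proof (rule ccontr)
    assume nx: "x \<notin> span E'"
    define p where "p = (\<Sum>e\<in>E'. (e \<bullet> (A *v x)) *\<^sub>R e)"
    define y where "y = x - p"
    have p: "p \<in> span E'" unfolding p_def by (intro span_sum span_scale span_base)
    have y0: "y \<noteq> 0" using nx p by (auto simp: y_def)
    have pS: "p \<in> S" using p E' S span_minimal by blast
    have yS: "y \<in> S" unfolding y_def using S x pS by (rule subspace_diff)
    have orth: "e \<bullet> (A *v y) = 0" if "e \<in> E'" for e
    proof -
      have "e \<bullet> (A *v p) = (\<Sum>e'\<in>E'. (e' \<bullet> (A *v x)) * (e \<bullet> (A *v e')))"
        unfolding p_def linear_sum[OF linear_form] linear_cmul[OF linear_form] real_scaleR_def ..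
      also have "\<dots> = (\<Sum>e'\<in>E'. if e' = e then e' \<bullet> (A *v x) else 0)"
        using that on by (intro sum.cong) auto
      also have "\<dots> = e \<bullet> (A *v x)" using that fin by simp
      finally show ?thesis by (simp add: y_def matrix_vector_mult_diff_distrib inner_diff_right)
    qed
    define r where "r = sqrt (y \<bullet> (A *v y))"
    have pos: "0 < y \<bullet> (A *v y)" using A(1) y0 by (rule coercive_pos)
    then have r: "0 < r" "r * r = y \<bullet> (A *v y)" by (auto simp: r_def)
    define z where "z = (1 / r) *\<^sub>R y"
    have zz: "z \<bullet> (A *v z) = 1"
      using r pos by (simp add: z_def matrix_vector_mult_scaleR)
    have ez: "e \<bullet> (A *v z) = 0" if "e \<in> E'" for e
      using orth[OF that] by (simp add: z_def matrix_vector_mult_scaleR)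
    have ze: "z \<bullet> (A *v e) = 0" if "e \<in> E'" for e
      using ez[OF that] symmetric_form_commute[OF A(2)] by metis
    have zE: "z \<notin> E'" using ez[of z] zz by auto
    moreover have "?P (insert z E')"
    proof (intro conjI)
      show "orthonormal_wrt A (insert z E')"
        using on zz ez ze zE unfolding orthonormal_wrt_def by auto
      show "insert z E' \<subseteq> S" using E' subspace_scale[OF S yS] by (simp add: z_def)
    qed (use E' in auto)
    ultimately show False using max[of "insert z E'"] fin by simp
  qed
  then have "span E' = S" using E' S by (metis span_minimal subset_antisym subsetI)
  then show thesis using E' that by blast
qed

lemma sandwich_form:
  fixes C :: "real^'p^'p" and H :: "real^'p^'q"
  shows "y \<bullet> ((H ** B ** transpose H) *v z) = (transpose H *v y) \<bullet> (B *v (transpose H *v z))"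
  by (simp add: matrix_vector_mul_assoc[symmetric] dot_lmul_matrix)

lemma transpose_matrix_inv_symmetric:
  fixes A :: "real^'n^'n"
  assumes "invertible A" "transpose A = A"
  shows "transpose (matrix_inv A) = matrix_inv A"
proof -
  have "A ** transpose (matrix_inv A) = mat 1"
    using matrix_inv_cancel(2)[OF assms(1)] assms(2) by (metis matrix_transpose_mul transpose_mat)
  then show ?thesis by (metis matrix_inv_unique)
qed

lemma positive_definite_matrix_inv:
  fixes A :: "real^'n^'n"
  assumes c: "coercive c A" and sym: "transpose A = A"
  shows "positive_definite (matrix_inv A)"
  unfolding positive_definite_def
proof (intro conjI allI impI)
  have inv: "invertible A" using c by (rule coercive_invertible)
  show "transpose (matrix_inv A) = matrix_inv A"
    using inv sym by (rule transpose_matrix_inv_symmetric)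
  fix v :: "real^'n" assume v: "v \<noteq> 0"
  let ?w = "matrix_inv A *v v"
  have w: "A *v ?w = v" by (simp add: matrix_vector_mul_assoc matrix_inv_cancel[OF inv])
  then have "?w \<noteq> 0" using v by auto
  with c have "0 < ?w \<bullet> (A *v ?w)" by (rule coercive_pos)
  then show "0 < v \<bullet> (matrix_inv A *v v)" by (simp add: w inner_commute)
qed

lemma positive_definite_sandwich:
  fixes C :: "real^'p^'p" and H :: "real^'p^'q"
  assumes B: "positive_definite B" and H: "rank H = CARD('q)"
  shows "positive_definite (H ** B ** transpose H)"
  unfolding positive_definite_def
proof (intro conjI allI impI)
  show "transpose (H ** B ** transpose H) = H ** B ** transpose H"
    using B by (simp add: matrix_transpose_mul matrix_mul_assoc positive_definite_def)
  fix v :: "real^'q" assume v: "v \<noteq> 0"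
  have "inj ((*v) (transpose H))" using H by (simp add: full_rank_injective[symmetric] rank_transpose)
  then have "transpose H *v v \<noteq> 0" using v by (metis injD matrix_vector_mult_0_right)
  then show "0 < v \<bullet> ((H ** B ** transpose H) *v v)"
    unfolding sandwich_form using B unfolding positive_definite_def by blast
qed

text \<open>
  Take a \<open>C\<close>-orthonormal basis whose first \<open>q\<close> vectors span the range of \<open>C\<^sup>-\<^sup>1 H\<^sup>T\<close>.  The others are
  \<open>C\<close>-orthogonal to that range, which says exactly that \<open>H\<close> annihilates them.  On the range, the form
  \<open>v \<mapsto> H v \<bullet> (H C\<^sup>-\<^sup>1 H\<^sup>T)\<^sup>-\<^sup>1 H v\<close> agrees with \<open>v \<bullet> C v\<close>, so in these coordinates it is the sum of the first
  \<open>q\<close> squares.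
\<close>

lemma exists_whitening_map:
  fixes C :: "real^'p^'p" and H :: "real^'p^'q"
  assumes C: "coercive c C" "transpose C = C" and H: "rank H = CARD('q)"
  defines "A \<equiv> matrix_inv (H ** matrix_inv C ** transpose H)"
  shows "\<exists>(T :: real^'p \<Rightarrow> real^'p) J. linear T \<and> surj T \<and> J \<subseteq> Basis \<and> card J = CARD('q) \<and>
    (\<forall>g. T g \<bullet> (C *v T g) = g \<bullet> g) \<and>
    (\<forall>g. (H *v T g) \<bullet> (A *v (H *v T g)) = (\<Sum>b\<in>J. (g \<bullet> b)\<^sup>2))"
proof -
  let ?K = "H ** matrix_inv C ** transpose H"
  have invC: "invertible C" using C(1) by (rule coercive_invertible)
  have "positive_definite ?K"
    by (intro positive_definite_sandwich positive_definite_matrix_inv[OF C] H)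
  then obtain c' where "coercive c' ?K" by (rule positive_definite_coercive)
  then have invK: "invertible ?K" by (rule coercive_invertible)
  define lift where "lift z = matrix_inv C *v (transpose H *v z)" for z
  have C_lift: "C *v lift z = transpose H *v z" for z
    by (simp add: lift_def matrix_vector_mul_assoc matrix_mul_assoc matrix_inv_cancel[OF invC] del: transpose_matrix_vector)
  have AH_lift: "A *v (H *v lift z) = z" for z
    by (simp add: A_def lift_def matrix_vector_mul_assoc matrix_mul_assoc matrix_inv_cancel[OF invK, unfolded matrix_mul_assoc] del: transpose_matrix_vector)
  have dual: "v \<bullet> (C *v lift z) = (H *v v) \<bullet> z" for v z
    unfolding C_lift by (metis dot_lmul_matrix inner_commute transpose_matrix_vector)
  have lin: "linear lift" unfolding lift_def
    by (intro linearI) (simp_all add: matrix_vector_right_distrib matrix_vector_mult_scaleR del: transpose_matrix_vector)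
  have inj: "inj lift" by (metis AH_lift injI)
  let ?R = "range lift"
  have subR: "subspace ?R" using lin by (rule linear_subspace_image) simp
  have dimR: "dim ?R = CARD('q)"
    using dim_image_eq[OF lin, of UNIV] inj by simp
  obtain E\<^sub>0 where E\<^sub>0: "E\<^sub>0 \<subseteq> ?R" "orthonormal_wrt C E\<^sub>0" "span E\<^sub>0 = ?R"
    using orthonormal_wrt_extend[OF C subR, of "{}"] by (auto simp: orthonormal_wrt_def)
  obtain E where E: "E\<^sub>0 \<subseteq> E" "orthonormal_wrt C E" "span E = UNIV"
    using orthonormal_wrt_extend[OF C subspace_UNIV E\<^sub>0(2)] by auto
  have card_E\<^sub>0: "card E\<^sub>0 = CARD('q)"
    using dim_span_eq_card_independent[OF orthonormal_wrt_independent[OF E\<^sub>0(2)]] E\<^sub>0(3) dimR by simp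
  have card_E: "card E = DIM(real^'p)"
    using dim_span_eq_card_independent[OF orthonormal_wrt_independent[OF E(2)]] E(3) by simp
  have finE: "finite E" using orthonormal_wrt_independent[OF E(2)] by (rule independent_imp_finite)
  obtain \<epsilon> where \<epsilon>: "bij_betw \<epsilon> (Basis :: (real^'p) set) E"
    using finite_same_card_bij[OF finite_Basis finE card_E[symmetric]] by blast
  have on: "\<epsilon> b \<bullet> (C *v \<epsilon> b') = (if b = b' then 1 else 0)" if "b \<in> Basis" "b' \<in> Basis" for b b'
    using E(2) \<epsilon> that unfolding orthonormal_wrt_def bij_betw_def inj_on_def by auto
  define T where "T g = (\<Sum>b\<in>Basis. (g \<bullet> b) *\<^sub>R \<epsilon> b)" for g :: "real^'p"
  define J where "J = {b\<in>Basis. \<epsilon> b \<in> E\<^sub>0}"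
  have T: "linear T" unfolding T_def
    by (intro linearI) (simp_all add: inner_add_left scaleR_add_left sum.distrib scaleR_sum_right)
  have form: "u \<bullet> (C *v T g) = (\<Sum>b\<in>Basis. (g \<bullet> b) * (u \<bullet> (C *v \<epsilon> b)))" for u g
    unfolding T_def linear_sum[OF linear_form] linear_cmul[OF linear_form] real_scaleR_def ..
  have TC: "T g \<bullet> (C *v T g) = g \<bullet> g" for g
  proof -
    have "\<epsilon> b \<bullet> (C *v T g) = g \<bullet> b" if "b \<in> Basis" for b
      unfolding form using on that by (simp add: if_distrib[of "\<lambda>x. _ * x"] cong: if_cong)
    then have "T g \<bullet> (C *v T g) = (\<Sum>b\<in>Basis. (g \<bullet> b) * (g \<bullet> b))"
      by (subst (1) T_def) (simp add: inner_sum_left)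
    then show ?thesis by (simp add: euclidean_inner[of g g])
  qed
  have "inj T"
    using TC by (intro linear_injective_0[OF T, THEN iffD2]) (metis inner_eq_zero_iff inner_zero_left)
  then have surj: "surj T" by (rule linear_injective_imp_surjective[OF T]) simp
  have cardJ: "card J = CARD('q)"
  proof -
    have "\<epsilon> ` J = E\<^sub>0" using \<epsilon> E(1) unfolding J_def bij_betw_def by blast
    moreover have "inj_on \<epsilon> J" using \<epsilon> unfolding J_def bij_betw_def by (rule inj_on_subset[OF conjunct1]) auto
    ultimately show ?thesis using card_image card_E\<^sub>0 by metis
  qed
  have H0: "H *v \<epsilon> b = 0" if "b \<in> Basis" "b \<notin> J" for b
  proof -
    have "\<epsilon> b \<bullet> (C *v w) = 0" if "w \<in> span E\<^sub>0" for w
    proof (rule linear_eq_0_on_span[OF linear_form _ that])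
      fix e assume "e \<in> E\<^sub>0"
      then have "\<epsilon> b \<noteq> e" "e \<in> E" using that E(1) \<open>b \<in> Basis\<close> \<open>b \<notin> J\<close> by (auto simp: J_def)
      moreover have "\<epsilon> b \<in> E" using \<epsilon> \<open>b \<in> Basis\<close> by (auto simp: bij_betw_def)
      ultimately show "\<epsilon> b \<bullet> (C *v e) = 0"
        using E(2) by (simp add: orthonormal_wrt_def)
    qed
    then have "(H *v \<epsilon> b) \<bullet> z = 0" for z unfolding dual[symmetric] E\<^sub>0(3) by blast
    then show ?thesis by (metis inner_eq_zero_iff)
  qed
  have AH: "(H *v v) \<bullet> (A *v (H *v \<epsilon> b)) = v \<bullet> (C *v \<epsilon> b)" if "b \<in> J" for v b
  proof -
    have "\<epsilon> b \<in> ?R" using that E\<^sub>0(1) by (auto simp: J_def)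
    then obtain z where z: "\<epsilon> b = lift z" by blast
    show ?thesis unfolding z AH_lift dual ..
  qed
  have "(H *v T g) \<bullet> (A *v (H *v T g)) = (\<Sum>b\<in>J. (g \<bullet> b)\<^sup>2)" for g
  proof -
    have "linear (\<lambda>v. (H *v T g) \<bullet> (A *v (H *v v)))"
      using linear_form[of "H *v T g" "A ** H"] by (simp add: matrix_vector_mul_assoc)
    then have "(H *v T g) \<bullet> (A *v (H *v T g)) = (\<Sum>b\<in>Basis. (g \<bullet> b) * ((H *v T g) \<bullet> (A *v (H *v \<epsilon> b))))"
      by (subst (2) T_def) (simp add: linear_sum linear_cmul inner_sum_right)
    also have "\<dots> = (\<Sum>b\<in>Basis. if b \<in> J then (g \<bullet> b) * (T g \<bullet> (C *v \<epsilon> b)) else 0)"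
      by (intro sum.cong refl) (simp add: AH H0)
    also have "\<dots> = (\<Sum>b\<in>J. (g \<bullet> b) * (T g \<bullet> (C *v \<epsilon> b)))"
      by (simp add: J_def sum.If_cases Int_def)
    also have "\<dots> = (\<Sum>b\<in>J. (g \<bullet> b)\<^sup>2)"
    proof (rule sum.cong[OF refl])
      fix b assume b: "b \<in> J"
      have "T g \<bullet> (C *v \<epsilon> b) = \<epsilon> b \<bullet> (C *v T g)" by (rule symmetric_form_commute[OF C(2)])
      also have "\<dots> = g \<bullet> b"
        unfolding form using on b by (simp add: J_def if_distrib[of "\<lambda>x. _ * x"] cong: if_cong)
      finally show "(g \<bullet> b) * (T g \<bullet> (C *v \<epsilon> b)) = (g \<bullet> b)\<^sup>2" by (simp add: power2_eq_square)
    qed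
    finally show ?thesis .
  qed
  moreover have "J \<subseteq> Basis" by (auto simp: J_def)
  ultimately show ?thesis
    using T surj cardJ TC by blast
qed

section \<open>The limiting quadratic form\<close>

definition wald_weight :: "real^'p^'p \<Rightarrow> real^'p^'q \<Rightarrow> real^'q^'q" where
  "wald_weight S H = matrix_inv (H ** matrix_inv S ** transpose H)"

text \<open>
  The test statistic seen from the true parameter: \<open>v\<close> stands for \<open>n\<^sup>1\<^sup>/\<^sup>2 (u - \<beta>\<^sub>n)\<close> with the least squares
  estimator \<open>u\<close>, \<open>\<xi>\<close> for \<open>n\<^sup>1\<^sup>/\<^sup>2 (H \<beta>\<^sub>n - h)\<close> and \<open>s\<close> for the residual variance.
\<close>

definition wald_stat :: "real^'p^'q \<Rightarrow> real^'q^'q \<Rightarrow> real^'q \<Rightarrow> real \<Rightarrow> real^'p \<Rightarrow> real" where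
  "wald_stat H A \<xi> s v = ((H *v v + \<xi>) \<bullet> (A *v (H *v v + \<xi>))) / s"

lemma wald_weight_positive_definite:
  fixes H :: "real^'p^'q"
  assumes C: "coercive c C" "transpose C = C" and H: "rank H = CARD('q)"
  shows "positive_definite (wald_weight C H)" "invertible (H ** matrix_inv C ** transpose H)"
proof -
  have pd: "positive_definite (H ** matrix_inv C ** transpose H)"
    by (intro positive_definite_sandwich positive_definite_matrix_inv[OF C] H)
  then obtain c' where "coercive c' (H ** matrix_inv C ** transpose H)"
    by (rule positive_definite_coercive)
  then show "positive_definite (wald_weight C H)" "invertible (H ** matrix_inv C ** transpose H)"
    using pd positive_definite_matrix_inv coercive_invertible
    by (auto simp: wald_weight_def positive_definite_def)
qed

lemma tendsto_wald_stat:
  assumes "(A \<longlongrightarrow> A\<^sub>0) F" "(\<xi> \<longlongrightarrow> \<xi>\<^sub>0) F" "(s \<longlongrightarrow> s\<^sub>0) F" "(v \<longlongrightarrow> v\<^sub>0) F" "s\<^sub>0 \<noteq> 0"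
  shows "((\<lambda>t. wald_stat H (A t) (\<xi> t) (s t) (v t)) \<longlongrightarrow> wald_stat H A\<^sub>0 \<xi>\<^sub>0 s\<^sub>0 v\<^sub>0) F"
  unfolding wald_stat_def
  by (intro tendsto_divide tendsto_inner tendsto_add tendsto_matrix_vector_mult tendsto_const assms)

lemma continuous_on_wald_stat: "continuous_on X (wald_stat H A \<xi> s)"
  unfolding wald_stat_def divide_inverse by (intro continuous_intros)

lemma borel_measurable_wald_stat [measurable]: "wald_stat H A \<xi> s \<in> borel_measurable borel"
  by (intro borel_measurable_continuous_onI continuous_on_wald_stat)

text \<open>
  After the substitution \<open>v = \<sigma> T g\<close> with the whitening map \<open>T\<close>, the density of \<open>W\<close> becomes a multiple of the
  standard Gaussian density and the form a sum of \<open>q\<close> squared coordinates.  Total mass \<open>1\<close> on both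
  sides identifies the constants, so no determinant has to be computed.
\<close>

lemma wald_stat_law:
  fixes C :: "real^'p^'p" and H :: "real^'p^'q" and W :: "'v \<Rightarrow> real^'p"
  assumes N: "prob_space N" and \<sigma>: "0 < \<sigma>" and C: "coercive c C" "transpose C = C"
    and H: "rank H = CARD('q)" and W: "has_mvn N W 0 (\<sigma>\<^sup>2 *\<^sub>R matrix_inv C)"
  shows "distr N borel (\<lambda>\<omega>. wald_stat H (wald_weight C H) 0 (\<sigma>\<^sup>2) (W \<omega>)) = chi_squared CARD('q)"
proof (rule measure_eqI)
  interpret N: prob_space N by fact
  let ?Q = "wald_stat H (wald_weight C H) 0 (\<sigma>\<^sup>2)"
  obtain T :: "real^'p \<Rightarrow> real^'p" and J where T: "linear T" "surj T"
    and J: "J \<subseteq> Basis" "card J = CARD('q)"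
    and TC: "\<forall>g. T g \<bullet> (C *v T g) = g \<bullet> g"
    and TH: "\<forall>g. (H *v T g) \<bullet> (wald_weight C H *v (H *v T g)) = (\<Sum>b\<in>J. (g \<bullet> b)\<^sup>2)"
    using exists_whitening_map[OF C H, folded wald_weight_def] by blast
  have inv: "invertible C" using C(1) by (rule coercive_invertible)
  have dW: "distributed N lborel W (\<lambda>v. ennreal (precision_density \<sigma> C v))"
    using W unfolding has_mvn_def mvn_density_precision[OF inv \<sigma>] .
  have [measurable]: "W \<in> borel_measurable N" using dW by (simp add: distributed_def)
  have [measurable]: "(\<lambda>v. ennreal (precision_density \<sigma> C v)) \<in> borel_measurable borel"
    using dW by (simp add: distributed_def)
  let ?T = "\<lambda>g. \<sigma> *\<^sub>R T g"
  have T': "linear ?T" using T(1) by (rule linear_compose_scale_right)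
  have "surj ?T"
  proof (rule surjI)
    show "?T (inv T ((1 / \<sigma>) *\<^sub>R y)) = y" for y using \<sigma> by (simp add: surj_f_inv_f[OF T(2)])
  qed
  then obtain k where k: "\<And>f. f \<in> borel_measurable borel \<Longrightarrow>
      (\<integral>\<^sup>+g. f (?T g) \<partial>lborel) = k * (\<integral>\<^sup>+y. f y \<partial>lborel)"
    using nn_integral_lborel_linear[OF T'] by blast
  define \<kappa> where "\<kappa> = sqrt (det C) / sqrt ((2 * pi * \<sigma>\<^sup>2) ^ CARD('p))"
  define K where "K = ennreal (\<kappa> * sqrt (2 * pi) ^ DIM(real^'p))"
  have dens: "ennreal (precision_density \<sigma> C (?T g)) = K * (\<Prod>b\<in>Basis. ennreal (std_normal_density (g \<bullet> b)))" for g
  proof -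
    have "(?T g \<bullet> (C *v ?T g)) / \<sigma>\<^sup>2 = g \<bullet> g"
      using \<sigma> by (simp add: matrix_vector_mult_scaleR TC power2_eq_square)
    moreover have "- X / (2 * \<sigma>\<^sup>2) = - (X / \<sigma>\<^sup>2) / 2" for X by simp
    moreover have "(\<Sum>b\<in>Basis. - (g \<bullet> b)\<^sup>2 / 2) = - (g \<bullet> g) / 2"
      by (simp add: euclidean_inner[of g g] sum_negf sum_divide_distrib power2_eq_square)
    ultimately have "- (?T g \<bullet> (C *v ?T g)) / (2 * \<sigma>\<^sup>2) = (\<Sum>b\<in>Basis. - (g \<bullet> b)\<^sup>2 / 2)"
      by (simp only:)
    then have "precision_density \<sigma> C (?T g) = \<kappa> * (\<Prod>b\<in>Basis. exp (- (g \<bullet> b)\<^sup>2 / 2))"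
      by (simp add: precision_density_def \<kappa>_def exp_sum)
    also have "\<dots> = (\<kappa> * sqrt (2 * pi) ^ DIM(real^'p)) * (\<Prod>b\<in>Basis. std_normal_density (g \<bullet> b))"
      by (simp add: std_normal_density_def prod.distrib prod_dividef power_divide)
    finally show ?thesis
      by (simp add: K_def ennreal_mult'' prod_nonneg prod_ennreal)
  qed
  have Q_T: "?Q (?T g) = (\<Sum>b\<in>J. (g \<bullet> b)\<^sup>2)" for g
    using \<sigma> by (simp add: wald_stat_def matrix_vector_mult_scaleR TH power2_eq_square)
  have main: "k * emeasure (distr N borel (\<lambda>\<omega>. ?Q (W \<omega>))) B = K * emeasure (chi_squared CARD('q)) B"
    if B[measurable]: "B \<in> sets borel" for B
  proof -
    let ?f = "\<lambda>v. ennreal (precision_density \<sigma> C v) * indicator B (?Q v)"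
    have "emeasure (distr N borel (\<lambda>\<omega>. ?Q (W \<omega>))) B = (\<integral>\<^sup>+\<omega>. indicator B (?Q (W \<omega>)) \<partial>N)"
      by (simp add: nn_integral_distr flip: nn_integral_indicator)
    also have "\<dots> = (\<integral>\<^sup>+v. ?f v \<partial>lborel)"
      by (rule distributed_nn_integral[OF dW, symmetric]) measurable
    finally have "k * emeasure (distr N borel (\<lambda>\<omega>. ?Q (W \<omega>))) B = (\<integral>\<^sup>+g. ?f (?T g) \<partial>lborel)"
      by (simp only:) (rule k[symmetric], measurable)
    also have "\<dots> = (\<integral>\<^sup>+g. K * ((\<Prod>b\<in>Basis. ennreal (std_normal_density (g \<bullet> b))) * indicator B (\<Sum>b\<in>J. (g \<bullet> b)\<^sup>2)) \<partial>lborel)"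
      unfolding dens Q_T mult.assoc ..
    also have "\<dots> = K * (\<integral>\<^sup>+g. (\<Prod>b\<in>Basis. ennreal (std_normal_density (g \<bullet> b))) * indicator B (\<Sum>b\<in>J. (g \<bullet> b)\<^sup>2) \<partial>lborel)"
      by (rule nn_integral_cmult) measurable
    also have "(\<integral>\<^sup>+g. (\<Prod>b\<in>Basis. ennreal (std_normal_density (g \<bullet> b))) * indicator B (\<Sum>b\<in>J. (g \<bullet> b)\<^sup>2) \<partial>lborel)
        = (\<integral>\<^sup>+g. indicator B (\<Sum>b\<in>J. (g \<bullet> b)\<^sup>2) \<partial>std_gaussian)"
      unfolding std_gaussian_def by (rule nn_integral_density[symmetric]) measurable
    also have "\<dots> = emeasure (distr std_gaussian borel (\<lambda>g. \<Sum>b\<in>J. (g \<bullet> b)\<^sup>2)) B"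
      by (simp add: nn_integral_distr flip: nn_integral_indicator)
    finally show ?thesis by (simp only: distr_std_gaussian_sum_squares[OF J(1)] J(2))
  qed
  have prob: "emeasure (distr N borel (\<lambda>\<omega>. ?Q (W \<omega>))) UNIV = 1" "emeasure (chi_squared CARD('q)) UNIV = 1"
    using prob_space.emeasure_space_1[OF N.prob_space_distr, of "\<lambda>\<omega>. ?Q (W \<omega>)" borel]
      prob_space.emeasure_space_1[OF prob_space_chi_squared]
    by (simp_all add: chi_squared_def)
  have kK: "k = K" using main[of UNIV] prob by simp
  have "K \<noteq> 0"
  proof
    assume "K = 0"
    then have "\<kappa> * sqrt (2 * pi) ^ DIM(real^'p) \<le> 0" unfolding K_def by (simp only: ennreal_eq_0_iff)
    moreover have "0 < sqrt (2 * pi) ^ DIM(real^'p)" by simp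
    ultimately have "\<kappa> \<le> 0" by (metis mult_pos_pos not_less)
    then have "ennreal (precision_density \<sigma> C v) = 0" for v
      unfolding precision_density_def \<kappa>_def[symmetric] by (intro ennreal_neg mult_nonpos_nonneg) auto
    moreover have "(\<integral>\<^sup>+v. ennreal (precision_density \<sigma> C v) * 1 \<partial>lborel) = (\<integral>\<^sup>+\<omega>. 1 \<partial>N)"
      by (rule distributed_nn_integral[OF dW]) simp
    ultimately show False using N.emeasure_space_1 by simp
  qed
  moreover have "K \<noteq> \<top>" by (simp add: K_def)
  moreover fix B assume "B \<in> sets (distr N borel (\<lambda>\<omega>. ?Q (W \<omega>)))"
  ultimately show "emeasure (distr N borel (\<lambda>\<omega>. ?Q (W \<omega>))) B = emeasure (chi_squared CARD('q)) B"
    using main[of B] unfolding kK by (simp add: ennreal_mult_cancel_left)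
qed simp

text \<open>
  If \<open>a\<close> solves \<open>H a = - \<xi>\<close>, the statistic is homogeneous of degree two in \<open>v - a\<close>.  A level other than \<open>0\<close>
  hence meets each ray from \<open>a\<close> at most once; the level \<open>0\<close> lies in a hyperplane.
\<close>

lemma negligible_wald_stat_level:
  fixes H :: "real^'p^'q"
  assumes A: "coercive c A" and H: "rank H = CARD('q)" and s: "s \<noteq> 0"
  shows "negligible {v. wald_stat H A \<xi> s v = t}"
proof -
  have "surj ((*v) H)" using H by (simp add: full_rank_surjective)
  then obtain a where a: "H *v a = - \<xi>" by (metis surjD)
  show ?thesis
  proof (cases "t = 0")
    case True
    obtain i :: 'q where "H $ i \<noteq> 0"
    proof -
      have "rank H \<noteq> 0" using H by simp
      then show thesis using that by (metis rank_eq_0 vec_eq_iff zero_index)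
    qed
    have "wald_stat H A \<xi> s v = t \<Longrightarrow> H *v v + \<xi> = 0" for v
      using coercive_pos[OF A, of "H *v v + \<xi>"] s True by (auto simp: wald_stat_def)
    then have "{v. wald_stat H A \<xi> s v = t} \<subseteq> {v. H $ i \<bullet> v = - \<xi> $ i}"
      by (auto simp: vec_eq_iff matrix_vector_mul_component eq_neg_iff_add_eq_0)
    then show ?thesis using negligible_hyperplane \<open>H $ i \<noteq> 0\<close> negligible_subset by blast
  next
    case False
    show ?thesis
    proof (rule starlike_negligible[of _ a])
      show "closed {v. wald_stat H A \<xi> s v = t}"
        by (intro closed_Collect_eq continuous_on_wald_stat continuous_on_const)
      fix r x assume r: "a + r *\<^sub>R x \<in> {v. wald_stat H A \<xi> s v = t}" "0 \<le> r"
        and x: "a + x \<in> {v. wald_stat H A \<xi> s v = t}"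
      have "wald_stat H A \<xi> s (a + r *\<^sub>R x) = r\<^sup>2 * wald_stat H A \<xi> s (a + x)"
        by (simp add: wald_stat_def matrix_vector_right_distrib matrix_vector_mult_scaleR a power2_eq_square)
      then have "r\<^sup>2 = 1" using r x False by simp
      then show "r = 1" using r(2) by (simp add: power2_eq_1_iff)
    qed
  qed
qed

lemma wald_stat_no_atoms:
  fixes H :: "real^'p^'q" and W :: "'v \<Rightarrow> real^'p"
  assumes "coercive c A" "rank H = CARD('q)" "s \<noteq> 0" and W: "has_mvn N W \<mu> S"
  shows "measure N {\<omega> \<in> space N. W \<omega> \<in> {v. wald_stat H A \<xi> s v = t}} = 0"
proof -
  let ?D = "{v. wald_stat H A \<xi> s v = t}"
  have D: "?D \<in> sets lborel" by measurable
  have "?D \<in> null_sets lborel"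
    using negligible_wald_stat_level[OF assms(1-3)] D by (simp add: negligible_iff_null_sets null_sets_completion_iff)
  then have "AE v in lborel. v \<notin> ?D" by (rule AE_not_in)
  then have "AE v in lborel. ennreal (mvn_density \<mu> S v) * indicator ?D v = 0"
    by eventually_elim simp
  then have "(\<integral>\<^sup>+v. ennreal (mvn_density \<mu> S v) * indicator ?D v \<partial>lborel) = (\<integral>\<^sup>+(v :: real^'p). 0 \<partial>lborel)"
    by (rule nn_integral_cong_AE)
  then have "emeasure N (W -` ?D \<inter> space N) = 0"
    using distributed_emeasure[OF W[unfolded has_mvn_def] D] by simp
  moreover have "W -` ?D \<inter> space N = {\<omega> \<in> space N. W \<omega> \<in> ?D}" by auto
  ultimately show ?thesis by (simp add: measure_def)
qed

section \<open>Convergence of critical values\<close>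

lemma chi_squared_neg: "measure (chi_squared k) {..<0} = 0"
proof -
  let ?P = "Pi\<^sub>M {..<k} (\<lambda>_. std_normal_measure)"
  have [measurable]: "(\<lambda>z. \<Sum>i<k. (z i)\<^sup>2) \<in> borel_measurable ?P" by measurable
  have "\<not> (\<Sum>i<k. (z i)\<^sup>2) < 0" for z :: "nat \<Rightarrow> real" by (simp add: not_less sum_nonneg)
  then have "(\<lambda>z. \<Sum>i<k. (z i)\<^sup>2) -` {..<0} \<inter> space ?P = ({} :: (nat \<Rightarrow> real) set)"
    by auto
  then show ?thesis unfolding chi_squared_def by (subst measure_distr) simp_all
qed

text \<open>
  The chi-squared law with \<open>q\<close> degrees of freedom is that of \<open>g \<bullet> g\<close> for a standard Gaussian vector in
  \<open>q\<close> dimensions, whose density is positive everywhere.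
\<close>

lemma chi_squared_pos:
  fixes a b :: real
  assumes ab: "0 \<le> a" "a < b"
  shows "0 < measure (chi_squared CARD('q::finite)) {a<..<b}"
proof -
  interpret X: prob_space "chi_squared CARD('q)" by (rule prob_space_chi_squared)
  let ?O = "{g :: real^'q. a < g \<bullet> g \<and> g \<bullet> g < b}"
  have meas[measurable]: "?O \<in> sets borel" by measurable
  have dens: "(\<lambda>g :: real^'q. \<Prod>b\<in>Basis. ennreal (std_normal_density (g \<bullet> b))) \<in> borel_measurable lborel"
    by measurable
  have sq: "(\<Sum>b\<in>Basis. (g \<bullet> b)\<^sup>2) = g \<bullet> g" for g :: "real^'q"
    by (simp add: euclidean_inner[of g g] power2_eq_square)
  have "emeasure (chi_squared CARD('q)) {a<..<b} = emeasure (std_gaussian :: (real^'q) measure) ?O"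
  proof -
    have "chi_squared CARD('q) = distr (std_gaussian :: (real^'q) measure) borel (\<lambda>g. g \<bullet> g)"
      using distr_std_gaussian_sum_squares[of "Basis :: (real^'q) set"] by (simp add: sq)
    moreover have "(\<lambda>g :: real^'q. g \<bullet> g) -` {a<..<b} \<inter> space std_gaussian = ?O" by auto
    ultimately show ?thesis by (simp add: emeasure_distr)
  qed
  moreover have "emeasure (std_gaussian :: (real^'q) measure) ?O \<noteq> 0"
  proof
    assume "emeasure (std_gaussian :: (real^'q) measure) ?O = 0"
    then have "(\<integral>\<^sup>+g. (\<Prod>b\<in>Basis. ennreal (std_normal_density (g \<bullet> b))) * indicator ?O g \<partial>lborel) = 0"
      unfolding std_gaussian_def using emeasure_density[OF dens, of ?O] meas by (simp only: sets_lborel)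
    then have "AE g in lborel. (\<Prod>b\<in>Basis. ennreal (std_normal_density (g \<bullet> b))) * indicator ?O g = 0"
      using dens meas by (subst (asm) nn_integral_0_iff_AE) auto
    then have "AE g in lborel. g \<notin> ?O"
    proof eventually_elim
      case (elim g)
      have "(\<Prod>b\<in>Basis. ennreal (std_normal_density (g \<bullet> b))) \<noteq> 0"
        using normal_density_pos[of 1 0] by (simp add: prod_zero_iff less_imp_neq[symmetric])
      then show ?case using elim by (auto simp: indicator_def)
    qed
    then have "?O \<in> null_sets lborel" by (simp add: AE_iff_null_sets)
    then have "negligible ?O" by (simp add: negligible_iff_null_sets null_sets_completionI)
    moreover have "open ?O"
      by (intro open_Collect_conj open_Collect_less continuous_intros)
    moreover have "?O \<noteq> {}"
    proof -
      obtain u :: "real^'q" where u: "u \<in> Basis" using nonempty_Basis by blast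
      have "sqrt ((a + b) / 2) *\<^sub>R u \<in> ?O" using ab u by (simp add: inner_Basis)
      then show ?thesis by blast
    qed
    ultimately show False using open_not_negligible by blast
  qed
  ultimately have "measure (chi_squared CARD('q)) {a<..<b} \<noteq> 0"
    by (metis X.emeasure_eq_measure ennreal_0)
  then show ?thesis by (simp add: zero_less_measure_iff)
qed

text \<open>
  Let \<open>z\<close> be the limiting quantile.  At \<open>z - e\<close> the limiting survival function exceeds \<open>\<alpha>\<close> by the definition
  of the infimum; at \<open>z + e\<close> it is strictly below \<open>\<alpha>\<close> because \<open>\<mu>\<close> charges the interval in between.  Both
  strict inequalities pass to \<open>\<mu>n n\<close> for large \<open>n\<close>.
\<close>

lemma upper_crit_tendsto:
  assumes \<mu>: "prob_space \<mu>" "sets \<mu> = sets borel" "measure \<mu> {..<0} = 0"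
    and pos: "\<And>a b. 0 \<le> a \<Longrightarrow> a < b \<Longrightarrow> 0 < measure \<mu> {a<..<b}"
    and \<mu>n: "\<forall>\<^sub>F n in sequentially. prob_space (\<mu>n n) \<and> sets (\<mu>n n) = sets borel"
    and lim: "\<And>c. (\<lambda>n. measure (\<mu>n n) {c<..}) \<longlonglongrightarrow> measure \<mu> {c<..}"
    and \<alpha>: "0 < \<alpha>" "\<alpha> < 1"
  shows "(\<lambda>n. upper_crit (\<mu>n n) \<alpha>) \<longlonglongrightarrow> upper_crit \<mu> \<alpha>"
proof -
  interpret \<mu>: prob_space \<mu> by fact
  define X where "X = {c. measure \<mu> {c<..} \<le> \<alpha>}"
  define z where "z = upper_crit \<mu> \<alpha>"
  have z: "z = Inf X" by (simp add: z_def X_def upper_crit_def)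
  have space: "space \<mu> = UNIV" using \<mu>(2) by (metis sets_eq_imp_space_eq space_borel)
  have neg: "measure \<mu> {c<..} = 1" if "c < 0" for c
  proof -
    have "measure \<mu> {..c} \<le> measure \<mu> {..<0}" using that \<mu>(2) by (intro \<mu>.finite_measure_mono) auto
    then have "measure \<mu> {..c} = 0" using \<mu>(3) measure_nonneg[of \<mu> "{..c}"] by simp
    moreover have "space \<mu> - {..c} = {c<..}" by (auto simp: space)
    ultimately show ?thesis using \<mu>.prob_compl[of "{..c}"] \<mu>(2) by simp
  qed
  have X_nonneg: "0 \<le> c" if "c \<in> X" for c
  proof (rule ccontr)
    assume "\<not> 0 \<le> c"
    then have "measure \<mu> {c<..} = 1" by (intro neg) simp
    then show False using that \<alpha>(2) by (simp add: X_def)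
  qed
  then have bdd: "bdd_below X" by (rule bdd_belowI)
  have "X \<noteq> {}"
  proof -
    have "range (\<lambda>i. {real i<..}) \<subseteq> sets \<mu>" unfolding \<mu>(2) by auto
    moreover have "decseq (\<lambda>i. {real i<..})" by (simp add: decseq_def)
    ultimately have "(\<lambda>i. measure \<mu> {real i<..}) \<longlonglongrightarrow> measure \<mu> (\<Inter>i. {real i<..})"
      by (rule \<mu>.finite_Lim_measure_decseq)
    moreover have "(\<Inter>i. {real i<..}) = {}"
    proof (rule equals0I)
      fix r assume r: "r \<in> (\<Inter>i. {real i<..})"
      obtain i :: nat where "r < real i" using reals_Archimedean2 by blast
      moreover have "real i < r" using r by blast
      ultimately show False by simp
    qed
    ultimately have "(\<lambda>i. measure \<mu> {real i<..}) \<longlonglongrightarrow> 0" by simp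
    then have "\<forall>\<^sub>F i in sequentially. measure \<mu> {real i<..} < \<alpha>" using \<alpha>(1) by (rule order_tendstoD)
    then obtain i :: nat where "measure \<mu> {real i<..} < \<alpha>" by (auto simp: eventually_sequentially)
    then show ?thesis by (auto simp: X_def intro!: exI[of _ "real i"])
  qed
  have z_nonneg: "0 \<le> z" unfolding z using \<open>X \<noteq> {}\<close> X_nonneg by (rule cInf_greatest)
  have above: "measure \<mu> {z + \<epsilon><..} < \<alpha>" if \<epsilon>: "0 < \<epsilon>" for \<epsilon>
  proof -
    obtain c where c: "c \<in> X" "c < z + \<epsilon> / 2"
      using cInf_lessD[OF \<open>X \<noteq> {}\<close>, of "z + \<epsilon> / 2"] \<epsilon> z by auto
    have "measure \<mu> {z + \<epsilon><..} + measure \<mu> {z + \<epsilon> / 2<..<z + \<epsilon>}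
        = measure \<mu> ({z + \<epsilon><..} \<union> {z + \<epsilon> / 2<..<z + \<epsilon>})"
      using \<mu>(2) by (intro \<mu>.finite_measure_Union[symmetric]) auto
    also have "\<dots> \<le> measure \<mu> {c<..}"
      using c(2) \<mu>(2) \<epsilon> by (intro \<mu>.finite_measure_mono) auto
    also have "\<dots> \<le> \<alpha>" using c(1) by (simp add: X_def)
    finally show ?thesis using pos[of "z + \<epsilon> / 2" "z + \<epsilon>"] z_nonneg \<epsilon> by simp
  qed
  have below: "\<alpha> < measure \<mu> {z - \<epsilon><..}" if \<epsilon>: "0 < \<epsilon>" for \<epsilon>
  proof (rule ccontr)
    assume "\<not> ?thesis"
    then have "z - \<epsilon> \<in> X" by (simp add: X_def)
    then show False using cInf_lower[OF _ bdd, of "z - \<epsilon>"] z \<epsilon> by simp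
  qed
  show ?thesis unfolding z_def[symmetric]
  proof (rule tendstoI)
    fix e :: real assume e: "0 < e"
    then have h: "0 < e / 2" by simp
    show "\<forall>\<^sub>F n in sequentially. dist (upper_crit (\<mu>n n) \<alpha>) z < e"
      using \<mu>n order_tendstoD(2)[OF lim above[OF h]] order_tendstoD(1)[OF lim below[OF h]]
    proof eventually_elim
      case (elim n)
      interpret n: prob_space "\<mu>n n" using elim by blast
      have sets: "sets (\<mu>n n) = sets borel" using elim by blast
      let ?X = "{c. measure (\<mu>n n) {c<..} \<le> \<alpha>}"
      have lower: "z - e / 2 \<le> c" if "c \<in> ?X" for c
      proof (rule ccontr)
        assume "\<not> ?thesis"
        then have "measure (\<mu>n n) {z - e / 2<..} \<le> measure (\<mu>n n) {c<..}"
          using sets by (intro n.finite_measure_mono) auto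
        then show False using elim that by simp
      qed
      have mem: "z + e / 2 \<in> ?X" using elim by simp
      have "Inf ?X \<le> z + e / 2" using mem lower by (intro cInf_lower bdd_belowI)
      moreover have "z - e / 2 \<le> Inf ?X" using mem lower by (intro cInf_greatest) auto
      ultimately show ?case using e by (simp add: upper_crit_def dist_real_def abs_le_iff)
    qed
  qed
qed

section \<open>Least squares, LASSO and test statistic as functions of two statistics\<close>

lemma gram_vector: "gram n x *v b = (\<Sum>i<n. (x i \<bullet> b) *\<^sub>R x i)"
  by (simp add: vec_eq_iff gram_def matrix_vector_mult_def sum_distrib_right sum.swap[of _ _ UNIV]
      inner_vec_def sum_distrib_left mult_ac)

lemma transpose_gram: "transpose (gram n x) = gram n x"
  by (simp add: gram_def transpose_def vec_eq_iff mult.commute)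

lemma gram_ols:
  assumes "invertible (gram n x)"
  shows "gram n x *v ols n x y = (\<Sum>i<n. y i *\<^sub>R x i)"
  by (simp add: ols_def matrix_vector_mul_assoc matrix_inv_cancel[OF assms])

text \<open>
  Pythagoras: the least squares residual is orthogonal to the columns of the design.
\<close>

lemma residual_sum_of_squares:
  assumes "invertible (gram n x)"
  shows "(\<Sum>i<n. (y i - x i \<bullet> b)\<^sup>2)
    = (\<Sum>i<n. (y i - x i \<bullet> ols n x y)\<^sup>2) + (b - ols n x y) \<bullet> (gram n x *v (b - ols n x y))"
proof -
  define u w where "u = ols n x y" and "w = b - ols n x y"
  have "(\<Sum>i<n. (y i - x i \<bullet> u) * (x i \<bullet> w)) = ((\<Sum>i<n. y i *\<^sub>R x i) - gram n x *v u) \<bullet> w"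
    by (simp add: gram_vector inner_diff_left inner_sum_left sum_subtractf left_diff_distrib)
  also have "\<dots> = 0" by (simp add: u_def gram_ols[OF assms])
  finally have orth: "(\<Sum>i<n. (y i - x i \<bullet> u) * (x i \<bullet> w)) = 0" .
  have quad: "(\<Sum>i<n. (x i \<bullet> w)\<^sup>2) = w \<bullet> (gram n x *v w)"
    by (simp add: gram_vector inner_sum_right power2_eq_square inner_commute)
  have "(y i - x i \<bullet> b)\<^sup>2 = (y i - x i \<bullet> u)\<^sup>2 - 2 * ((y i - x i \<bullet> u) * (x i \<bullet> w)) + (x i \<bullet> w)\<^sup>2" for i
    by (simp add: u_def w_def inner_diff_right power2_eq_square algebra_simps)
  then have "(\<Sum>i<n. (y i - x i \<bullet> b)\<^sup>2) = (\<Sum>i<n. (y i - x i \<bullet> u)\<^sup>2)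
      - 2 * (\<Sum>i<n. (y i - x i \<bullet> u) * (x i \<bullet> w)) + (\<Sum>i<n. (x i \<bullet> w)\<^sup>2)"
    by (simp add: sum.distrib sum_subtractf sum_distrib_left)
  then show ?thesis unfolding orth quad by (simp add: u_def w_def)
qed

text \<open>
  The two criteria differ by an additive constant and the positive factor \<open>n\<close>, so they have the same
  minimizers and the choice operator selects the same one.
\<close>

lemma lasso_eq_penalized_min:
  assumes n: "0 < n" and inv: "invertible (gram n x)"
  shows "lasso n x lam y = penalized_min ((1 / real n) *\<^sub>R gram n x) (ols n x y) (lam / real n)"
proof -
  define r where "r = (\<Sum>i<n. (y i - x i \<bullet> ols n x y)\<^sup>2)"
  let ?f = "\<lambda>b. (\<Sum>i<n. (y i - x i \<bullet> b)\<^sup>2) + lam * (\<Sum>j\<in>UNIV. \<bar>b $ j\<bar>)"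
  let ?g = "penalized ((1 / real n) *\<^sub>R gram n x) (ols n x y) (lam / real n)"
  have "?f b = r + real n * ?g b" for b
    using n by (simp add: penalized_def r_def residual_sum_of_squares[OF inv, of y b]
        scaleR_matrix_vector_assoc[symmetric] field_simps)
  then have "?f b' < ?f b \<longleftrightarrow> ?g b' < ?g b" for b b' using n by simp
  then show ?thesis
    unfolding lasso_def penalized_min_def arg_min_def is_arg_min_def by simp
qed

text \<open>
  The deviation of the estimator from the true parameter does not depend on that parameter; the same
  errors can thus serve the null hypothesis and the local alternative.
\<close>

lemma ols_model:
  assumes "invertible (gram n x)"
  shows "ols n x (\<lambda>i. x i \<bullet> b + e i) = b + ols n x e"
proof -
  have "(\<Sum>i<n. (x i \<bullet> b + e i) *\<^sub>R x i) = gram n x *v b + (\<Sum>i<n. e i *\<^sub>R x i)"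
    by (simp add: gram_vector scaleR_add_left sum.distrib)
  then show ?thesis
    by (simp add: ols_def matrix_vector_right_distrib matrix_vector_mul_assoc matrix_inv_cancel[OF assms])
qed

lemma resid_var_model:
  assumes "invertible (gram n x)"
  shows "resid_var n x (\<lambda>i. x i \<bullet> b + e i) = resid_var n x e"
  by (simp add: resid_var_def ols_model[OF assms] inner_add_right)

lemma sandwich_scaleR:
  fixes H :: "real^'p^'q"
  assumes "invertible B" "c \<noteq> 0"
  shows "H ** matrix_inv (c *\<^sub>R B) ** transpose H = (1 / c) *\<^sub>R (H ** matrix_inv B ** transpose H)"
  by (simp add: matrix_inv_scaleR[OF assms] matrix_scalar_ac scalar_matrix_assoc)

lemma wald_weight_scaleR:
  fixes H :: "real^'p^'q"
  assumes "invertible B" "invertible (H ** matrix_inv B ** transpose H)" "c \<noteq> 0"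
  shows "wald_weight (c *\<^sub>R B) H = c *\<^sub>R wald_weight B H"
  unfolding wald_weight_def sandwich_scaleR[OF assms(1,3)]
  using matrix_inv_scaleR[OF assms(2), of "1 / c"] assms(3) by simp

lemma restr_gain_eq: "restr_gain B H = matrix_inv B ** transpose H ** wald_weight B H"
  by (simp add: restr_gain_def wald_weight_def)

lemma restr_gain_scaleR:
  fixes H :: "real^'p^'q"
  assumes "invertible B" "invertible (H ** matrix_inv B ** transpose H)" "c \<noteq> 0"
  shows "restr_gain (c *\<^sub>R B) H = restr_gain B H"
  using assms unfolding restr_gain_eq wald_weight_scaleR[OF assms] matrix_inv_scaleR[OF assms(1,3)]
  by (simp add: matrix_scalar_ac scalar_matrix_assoc)

text \<open>
  The sample size cancels: \<open>H C\<^sub>n\<^sup>-\<^sup>1 H\<^sup>T\<close> is of order \<open>1 / n\<close>, and \<open>n\<close> is split between the two factors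
  \<open>H u - h\<close>.
\<close>

lemma test_stat_eq_wald_stat:
  fixes x :: "nat \<Rightarrow> real^'p" and H :: "real^'p^'q"
  assumes n: "0 < n" and inv: "invertible ((1 / real n) *\<^sub>R gram n x)"
    and inv': "invertible (H ** matrix_inv ((1 / real n) *\<^sub>R gram n x) ** transpose H)"
  shows "test_stat n x H h y
    = wald_stat H (wald_weight ((1 / real n) *\<^sub>R gram n x) H) (sqrt (real n) *\<^sub>R (H *v b - h))
        (resid_var n x y) (sqrt (real n) *\<^sub>R (ols n x y - b))"
proof -
  let ?S = "(1 / real n) *\<^sub>R gram n x" and ?d = "H *v ols n x y - h"
  have "gram n x = real n *\<^sub>R ?S" using n by simp
  then have w: "wald_weight (gram n x) H = real n *\<^sub>R wald_weight ?S H"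
    using wald_weight_scaleR[OF inv inv', of "real n"] n by simp
  have d: "H *v (sqrt (real n) *\<^sub>R (ols n x y - b)) + sqrt (real n) *\<^sub>R (H *v b - h) = sqrt (real n) *\<^sub>R ?d"
    by (simp add: matrix_vector_mult_scaleR matrix_vector_mult_diff_distrib scaleR_diff_right)
  have "test_stat n x H h y = (?d \<bullet> (wald_weight (gram n x) H *v ?d)) / resid_var n x y"
    by (simp add: test_stat_def wald_weight_def)
  also have "?d \<bullet> (wald_weight (gram n x) H *v ?d)
      = (sqrt (real n) *\<^sub>R ?d) \<bullet> (wald_weight ?S H *v (sqrt (real n) *\<^sub>R ?d))"
    unfolding w by (simp add: matrix_vector_mult_scaleR scaleR_matrix_vector_assoc[symmetric]) 
  finally show ?thesis unfolding wald_stat_def d .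
qed

lemma tendsto_wald_weight:
  assumes "(S \<longlongrightarrow> S\<^sub>0) F" "invertible S\<^sub>0" "invertible (H ** matrix_inv S\<^sub>0 ** transpose H)"
  shows "((\<lambda>t. wald_weight (S t) H) \<longlongrightarrow> wald_weight S\<^sub>0 H) F"
  unfolding wald_weight_def
  by (intro tendsto_matrix_inv tendsto_matrix_mult tendsto_const assms)

lemma tendsto_restr_gain:
  assumes "(S \<longlongrightarrow> S\<^sub>0) F" "invertible S\<^sub>0" "invertible (H ** matrix_inv S\<^sub>0 ** transpose H)"
  shows "((\<lambda>t. restr_gain (S t) H) \<longlongrightarrow> restr_gain S\<^sub>0 H) F"
  unfolding restr_gain_eq
  by (intro tendsto_matrix_inv tendsto_matrix_mult tendsto_const tendsto_wald_weight assms)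

text \<open>
  Away from equality both comparisons are eventually constant; strict and weak inequality then have
  the same limit.
\<close>

lemma tendsto_of_bool_less:
  fixes X Y :: "'a \<Rightarrow> real"
  assumes X: "(X \<longlongrightarrow> a) F" and Y: "(Y \<longlongrightarrow> b) F" and ne: "a \<noteq> b"
  shows "((\<lambda>t. of_bool (X t < Y t) :: real) \<longlongrightarrow> of_bool (a < b)) F"
    and "((\<lambda>t. of_bool (X t \<le> Y t) :: real) \<longlongrightarrow> of_bool (a < b)) F"
proof -
  have d: "((\<lambda>t. Y t - X t) \<longlongrightarrow> b - a) F" by (intro tendsto_diff X Y)
  have "\<forall>\<^sub>F t in F. (X t < Y t) = (a < b) \<and> (X t \<le> Y t) = (a < b)"
  proof (cases "a < b")
    case True
    then have "0 < b - a" by simp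
    with d have "\<forall>\<^sub>F t in F. 0 < Y t - X t" by (rule order_tendstoD)
    then show ?thesis by (rule eventually_mono) (use True in auto)
  next
    case False
    then have "b - a < 0" using ne by simp
    with d have "\<forall>\<^sub>F t in F. Y t - X t < 0" by (rule order_tendstoD)
    then show ?thesis by (rule eventually_mono) (use False in auto)
  qed
  then show "((\<lambda>t. of_bool (X t < Y t) :: real) \<longlongrightarrow> of_bool (a < b)) F"
    and "((\<lambda>t. of_bool (X t \<le> Y t) :: real) \<longlongrightarrow> of_bool (a < b)) F"
    by (auto intro!: tendsto_eventually elim: eventually_mono)
qed

lemma continuous_penalized_min:
  assumes "coercive c S" "transpose S = S" "0 \<le> l"
  shows "continuous_on UNIV (\<lambda>u. penalized_min S u l)"
  unfolding continuous_on_def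
  by (intro ballI tendsto_penalized_min[OF tendsto_const _ tendsto_const assms(1,2,2,3,3)] tendsto_ident_at)

lemma borel_measurable_matrix_vector_mult [measurable]:
  fixes A :: "real^'n^'m"
  assumes "f \<in> borel_measurable M"
  shows "(\<lambda>\<omega>. A *v f \<omega>) \<in> borel_measurable M"
proof -
  have "(\<lambda>v. A *v v) \<in> borel_measurable borel"
    by (intro borel_measurable_continuous_onI continuous_intros)
  from measurable_compose[OF assms this] show ?thesis .
qed

section \<open>Asymptotic laws of the estimators\<close>

theorem theorem1:
  fixes M :: "'w measure" and N :: "'v measure"
    and x :: "nat \<Rightarrow> nat \<Rightarrow> real^'p" and e :: "nat \<Rightarrow> nat \<Rightarrow> 'w \<Rightarrow> real"
    and \<beta>\<^sub>n :: "nat \<Rightarrow> real^'p" and \<beta> b\<^sub>0 :: "real^'p" and \<sigma> :: real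
    and C :: "real^'p^'p" and H :: "real^'p^'q" and h \<xi> :: "real^'q"
    and lam :: "nat \<Rightarrow> real" and lam\<^sub>0 \<alpha> :: real
    and W :: "'v \<Rightarrow> real^'p"
  defines "Y \<equiv> \<lambda>b n \<omega> i. x n i \<bullet> b + e n i \<omega>"
  defines "y \<equiv> \<lambda>n. Y (\<beta>\<^sub>n n) n"
  defines "\<L>\<^sub>n \<equiv> \<lambda>n \<omega>. test_stat n (x n) H h (y n \<omega>)"
  defines "crit\<^sub>n \<equiv> \<lambda>n. upper_crit (distr M borel (\<lambda>\<omega>. test_stat n (x n) H h (Y b\<^sub>0 n \<omega>))) \<alpha>"
  defines "L \<equiv> \<lambda>n \<omega>. lasso n (x n) (lam n) (y n \<omega>)"
  defines "RL \<equiv> \<lambda>n \<omega>. restricted_lasso n (x n) H h (lam n) (y n \<omega>)"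
  defines "PTL \<equiv> \<lambda>n \<omega>. pt_lasso n (x n) H h (lam n) (crit\<^sub>n n) (y n \<omega>)"
  defines "SSL \<equiv> \<lambda>n \<omega>. ss_lasso n (x n) H h (lam n) (y n \<omega>)"
  defines "PRSSL \<equiv> \<lambda>n \<omega>. prss_lasso n (x n) H h (lam n) (y n \<omega>)"
  defines "Z \<equiv> \<lambda>\<phi>. (\<phi> - \<beta>) \<bullet> (C *v (\<phi> - \<beta>)) + lam\<^sub>0 * (\<Sum>j\<in>UNIV. \<bar>\<phi> $ j\<bar>)"
  defines "\<eta> \<equiv> (ARG_MIN Z \<phi>. True)"
  defines "D \<equiv> restr_gain C H *v (H *v \<eta> - h)"
  defines "\<L> \<equiv> \<lambda>v. ((H *v W v + \<xi>) \<bullet>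
                  (matrix_inv (H ** matrix_inv C ** transpose H) *v (H *v W v + \<xi>))) / \<sigma>\<^sup>2"
  defines "crit \<equiv> upper_crit (chi_squared CARD('q)) \<alpha>"
  defines "k \<equiv> real CARD('q) - 2"
  assumes prob_M: "prob_space M"
    and sigma_pos: "\<sigma> > 0"
    and full_rank: "\<And>n. n > CARD('p) \<Longrightarrow> dim (x n ` {..<n}) = CARD('p)"
    and err_rv: "\<And>n i. i < n \<Longrightarrow> e n i \<in> borel_measurable M"
    and err_sq: "\<And>n i. i < n \<Longrightarrow> integrable M (\<lambda>\<omega>. (e n i \<omega>)\<^sup>2)"
    and err_mean: "\<And>n i. i < n \<Longrightarrow> (\<integral>\<omega>. e n i \<omega> \<partial>M) = 0"
    and err_cov: "\<And>n i j. i < n \<Longrightarrow> j < n \<Longrightarrow>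
                    (\<integral>\<omega>. e n i \<omega> * e n j \<omega> \<partial>M) = (if i = j then \<sigma>\<^sup>2 else 0)"
    and ols_normal: "\<And>n. n > CARD('p) \<Longrightarrow>
                    has_mvn M (\<lambda>\<omega>. ols n (x n) (y n \<omega>)) (\<beta>\<^sub>n n)
                      (\<sigma>\<^sup>2 *\<^sub>R matrix_inv (gram n (x n)))"
    and resid_chi2: "\<And>n. n > CARD('p) \<Longrightarrow>
                    distr M borel (\<lambda>\<omega>. real (n - CARD('p)) * resid_var n (x n) (y n \<omega>) / \<sigma>\<^sup>2)
                      = chi_squared (n - CARD('p))"
    and ols_resid_indep: "\<And>n. n > CARD('p) \<Longrightarrow>
                    indep_rvs M (\<lambda>\<omega>. ols n (x n) (y n \<omega>))
                      (\<lambda>\<omega>. real (n - CARD('p)) * resid_var n (x n) (y n \<omega>) / \<sigma>\<^sup>2)"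
    and A1: "(\<lambda>n. Max ((\<lambda>i. x n i \<bullet> (matrix_inv (gram n (x n)) *v x n i)) ` {..<n}))
                      \<longlonglongrightarrow> 0"
    and A2: "(\<lambda>n. (1 / real n) *\<^sub>R gram n (x n)) \<longlonglongrightarrow> C" "positive_definite C"
    and rank_H: "rank H = CARD('q)"
    and local_alt: "\<And>n. n > CARD('p) \<Longrightarrow> H *v \<beta>\<^sub>n n = h + (1 / sqrt (real n)) *\<^sub>R \<xi>"
    and beta_lim: "\<beta>\<^sub>n \<longlonglongrightarrow> \<beta>"
    and null: "H *v b\<^sub>0 = h"
    and alpha: "0 < \<alpha>" "\<alpha> < 1"
    and lam_nonneg: "\<And>n. lam n \<ge> 0"
    and C_nonsing: "invertible C"
    and lam_lim: "(\<lambda>n. lam n / real n) \<longlonglongrightarrow> lam\<^sub>0" "lam\<^sub>0 \<ge> 0"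
    and prob_N: "prob_space N"
    and W_normal: "has_mvn N W 0 (\<sigma>\<^sup>2 *\<^sub>R matrix_inv C)"
  shows
    "conv_in_prob M L (\<lambda>_. \<eta>)
     \<and> conv_in_prob M RL (\<lambda>_. \<eta> - D)
     \<and> conv_in_prob M (\<lambda>n \<omega>. L n \<omega> - RL n \<omega>) (\<lambda>_. D)
     \<and> (conv_in_prob M
           (\<lambda>n \<omega>. PTL n \<omega> - (\<eta> - of_bool (\<L>\<^sub>n n \<omega> \<le> crit\<^sub>n n) *\<^sub>R D)) (\<lambda>_. 0)
        \<and> conv_in_distr M PTL N (\<lambda>v. \<eta> - of_bool (\<L> v < crit) *\<^sub>R D))
     \<and> conv_in_distr M SSL N (\<lambda>v. \<eta> - (k * inverse (\<L> v)) *\<^sub>R D)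
     \<and> conv_in_distr M PRSSL N
         (\<lambda>v. \<eta> - (k * inverse (\<L> v)
                    + (1 - k * inverse (\<L> v)) * of_bool (\<L> v < k)) *\<^sub>R D)"
proof -
  interpret M: prob_space M by (rule prob_M)
  interpret N: prob_space N by (rule prob_N)
  define S where "S n = (1 / real n) *\<^sub>R gram n (x n)" for n
  define V where "V n \<omega> = sqrt (real n) *\<^sub>R (ols n (x n) (y n \<omega>) - \<beta>\<^sub>n n)" for n \<omega>
  define s where "s n \<omega> = resid_var n (x n) (y n \<omega>)" for n \<omega>
  have S: "S \<longlonglongrightarrow> C" unfolding S_def by (rule A2(1))
  have C_sym: "transpose C = C" using A2(2) by (simp add: positive_definite_def)
  obtain c where c: "coercive c C" using A2(2) by (rule positive_definite_coercive)
  have S_sym: "transpose (S n) = S n" for n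
    by (simp add: S_def transpose_scalar transpose_gram)
  have pdA: "positive_definite (wald_weight C H)" and invK: "invertible (H ** matrix_inv C ** transpose H)"
    by (rule wald_weight_positive_definite[OF c C_sym rank_H])+
  obtain a where a: "coercive a (wald_weight C H)" using pdA by (rule positive_definite_coercive)
  have \<sigma>2: "\<sigma>\<^sup>2 \<noteq> 0" using sigma_pos by simp
  have large: "\<forall>\<^sub>F n in sequentially. n > CARD('p)" by (rule eventually_gt_at_top)
  have coercive_S: "\<forall>\<^sub>F n in sequentially. coercive (c / 2) (S n)" by (rule coercive_perturb[OF S c])
  have V_strong: "conv_strong M V N W"
    unfolding V_def
  proof (rule standardized_normal_conv_strong[OF prob_M prob_N sigma_pos S c _ W_normal])
    show "\<forall>\<^sub>F n in sequentially. has_mvn M (\<lambda>\<omega>. ols n (x n) (y n \<omega>)) (\<beta>\<^sub>n n) (\<sigma>\<^sup>2 *\<^sub>R matrix_inv (real n *\<^sub>R S n))"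
      using large by (rule eventually_mono) (use ols_normal in \<open>simp add: S_def\<close>)
  qed
  have s_lim: "conv_in_prob M s (\<lambda>_. \<sigma>\<^sup>2)"
  proof (rule scaled_chi_squared_conv_in_prob[OF sigma_pos, where p = "CARD('p)"])
    show "\<forall>\<^sub>F n in sequentially. (\<lambda>\<omega>. real (n - CARD('p)) * s n \<omega> / \<sigma>\<^sup>2) \<in> borel_measurable M \<and>
        distr M borel (\<lambda>\<omega>. real (n - CARD('p)) * s n \<omega> / \<sigma>\<^sup>2) = chi_squared (n - CARD('p))"
      using large by (rule eventually_mono)
        (use resid_chi2 ols_resid_indep in \<open>auto simp: s_def indep_rvs_def\<close>)
  qed
  have V_meas: "\<forall>\<^sub>F n in sequentially. V n \<in> borel_measurable M"
    using V_strong by (simp add: conv_strong_def)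
  have s_meas: "\<forall>\<^sub>F n in sequentially. s n \<in> borel_measurable M"
    using s_lim by (simp add: conv_in_prob_def)
  have W_meas[measurable]: "W \<in> borel_measurable N" using V_strong by (simp add: conv_strong_def)

  define Q where "Q = wald_stat H (wald_weight C H) \<xi> (\<sigma>\<^sup>2)"
  define Q\<^sub>0 where "Q\<^sub>0 = wald_stat H (wald_weight C H) 0 (\<sigma>\<^sup>2)"
  have [measurable]: "Q \<in> borel_measurable borel" "Q\<^sub>0 \<in> borel_measurable borel"
    unfolding Q_def Q\<^sub>0_def by measurable
  have \<L>_eq: "\<L> v = Q (W v)" for v
    by (simp add: \<L>_def Q_def wald_stat_def wald_weight_def)
  have \<eta>_eq: "\<eta> = penalized_min C \<beta> lam\<^sub>0"
    by (simp add: \<eta>_def penalized_min_def Z_def penalized_def[abs_def])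
  have level: "closed {v. Q v = t}" "measure N {\<omega> \<in> space N. W \<omega> \<in> {v. Q v = t}} = 0"
    "closed {v. Q\<^sub>0 v = t}" "measure N {\<omega> \<in> space N. W \<omega> \<in> {v. Q\<^sub>0 v = t}} = 0" for t
    unfolding Q_def Q\<^sub>0_def
    by (intro closed_Collect_eq continuous_on_wald_stat continuous_on_const
        wald_stat_no_atoms[OF a rank_H \<sigma>2 W_normal])+

  \<comment> \<open>The deterministic functions through which LASSO, difference to the restricted LASSO and test statistic depend on \<open>V\<close> and \<open>s\<close>; the argument \<open>\<zeta>\<close> is \<open>\<xi>\<close> under the local alternative and \<open>0\<close> under the null hypothesis.\<close>
  define Lg where "Lg n v = penalized_min (S n) (\<beta>\<^sub>n n + (1 / sqrt (real n)) *\<^sub>R v) (lam n / real n)" for n v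
  define Dg where "Dg n v = restr_gain (S n) H *v (H *v Lg n v - h)" for n v
  define Qg where "Qg n \<zeta> t v = wald_stat H (wald_weight (S n) H) \<zeta> t v" for n \<zeta> t v

  let ?F = "\<lambda>v. sequentially \<times>\<^sub>F (nhds v \<times>\<^sub>F nhds (\<sigma>\<^sup>2))"
  have fst_lim: "filterlim fst sequentially (?F v)" for v by (rule filterlim_fst)
  have v_lim: "((\<lambda>(n, v', t). v') \<longlongrightarrow> v) (?F v)" for v
    using filterlim_compose[OF filterlim_fst filterlim_snd] by (simp add: case_prod_unfold)
  have t_lim: "((\<lambda>(n, v', t). t) \<longlongrightarrow> \<sigma>\<^sup>2) (?F v)" for v
    using filterlim_compose[OF filterlim_snd filterlim_snd] by (simp add: case_prod_unfold)
  have seq_lim: "((\<lambda>(n, v', t). X n) \<longlongrightarrow> X\<^sub>0) (?F v)" if "X \<longlonglongrightarrow> X\<^sub>0"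
    for X :: "nat \<Rightarrow> 'z::topological_space" and X\<^sub>0 v
    using filterlim_compose[OF that fst_lim] by (simp add: case_prod_unfold)
  have root: "(\<lambda>n. 1 / sqrt (real n)) \<longlonglongrightarrow> 0" by real_asymp
  have Lg_lim: "((\<lambda>(n, v', t). Lg n v') \<longlongrightarrow> \<eta>) (?F v)" for v
  proof -
    have "((\<lambda>z. \<beta>\<^sub>n (fst z) + (1 / sqrt (real (fst z))) *\<^sub>R fst (snd z)) \<longlongrightarrow> \<beta> + 0 *\<^sub>R v) (?F v)"
      using seq_lim[OF beta_lim] seq_lim[OF root] v_lim
      by (intro tendsto_add tendsto_scaleR) (simp_all add: case_prod_unfold)
    then show ?thesis
      unfolding \<eta>_eq Lg_def case_prod_unfold
      using seq_lim[OF S] seq_lim[OF lam_lim(1)] lam_nonneg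
      by (intro tendsto_penalized_min[OF _ _ _ c C_sym S_sym lam_lim(2)]) (simp_all add: case_prod_unfold)
  qed
  have Dg_lim: "((\<lambda>(n, v', t). Dg n v') \<longlongrightarrow> D) (?F v)" for v
    using Lg_lim[of v] seq_lim[OF tendsto_restr_gain[OF S C_nonsing invK]]
    unfolding D_def Dg_def case_prod_unfold
    by (intro tendsto_matrix_vector_mult tendsto_diff tendsto_const)
  have Qg_lim: "((\<lambda>(n, v', t). Qg n \<zeta> t v') \<longlongrightarrow> wald_stat H (wald_weight C H) \<zeta> (\<sigma>\<^sup>2) v) (?F v)" for v \<zeta>
    using v_lim[of v] t_lim[of v] seq_lim[OF tendsto_wald_weight[OF S C_nonsing invK]]
    unfolding Qg_def case_prod_unfold
    by (intro tendsto_wald_stat tendsto_const \<sigma>2)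

  have good: "\<forall>\<^sub>F n in sequentially. invertible (gram n (x n)) \<and> invertible (S n) \<and>
      invertible (H ** matrix_inv (S n) ** transpose H) \<and> n > CARD('p) \<and> coercive (c / 2) (S n)"
    using coercive_S large
  proof eventually_elim
    case (elim n)
    have inv: "invertible (S n)" using elim(1) by (rule coercive_invertible)
    have "gram n (x n) = real n *\<^sub>R S n" using elim(2) by (simp add: S_def)
    then have "invertible (gram n (x n))" using scalar_invertible[OF _ inv, of "real n"] elim(2) by simp
    then show ?case using inv elim wald_weight_positive_definite(2)[OF elim(1) S_sym rank_H] by blast
  qed
  have rep: "\<forall>\<^sub>F n in sequentially. \<forall>\<omega>. L n \<omega> = Lg n (V n \<omega>) \<and> L n \<omega> - RL n \<omega> = Dg n (V n \<omega>) \<and>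
      \<L>\<^sub>n n \<omega> = Qg n \<xi> (s n \<omega>) (V n \<omega>) \<and>
      test_stat n (x n) H h (Y b\<^sub>0 n \<omega>) = Qg n 0 (s n \<omega>) (V n \<omega>)"
    using good
  proof eventually_elim
    case (elim n)
    then have n: "0 < n" and inv: "invertible (gram n (x n))" and invS: "invertible (S n)"
      and invKS: "invertible (H ** matrix_inv (S n) ** transpose H)" and np: "n > CARD('p)" by auto
    have gram_S: "gram n (x n) = real n *\<^sub>R S n" using n by (simp add: S_def)
    have "ols n (x n) (y n \<omega>) = \<beta>\<^sub>n n + (1 / sqrt (real n)) *\<^sub>R V n \<omega>" for \<omega>
      using n by (simp add: V_def)
    then have L_eq: "L n \<omega> = Lg n (V n \<omega>)" for \<omega>
      unfolding L_def Lg_def lasso_eq_penalized_min[OF n inv] S_def by simp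
    have "restr_gain (gram n (x n)) H = restr_gain (S n) H"
      unfolding gram_S using n by (intro restr_gain_scaleR invS invKS) simp
    then have D_eq: "L n \<omega> - RL n \<omega> = Dg n (V n \<omega>)" for \<omega>
      using L_eq[of \<omega>] by (simp add: RL_def restricted_lasso_def Dg_def L_def)
    have "sqrt (real n) *\<^sub>R (H *v \<beta>\<^sub>n n - h) = \<xi>" using local_alt[OF np] n by simp
    then have Q_eq: "\<L>\<^sub>n n \<omega> = Qg n \<xi> (s n \<omega>) (V n \<omega>)" for \<omega>
      unfolding \<L>\<^sub>n_def Qg_def V_def s_def S_def
      using test_stat_eq_wald_stat[OF n invS[unfolded S_def] invKS[unfolded S_def], of h _ "\<beta>\<^sub>n n"] by simp
    have model: "ols n (x n) (Y b n \<omega>) - b = ols n (x n) (\<lambda>i. e n i \<omega>)"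
      "resid_var n (x n) (Y b n \<omega>) = resid_var n (x n) (\<lambda>i. e n i \<omega>)" for b \<omega>
      unfolding Y_def by (simp_all add: ols_model[OF inv] resid_var_model[OF inv])
    have "test_stat n (x n) H h (Y b\<^sub>0 n \<omega>) = Qg n 0 (s n \<omega>) (V n \<omega>)" for \<omega>
      unfolding Qg_def V_def s_def S_def y_def model
      unfolding test_stat_eq_wald_stat[OF n invS[unfolded S_def] invKS[unfolded S_def], of h _ b\<^sub>0] model null
      by simp
    then show ?case using L_eq D_eq Q_eq by blast
  qed
  have Lg_meas: "\<forall>\<^sub>F n in sequentially. Lg n \<in> borel_measurable borel"
    using good
  proof eventually_elim
    case (elim n)
    have "continuous_on UNIV (\<lambda>u. penalized_min (S n) u (lam n / real n))"
      using elim lam_nonneg by (intro continuous_penalized_min[OF _ S_sym]) auto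
    then have "continuous_on UNIV (\<lambda>v. penalized_min (S n) (\<beta>\<^sub>n n + (1 / sqrt (real n)) *\<^sub>R v) (lam n / real n))"
      by (rule continuous_on_compose2) (auto intro!: continuous_intros)
    then show ?case unfolding Lg_def[abs_def] by (rule borel_measurable_continuous_onI)
  qed
  have meas: "\<forall>\<^sub>F n in sequentially. L n \<in> borel_measurable M \<and> (\<lambda>\<omega>. L n \<omega> - RL n \<omega>) \<in> borel_measurable M \<and>
      \<L>\<^sub>n n \<in> borel_measurable M \<and> (\<lambda>\<omega>. test_stat n (x n) H h (Y b\<^sub>0 n \<omega>)) \<in> borel_measurable M"
    using rep Lg_meas V_meas s_meas
  proof eventually_elim
    case (elim n)
    note [measurable] = elim(2,3,4)
    have "\<L>\<^sub>n n = (\<lambda>\<omega>. Qg n \<xi> (s n \<omega>) (V n \<omega>))" "L n = (\<lambda>\<omega>. Lg n (V n \<omega>))" using elim(1) by auto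
    then show ?case using elim(1) by (simp add: Qg_def Dg_def wald_stat_def)
  qed

  have mapping: "conv_in_distr M T N (\<lambda>\<omega>. g (W \<omega>))"
    if "\<forall>\<^sub>F n in sequentially. T n \<in> borel_measurable M"
      "\<forall>\<^sub>F n in sequentially. \<forall>\<omega>. T n \<omega> = G n (V n \<omega>) (s n \<omega>)"
      "closed D\<^sub>0" "measure N {\<omega> \<in> space N. W \<omega> \<in> D\<^sub>0} = 0" "g \<in> borel_measurable borel"
      "\<And>v. v \<notin> D\<^sub>0 \<Longrightarrow> ((\<lambda>(n, v', t). G n v' t) \<longlongrightarrow> g v) (?F v)"
    for T :: "nat \<Rightarrow> 'w \<Rightarrow> 'z::euclidean_space" and G D\<^sub>0 g
    by (rule extended_continuous_mapping[OF prob_M prob_N V_strong s_lim that])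
  have mapping_const: "conv_in_prob M T (\<lambda>_. z)"
    if "\<forall>\<^sub>F n in sequentially. T n \<in> borel_measurable M"
      "\<forall>\<^sub>F n in sequentially. \<forall>\<omega>. T n \<omega> = G n (V n \<omega>) (s n \<omega>)"
      "\<And>v. ((\<lambda>(n, v', t). G n v' t) \<longlongrightarrow> z) (?F v)"
    for T :: "nat \<Rightarrow> 'w \<Rightarrow> 'z::euclidean_space" and G z
    using mapping[of T G "{}" "\<lambda>_. z"] that
    by (intro conv_in_distr_const_imp_conv_in_prob[OF prob_M prob_N]) auto

  have part_i: "conv_in_prob M L (\<lambda>_. \<eta>)"
    using meas rep Lg_lim
    by (intro mapping_const[of L "\<lambda>n v t. Lg n v"]) (auto elim: eventually_mono)
  have part_iii: "conv_in_prob M (\<lambda>n \<omega>. L n \<omega> - RL n \<omega>) (\<lambda>_. D)"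
    using meas rep Dg_lim
    by (intro mapping_const[of "\<lambda>n \<omega>. L n \<omega> - RL n \<omega>" "\<lambda>n v t. Dg n v"]) (auto elim: eventually_mono)
  have RL_rep: "\<forall>\<^sub>F n in sequentially. \<forall>\<omega>. RL n \<omega> = Lg n (V n \<omega>) - Dg n (V n \<omega>)"
    using rep by (rule eventually_mono) (metis diff_diff_eq2 diff_add_cancel add_diff_cancel_left' diff_add_eq)
  have RL_meas: "\<forall>\<^sub>F n in sequentially. RL n \<in> borel_measurable M"
    using meas
  proof eventually_elim
    case (elim n)
    then have "(\<lambda>\<omega>. L n \<omega> - (L n \<omega> - RL n \<omega>)) \<in> borel_measurable M"
      using borel_measurable_diff[of "L n" M "\<lambda>\<omega>. L n \<omega> - RL n \<omega>"] by blast
    moreover have "(\<lambda>\<omega>. L n \<omega> - (L n \<omega> - RL n \<omega>)) = RL n" by (simp add: fun_eq_iff)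
    ultimately show ?case by (simp only:)
  qed
  have part_ii: "conv_in_prob M RL (\<lambda>_. \<eta> - D)"
    using RL_meas RL_rep
  proof (rule mapping_const)
    show "((\<lambda>(n, v', t). Lg n v' - Dg n v') \<longlongrightarrow> \<eta> - D) (?F v)" for v
      using tendsto_diff[OF Lg_lim Dg_lim] by (simp add: case_prod_unfold)
  qed

  have crit_lim: "crit\<^sub>n \<longlonglongrightarrow> crit"
    unfolding crit\<^sub>n_def crit_def
  proof (rule upper_crit_tendsto[OF prob_space_chi_squared sets_chi_squared chi_squared_neg chi_squared_pos _ _ alpha])
    show "\<forall>\<^sub>F n in sequentially. prob_space (distr M borel (\<lambda>\<omega>. test_stat n (x n) H h (Y b\<^sub>0 n \<omega>))) \<and>
        sets (distr M borel (\<lambda>\<omega>. test_stat n (x n) H h (Y b\<^sub>0 n \<omega>))) = sets borel"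
      using meas by (rule eventually_mono) (auto intro: M.prob_space_distr)
    fix t :: real
    \<comment> \<open>The truncation makes the identity a bounded continuous test function; on indicators it has no effect.\<close>
    have surv: "measure (distr P borel X) {t<..} = (\<integral>\<omega>. min 1 (max 0 (of_bool (t < X \<omega>))) \<partial>P)"
      if "X \<in> borel_measurable P" for P :: "'z measure" and X :: "'z \<Rightarrow> real"
    proof -
      have "measure (distr P borel X) {t<..} = measure P {\<omega> \<in> space P. t < X \<omega>}"
        using that by (subst measure_distr) (auto intro!: arg_cong[where f = "measure P"])
      also have "\<dots> = (\<integral>\<omega>. indicator {\<omega> \<in> space P. t < X \<omega>} \<omega> \<partial>P)"
        by (simp add: Int_absorb2 subset_eq)
      also have "\<dots> = (\<integral>\<omega>. min 1 (max 0 (of_bool (t < X \<omega>))) \<partial>P)"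
        by (intro Bochner_Integration.integral_cong) (auto simp: indicator_def)
      finally show ?thesis .
    qed
    have "conv_in_distr M (\<lambda>n \<omega>. of_bool (t < test_stat n (x n) H h (Y b\<^sub>0 n \<omega>)) :: real) N (\<lambda>\<omega>. of_bool (t < Q\<^sub>0 (W \<omega>)))"
    proof (rule mapping[OF _ _ level(3,4)])
      show "\<forall>\<^sub>F n in sequentially. (\<lambda>\<omega>. of_bool (t < test_stat n (x n) H h (Y b\<^sub>0 n \<omega>)) :: real) \<in> borel_measurable M"
        using meas by (rule eventually_mono) auto
      show "\<forall>\<^sub>F n in sequentially. \<forall>\<omega>. (of_bool (t < test_stat n (x n) H h (Y b\<^sub>0 n \<omega>)) :: real)
          = of_bool (t < Qg n 0 (s n \<omega>) (V n \<omega>))"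
        using rep by (rule eventually_mono) simp
      show "((\<lambda>(n, v', u). of_bool (t < Qg n 0 u v')) \<longlongrightarrow> (of_bool (t < Q\<^sub>0 v) :: real)) (?F v)"
        if "v \<notin> {v. Q\<^sub>0 v = t}" for v
        using tendsto_of_bool_less(1)[OF tendsto_const Qg_lim[of 0 v, folded Q\<^sub>0_def], of t] that
        by (auto simp: case_prod_unfold)
    qed measurable
    moreover have "continuous_on UNIV (\<lambda>z :: real. min 1 (max 0 z))" by (intro continuous_intros)
    moreover have "bounded (range (\<lambda>z :: real. min 1 (max 0 z)))"
      by (auto simp: bounded_iff intro!: exI[of _ 1])
    ultimately have "(\<lambda>n. \<integral>\<omega>. min 1 (max 0 (of_bool (t < test_stat n (x n) H h (Y b\<^sub>0 n \<omega>)) :: real)) \<partial>M)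
        \<longlonglongrightarrow> (\<integral>\<omega>. min 1 (max 0 (of_bool (t < Q\<^sub>0 (W \<omega>)))) \<partial>N)"
      unfolding conv_in_distr_def by blast
    also have "(\<integral>\<omega>. min 1 (max 0 (of_bool (t < Q\<^sub>0 (W \<omega>)))) \<partial>N) = measure (chi_squared CARD('q)) {t<..}"
      unfolding wald_stat_law[OF prob_N sigma_pos c C_sym rank_H W_normal, folded Q\<^sub>0_def, symmetric]
      by (rule surv[symmetric]) measurable
    finally show "(\<lambda>n. measure (distr M borel (\<lambda>\<omega>. test_stat n (x n) H h (Y b\<^sub>0 n \<omega>))) {t<..})
        \<longlonglongrightarrow> measure (chi_squared CARD('q)) {t<..}"
    proof (rule Lim_transform_eventually)
      show "\<forall>\<^sub>F n in sequentially.
          (\<integral>\<omega>. min 1 (max 0 (of_bool (t < test_stat n (x n) H h (Y b\<^sub>0 n \<omega>)) :: real)) \<partial>M)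
          = measure (distr M borel (\<lambda>\<omega>. test_stat n (x n) H h (Y b\<^sub>0 n \<omega>))) {t<..}"
        using meas by (rule eventually_mono) (rule surv[symmetric], blast)
    qed
  qed

  have PTL_eq: "PTL n \<omega> = L n \<omega> - of_bool (\<L>\<^sub>n n \<omega> \<le> crit\<^sub>n n) *\<^sub>R (L n \<omega> - RL n \<omega>)" for n \<omega>
    by (simp add: PTL_def pt_lasso_def \<L>\<^sub>n_def L_def RL_def)
  define kn where "kn n = shrink_const n CARD('p) CARD('q)" for n
  have SSL_eq: "SSL n \<omega> = L n \<omega> - (kn n * inverse (\<L>\<^sub>n n \<omega>)) *\<^sub>R (L n \<omega> - RL n \<omega>)" for n \<omega>
    by (simp add: SSL_def ss_lasso_def \<L>\<^sub>n_def L_def RL_def kn_def)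
  have PRSSL_eq: "PRSSL n \<omega> = RL n \<omega> + ((1 - kn n * inverse (\<L>\<^sub>n n \<omega>)) * of_bool (kn n < \<L>\<^sub>n n \<omega>)) *\<^sub>R (L n \<omega> - RL n \<omega>)" for n \<omega>
    by (simp add: PRSSL_def prss_lasso_def \<L>\<^sub>n_def L_def RL_def kn_def)
  have kn_lim: "kn \<longlonglongrightarrow> k"
  proof -
    have "(\<lambda>n. real (n - CARD('p)) / (real (n - CARD('p)) + 2)) \<longlonglongrightarrow> 1" by real_asymp
    from tendsto_mult[OF this tendsto_const[of k]] show ?thesis
      by (simp add: kn_def[abs_def] shrink_const_def k_def)
  qed
  have est_meas: "\<forall>\<^sub>F n in sequentially. PTL n \<in> borel_measurable M \<and> SSL n \<in> borel_measurable M \<and> PRSSL n \<in> borel_measurable M"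
    using meas RL_meas
  proof eventually_elim
    case (elim n)
    have [measurable]: "L n \<in> borel_measurable M" "RL n \<in> borel_measurable M" "\<L>\<^sub>n n \<in> borel_measurable M"
      using elim by auto
    show ?case unfolding PTL_eq[abs_def] SSL_eq[abs_def] PRSSL_eq[abs_def] by measurable
  qed

  have est_rep: "\<forall>\<^sub>F n in sequentially. \<forall>\<omega>.
      PTL n \<omega> = Lg n (V n \<omega>) - of_bool (Qg n \<xi> (s n \<omega>) (V n \<omega>) \<le> crit\<^sub>n n) *\<^sub>R Dg n (V n \<omega>) \<and>
      SSL n \<omega> = Lg n (V n \<omega>) - (kn n * inverse (Qg n \<xi> (s n \<omega>) (V n \<omega>))) *\<^sub>R Dg n (V n \<omega>) \<and>
      PRSSL n \<omega> = (Lg n (V n \<omega>) - Dg n (V n \<omega>)) +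
        ((1 - kn n * inverse (Qg n \<xi> (s n \<omega>) (V n \<omega>))) * of_bool (kn n < Qg n \<xi> (s n \<omega>) (V n \<omega>))) *\<^sub>R Dg n (V n \<omega>)"
    using rep RL_rep
  proof eventually_elim
    case (elim n)
    show ?case
    proof
      fix \<omega>
      have "L n \<omega> - RL n \<omega> = Dg n (V n \<omega>)" "L n \<omega> = Lg n (V n \<omega>)"
        "RL n \<omega> = Lg n (V n \<omega>) - Dg n (V n \<omega>)" "\<L>\<^sub>n n \<omega> = Qg n \<xi> (s n \<omega>) (V n \<omega>)"
        using elim by blast+
      then show "PTL n \<omega> = Lg n (V n \<omega>) - of_bool (Qg n \<xi> (s n \<omega>) (V n \<omega>) \<le> crit\<^sub>n n) *\<^sub>R Dg n (V n \<omega>) \<and>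
          SSL n \<omega> = Lg n (V n \<omega>) - (kn n * inverse (Qg n \<xi> (s n \<omega>) (V n \<omega>))) *\<^sub>R Dg n (V n \<omega>) \<and>
          PRSSL n \<omega> = (Lg n (V n \<omega>) - Dg n (V n \<omega>)) +
            ((1 - kn n * inverse (Qg n \<xi> (s n \<omega>) (V n \<omega>))) * of_bool (kn n < Qg n \<xi> (s n \<omega>) (V n \<omega>))) *\<^sub>R Dg n (V n \<omega>)"
        unfolding PTL_eq SSL_eq PRSSL_eq by (simp only: simp_thms)
    qed
  qed

  have part_iv_prob: "conv_in_prob M (\<lambda>n \<omega>. PTL n \<omega> - (\<eta> - of_bool (\<L>\<^sub>n n \<omega> \<le> crit\<^sub>n n) *\<^sub>R D)) (\<lambda>_. 0)"
  proof (rule mapping_const)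
    show "\<forall>\<^sub>F n in sequentially. (\<lambda>\<omega>. PTL n \<omega> - (\<eta> - of_bool (\<L>\<^sub>n n \<omega> \<le> crit\<^sub>n n) *\<^sub>R D)) \<in> borel_measurable M"
      using meas est_meas
    proof eventually_elim
      case (elim n)
      have [measurable]: "PTL n \<in> borel_measurable M" "\<L>\<^sub>n n \<in> borel_measurable M" using elim by auto
      show ?case by measurable
    qed
    show "\<forall>\<^sub>F n in sequentially. \<forall>\<omega>. PTL n \<omega> - (\<eta> - of_bool (\<L>\<^sub>n n \<omega> \<le> crit\<^sub>n n) *\<^sub>R D)
        = (Lg n (V n \<omega>) - \<eta>) - of_bool (Qg n \<xi> (s n \<omega>) (V n \<omega>) \<le> crit\<^sub>n n) *\<^sub>R (Dg n (V n \<omega>) - D)"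
      using est_rep rep by eventually_elim (simp add: algebra_simps)
    fix v
    have "((\<lambda>(n, v', t). Lg n v' - \<eta>) \<longlongrightarrow> 0) (?F v)" "((\<lambda>(n, v', t). Dg n v' - D) \<longlongrightarrow> 0) (?F v)"
      using LIM_zero[OF Lg_lim[of v]] LIM_zero[OF Dg_lim[of v]] by (simp_all add: case_prod_unfold)
    \<comment> \<open>Here even the level \<open>crit\<close> does no harm: the indicator is bounded and multiplies a null sequence.\<close>
    moreover from this(2) have "((\<lambda>(n, v', t). of_bool (Qg n \<xi> t v' \<le> crit\<^sub>n n) *\<^sub>R (Dg n v' - D)) \<longlongrightarrow> 0) (?F v)"
      by (rule Lim_null_comparison[rotated, OF tendsto_norm_zero]) (auto intro!: always_eventually)
    ultimately show "((\<lambda>(n, v', t). (Lg n v' - \<eta>) - of_bool (Qg n \<xi> t v' \<le> crit\<^sub>n n) *\<^sub>R (Dg n v' - D)) \<longlongrightarrow> 0) (?F v)"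
      using tendsto_diff by (fastforce simp: case_prod_unfold)
  qed
  have part_iv_distr: "conv_in_distr M PTL N (\<lambda>v. \<eta> - of_bool (\<L> v < crit) *\<^sub>R D)"
    unfolding \<L>_eq
  proof (rule mapping[OF _ _ level(1,2)])
    show "\<forall>\<^sub>F n in sequentially. PTL n \<in> borel_measurable M" using est_meas by (rule eventually_mono) simp
    show "\<forall>\<^sub>F n in sequentially. \<forall>\<omega>. PTL n \<omega> = Lg n (V n \<omega>) - of_bool (Qg n \<xi> (s n \<omega>) (V n \<omega>) \<le> crit\<^sub>n n) *\<^sub>R Dg n (V n \<omega>)"
      using est_rep by (rule eventually_mono) blast
    show "((\<lambda>(n, v', t). Lg n v' - of_bool (Qg n \<xi> t v' \<le> crit\<^sub>n n) *\<^sub>R Dg n v') \<longlongrightarrow> \<eta> - of_bool (Q v < crit) *\<^sub>R D) (?F v)"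
      if "v \<notin> {v. Q v = crit}" for v
      using tendsto_diff[OF Lg_lim[of v] tendsto_scaleR[OF tendsto_of_bool_less(2)[OF Qg_lim[of \<xi> v, folded Q_def] seq_lim[OF crit_lim]] Dg_lim]] that
      by (simp add: case_prod_unfold)
  qed measurable
  have inv_lim: "((\<lambda>(n, v', t). kn n * inverse (Qg n \<xi> t v')) \<longlongrightarrow> k * inverse (Q v)) (?F v)" if "Q v \<noteq> 0" for v
    using tendsto_mult[OF seq_lim[OF kn_lim] tendsto_inverse[OF Qg_lim[of \<xi> v, folded Q_def] that]]
    by (simp add: case_prod_unfold)
  have part_v: "conv_in_distr M SSL N (\<lambda>v. \<eta> - (k * inverse (\<L> v)) *\<^sub>R D)"
    unfolding \<L>_eq
  proof (rule mapping[OF _ _ level(1,2)])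
    show "\<forall>\<^sub>F n in sequentially. SSL n \<in> borel_measurable M" using est_meas by (rule eventually_mono) simp
    show "\<forall>\<^sub>F n in sequentially. \<forall>\<omega>. SSL n \<omega> = Lg n (V n \<omega>) - (kn n * inverse (Qg n \<xi> (s n \<omega>) (V n \<omega>))) *\<^sub>R Dg n (V n \<omega>)"
      using est_rep by (rule eventually_mono) blast
    show "((\<lambda>(n, v', t). Lg n v' - (kn n * inverse (Qg n \<xi> t v')) *\<^sub>R Dg n v') \<longlongrightarrow> \<eta> - (k * inverse (Q v)) *\<^sub>R D) (?F v)"
      if "v \<notin> {v. Q v = 0}" for v
      using tendsto_diff[OF Lg_lim[of v] tendsto_scaleR[OF inv_lim Dg_lim]] that
      by (simp add: case_prod_unfold)
  qed measurable
  have part_vi: "conv_in_distr M PRSSL N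
      (\<lambda>v. \<eta> - (k * inverse (\<L> v) + (1 - k * inverse (\<L> v)) * of_bool (\<L> v < k)) *\<^sub>R D)"
    unfolding \<L>_eq
  \<comment> \<open>Excluding the level \<open>k\<close> as well makes the indicator locally constant at all remaining points.\<close>
  proof (rule mapping[of _ _ "{v. Q v = 0} \<union> {v. Q v = k}"])
    show "\<forall>\<^sub>F n in sequentially. PRSSL n \<in> borel_measurable M" using est_meas by (rule eventually_mono) simp
    show "\<forall>\<^sub>F n in sequentially. \<forall>\<omega>. PRSSL n \<omega> = (Lg n (V n \<omega>) - Dg n (V n \<omega>)) +
        ((1 - kn n * inverse (Qg n \<xi> (s n \<omega>) (V n \<omega>))) * of_bool (kn n < Qg n \<xi> (s n \<omega>) (V n \<omega>))) *\<^sub>R Dg n (V n \<omega>)"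
      using est_rep by (rule eventually_mono) blast
    show "closed ({v. Q v = 0} \<union> {v. Q v = k})" by (intro closed_Un level)
    have "{\<omega> \<in> space N. W \<omega> \<in> {v. Q v = 0} \<union> {v. Q v = k}}
        = {\<omega> \<in> space N. W \<omega> \<in> {v. Q v = 0}} \<union> {\<omega> \<in> space N. W \<omega> \<in> {v. Q v = k}}" by auto
    moreover have "measure N ({\<omega> \<in> space N. W \<omega> \<in> {v. Q v = 0}} \<union> {\<omega> \<in> space N. W \<omega> \<in> {v. Q v = k}})
        \<le> measure N {\<omega> \<in> space N. W \<omega> \<in> {v. Q v = 0}} + measure N {\<omega> \<in> space N. W \<omega> \<in> {v. Q v = k}}"
      by (rule measure_Un_le) measurable
    ultimately show "measure N {\<omega> \<in> space N. W \<omega> \<in> {v. Q v = 0} \<union> {v. Q v = k}} = 0"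
      unfolding level(2) by (simp only: measure_le_0_iff add_0_left)
    show "((\<lambda>(n, v', t). (Lg n v' - Dg n v') +
          ((1 - kn n * inverse (Qg n \<xi> t v')) * of_bool (kn n < Qg n \<xi> t v')) *\<^sub>R Dg n v')
        \<longlongrightarrow> \<eta> - (k * inverse (Q v) + (1 - k * inverse (Q v)) * of_bool (Q v < k)) *\<^sub>R D) (?F v)"
      if v: "v \<notin> {v. Q v = 0} \<union> {v. Q v = k}" for v
    proof -
      have "Q v \<noteq> 0" "k \<noteq> Q v" using v by auto
      have "((\<lambda>(n, v', t). (Lg n v' - Dg n v') +
            ((1 - kn n * inverse (Qg n \<xi> t v')) * of_bool (kn n < Qg n \<xi> t v')) *\<^sub>R Dg n v')
          \<longlongrightarrow> (\<eta> - D) + ((1 - k * inverse (Q v)) * of_bool (k < Q v)) *\<^sub>R D) (?F v)"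
        using tendsto_add[OF tendsto_diff[OF Lg_lim[of v] Dg_lim[of v]]
            tendsto_scaleR[OF tendsto_mult[OF tendsto_diff[OF tendsto_const[of 1] inv_lim[OF \<open>Q v \<noteq> 0\<close>]]
              tendsto_of_bool_less(1)[OF seq_lim[OF kn_lim] Qg_lim[of \<xi> v, folded Q_def] \<open>k \<noteq> Q v\<close>]] Dg_lim]]
        by (simp add: case_prod_unfold)
      also have "(\<eta> - D) + ((1 - k * inverse (Q v)) * of_bool (k < Q v)) *\<^sub>R D
          = \<eta> - (k * inverse (Q v) + (1 - k * inverse (Q v)) * of_bool (Q v < k)) *\<^sub>R D"
        using \<open>k \<noteq> Q v\<close> by (cases "k < Q v") (auto simp: algebra_simps)
      finally show ?thesis .
    qed
  qed measurable
  show ?thesis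
    using part_i part_ii part_iii part_iv_prob part_iv_distr part_v part_vi by blast
qed

end
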